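(* Let $\alpha\in(-\pi,\pi)$ and let $(\delta_n)_{n\ge1}$ be a sequence of nonzero complex numbers with $\delta_n\to0$. With $\Delta(\delta)=\max(|1-\delta|,|1+\delta|)$, put $$B_1^{[\alpha,\delta]}=\frac{\pi-\alpha}{2}\,\frac1{\Delta(\delta)}\begin{bmatrix}\delta&-1\\1&-\delta\end{bmatrix},\qquad B_2^{[\alpha,\delta]}=\frac{\pi+\alpha}{2}\,\frac1{\Delta(\delta)}\begin{bmatrix}-\delta&-1\\1&\delta\end{bmatrix},$$ and let $$B_1=\bigoplus_{n=1}^\infty B_1^{[\alpha,\delta_n]},\qquad B_2=\bigoplus_{n=1}^\infty B_2^{[\alpha,\delta_n]}$$ be the direct sums acting on the Hilbert space direct sum $\bigoplus_{n=1}^\infty\mathbb C^2$. Then $\|B_1\|_2=\frac{\pi-\alpha}2$, $\|B_2\|_2=\frac{\pi+\alpha}2$, and the Magnus (BCH) expansion of $B_1,B_2$ is completely divergent. If all the $\delta_n$ are purely imaginary, then $B_1$ and $B_2$ are skew-Hermitian (and their exponentials are unitary); in that case their realifications are skew-symmetric and the exponentials of these are orthogonal.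
   Context: $\|\cdot\|_2$ is the operator norm. The Magnus (BCH) expansion of bounded operators $B_1,B_2$ is the series $\sum_{k\ge1}\mu_k$ where $\log(\exp(tB_1)\exp(tB_2))=\sum_{k\ge1}\mu_kt^k$ for small $|t|$, with $\log A=\int_0^1 (A-\mathrm{Id})(\lambda\,\mathrm{Id}+(1-\lambda)A)^{-1}d\lambda$ for $A$ with spectrum disjoint from $(-\infty,0]$. A series $\sum_{k\ge1}s_k$ in a Banach algebra $\mathfrak A$ is radially convergent to $S$ if there is a real-analytic function $s:(0,1)\to\mathfrak A$ such that $\sum_kt^ks_k$ converges to $s(t)$ for small $t>0$ and $\lim_{t\nearrow1}s(t)=S$ (in norm). This is weaker than Abel summability, and hence weaker than convergence. A series is completely divergent if it is not radially convergent to any element. *)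

theory Defs
  imports "HOL-Analysis.Analysis"
begin

text \<open>The Hilbert space direct sum of countably many copies of \<open>\<complex>\<^sup>2\<close>, with summands indexed from 0.\<close>

typedef hsum = "{x :: nat \<Rightarrow> complex^2. summable (\<lambda>n. (norm (x n))\<^sup>2)}"
  morphisms coord Abs_hsum
  by (intro exI[of _ "\<lambda>_. 0"]) simp

setup_lifting type_definition_hsum

lemma summable_coord: "summable (\<lambda>n. (norm (coord x n))\<^sup>2)"
  using coord[of x] by simp

lemma hsum_eqI: "(\<And>n. coord x n = coord y n) \<Longrightarrow> x = y"
  by (simp add: coord_inject[symmetric] fun_eq_iff)

lemma sq_add_le: "(norm (a + b :: 'a::real_normed_vector))\<^sup>2 \<le> 2 * (norm a)\<^sup>2 + 2 * (norm b)\<^sup>2"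
proof -
  have "(norm (a + b))\<^sup>2 \<le> (norm a + norm b)\<^sup>2"
    by (intro power_mono norm_triangle_ineq) auto
  also have "\<dots> \<le> 2 * (norm a)\<^sup>2 + 2 * (norm b)\<^sup>2"
    using zero_le_power2[of "norm a - norm b"] by (simp add: power2_eq_square algebra_simps)
  finally show ?thesis .
qed

lemma summable_sq_add:
  fixes f g :: "nat \<Rightarrow> 'a::real_normed_vector"
  assumes "summable (\<lambda>n. (norm (f n))\<^sup>2)" "summable (\<lambda>n. (norm (g n))\<^sup>2)"
  shows "summable (\<lambda>n. (norm (f n + g n))\<^sup>2)"
proof (rule summable_comparison_test')
  show "summable (\<lambda>n. 2 * (norm (f n))\<^sup>2 + 2 * (norm (g n))\<^sup>2)"
    by (intro summable_add summable_mult assms)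
  show "norm ((norm (f n + g n))\<^sup>2) \<le> 2 * (norm (f n))\<^sup>2 + 2 * (norm (g n))\<^sup>2" for n
    using sq_add_le[of "f n" "g n"] by simp
qed

lemma mult_le_sq_add: "a \<ge> 0 \<Longrightarrow> b \<ge> 0 \<Longrightarrow> a * b \<le> a\<^sup>2 + b\<^sup>2" for a b :: real
proof -
  assume "a \<ge> 0" "b \<ge> 0"
  hence "0 \<le> a * b" by simp
  thus ?thesis using sum_squares_bound[of a b] by linarith
qed

lemma summable_inner_coord: "summable (\<lambda>n. inner (coord x n) (coord y n))"
proof (rule summable_comparison_test')
  show "summable (\<lambda>n. (norm (coord x n))\<^sup>2 + (norm (coord y n))\<^sup>2)"
    by (intro summable_add summable_coord)
  show "norm (inner (coord x n) (coord y n)) \<le> (norm (coord x n))\<^sup>2 + (norm (coord y n))\<^sup>2" for n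
  proof -
    have "norm (inner (coord x n) (coord y n)) \<le> norm (coord x n) * norm (coord y n)"
      by (simp add: Cauchy_Schwarz_ineq2)
    also have "\<dots> \<le> (norm (coord x n))\<^sup>2 + (norm (coord y n))\<^sup>2"
      by (rule mult_le_sq_add) simp_all
    finally show ?thesis .
  qed
qed

text \<open>
  The class \<^class>\<open>real_inner\<close> records the underlying real Hilbert space, so its
  inner product is the real part of the Hermitian product \<open>cinner\<close> defined below; both
  induce the same norm.
\<close>

instantiation hsum :: real_inner
begin

lift_definition zero_hsum :: hsum is "\<lambda>_. 0" by simp
lift_definition plus_hsum :: "hsum \<Rightarrow> hsum \<Rightarrow> hsum" is "\<lambda>x y n. x n + y n"
  by (rule summable_sq_add)
lift_definition uminus_hsum :: "hsum \<Rightarrow> hsum" is "\<lambda>x n. - x n" by simp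
lift_definition minus_hsum :: "hsum \<Rightarrow> hsum \<Rightarrow> hsum" is "\<lambda>x y n. x n - y n"
proof -
  fix x y :: "nat \<Rightarrow> complex^2"
  assume "summable (\<lambda>n. (norm (x n))\<^sup>2)" "summable (\<lambda>n. (norm (y n))\<^sup>2)"
  thus "summable (\<lambda>n. (norm (x n - y n))\<^sup>2)"
    using summable_sq_add[of x "\<lambda>n. - y n"] by simp
qed
lift_definition scaleR_hsum :: "real \<Rightarrow> hsum \<Rightarrow> hsum" is "\<lambda>r x n. r *\<^sub>R x n"
  by (simp add: power_mult_distrib summable_mult)

definition inner_hsum :: "hsum \<Rightarrow> hsum \<Rightarrow> real" where
  "inner_hsum x y = (\<Sum>n. inner (coord x n) (coord y n))"
definition norm_hsum :: "hsum \<Rightarrow> real" where "norm_hsum x = sqrt (inner x x)"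
definition dist_hsum :: "hsum \<Rightarrow> hsum \<Rightarrow> real" where "dist_hsum x y = norm (x - y)"
definition sgn_hsum :: "hsum \<Rightarrow> hsum" where "sgn_hsum x = inverse (norm x) *\<^sub>R x"
definition uniformity_hsum :: "(hsum \<times> hsum) filter" where
  "uniformity_hsum = (INF e\<in>{0<..}. principal {(x, y). dist x y < e})"
definition open_hsum :: "hsum set \<Rightarrow> bool" where
  "open_hsum U = (\<forall>x\<in>U. eventually (\<lambda>(x', y). x' = x \<longrightarrow> y \<in> U) uniformity)"

instance
proof
  fix x y z :: hsum and a b r :: real
  show "x + y + z = x + (y + z)" by transfer (simp add: add.assoc)
  show "x + y = y + x" by transfer (simp add: add.commute)
  show "0 + x = x" by transfer simp
  show "- x + x = 0" by transfer simp
  show "x - y = x + - y" by transfer simp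
  show "a *\<^sub>R (x + y) = a *\<^sub>R x + a *\<^sub>R y" by transfer (simp add: scaleR_add_right)
  show "(a + b) *\<^sub>R x = a *\<^sub>R x + b *\<^sub>R x" by transfer (simp add: scaleR_add_left)
  show "a *\<^sub>R b *\<^sub>R x = (a * b) *\<^sub>R x" by transfer simp
  show "1 *\<^sub>R x = x" by transfer simp
  show "dist x y = norm (x - y)" by (rule dist_hsum_def)
  show "sgn x = inverse (norm x) *\<^sub>R x" by (rule sgn_hsum_def)
  show "uniformity = (INF e\<in>{0<..}. principal {(x :: hsum, y). dist x y < e})"
    by (rule uniformity_hsum_def)
  show "open U = (\<forall>x\<in>U. \<forall>\<^sub>F (x', y) in uniformity. x' = x \<longrightarrow> y \<in> U)" for U :: "hsum set"
    by (rule open_hsum_def)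
  show "inner x y = inner y x"
    by (simp add: inner_hsum_def inner_commute)
  show "inner (x + y) z = inner x z + inner y z"
    by (simp add: inner_hsum_def plus_hsum.rep_eq inner_add_left suminf_add
        summable_inner_coord)
  show "inner (r *\<^sub>R x) y = r * inner x y"
    by (simp add: inner_hsum_def scaleR_hsum.rep_eq suminf_mult summable_inner_coord)
  show "0 \<le> inner x x"
    unfolding inner_hsum_def by (intro suminf_nonneg summable_inner_coord) simp
  show "inner x x = 0 \<longleftrightarrow> x = 0"
  proof
    assume "inner x x = 0"
    hence "\<forall>n. inner (coord x n) (coord x n) = 0"
      unfolding inner_hsum_def by (subst (asm) suminf_eq_zero_iff) (auto simp: summable_inner_coord)
    thus "x = 0" by (intro hsum_eqI) (simp add: zero_hsum.rep_eq)
  qed (simp add: inner_hsum_def zero_hsum.rep_eq)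
  show "norm x = sqrt (inner x x)" by (rule norm_hsum_def)
qed

end

lemma norm_hsum_sq: "(norm x)\<^sup>2 = (\<Sum>n. (norm (coord x n))\<^sup>2)" for x :: hsum
  by (simp add: power2_norm_eq_inner inner_hsum_def)

lemma sum_coord_le: "(\<Sum>n<N. (norm (coord x n))\<^sup>2) \<le> (norm x)\<^sup>2"
  unfolding norm_hsum_sq by (intro sum_le_suminf summable_coord) auto

lemma norm_coord_le: "norm (coord x n) \<le> norm x"
proof (rule power2_le_imp_le)
  have "(norm (coord x n))\<^sup>2 \<le> (\<Sum>n<Suc n. (norm (coord x n))\<^sup>2)"
    by (simp add: sum_nonneg)
  also have "\<dots> \<le> (norm x)\<^sup>2" by (rule sum_coord_le)
  finally show "(norm (coord x n))\<^sup>2 \<le> (norm x)\<^sup>2" .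
qed simp

instance hsum :: banach
proof
  fix X :: "nat \<Rightarrow> hsum"
  assume C: "Cauchy X"
  have "Cauchy (\<lambda>m. coord (X m) n)" for n
  proof (rule CauchyI)
    fix e :: real assume "e > 0"
    then obtain M where "\<forall>m\<ge>M. \<forall>k\<ge>M. norm (X m - X k) < e" using CauchyD[OF C] by blast
    moreover have "norm (coord (X m) n - coord (X k) n) \<le> norm (X m - X k)" for m k
      using norm_coord_le[of "X m - X k" n] by (simp add: minus_hsum.rep_eq)
    ultimately show "\<exists>M. \<forall>m\<ge>M. \<forall>k\<ge>M. norm (coord (X m) n - coord (X k) n) < e"
      by (meson le_less_trans)
  qed
  hence "\<forall>n. \<exists>l. (\<lambda>m. coord (X m) n) \<longlonglongrightarrow> l"
    by (simp add: Cauchy_convergent_iff convergent_def)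
  then obtain l where l: "\<And>n. (\<lambda>m. coord (X m) n) \<longlonglongrightarrow> l n" by metis
  have key: "\<exists>M. \<forall>m\<ge>M. \<forall>N. (\<Sum>n<N. (norm (coord (X m) n - l n))\<^sup>2) \<le> e\<^sup>2" if "e > 0" for e :: real
  proof -
    obtain M where M: "\<And>m k. m \<ge> M \<Longrightarrow> k \<ge> M \<Longrightarrow> norm (X m - X k) < e"
      using CauchyD[OF C \<open>e > 0\<close>] by blast
    have "(\<Sum>n<N. (norm (coord (X m) n - l n))\<^sup>2) \<le> e\<^sup>2" if m: "m \<ge> M" for m N
    proof (rule LIMSEQ_le_const2)
      show "(\<lambda>k. \<Sum>n<N. (norm (coord (X m) n - coord (X k) n))\<^sup>2)
          \<longlonglongrightarrow> (\<Sum>n<N. (norm (coord (X m) n - l n))\<^sup>2)"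
        by (intro tendsto_intros l)
      have "(\<Sum>n<N. (norm (coord (X m) n - coord (X k) n))\<^sup>2) \<le> e\<^sup>2" if "k \<ge> M" for k
      proof -
        have "(\<Sum>n<N. (norm (coord (X m) n - coord (X k) n))\<^sup>2) \<le> (norm (X m - X k))\<^sup>2"
          using sum_coord_le[of "X m - X k" N] by (simp add: minus_hsum.rep_eq)
        also have "\<dots> \<le> e\<^sup>2" using M[OF m that] by (intro power_mono) auto
        finally show ?thesis .
      qed
      thus "\<exists>K. \<forall>k\<ge>K. (\<Sum>n<N. (norm (coord (X m) n - coord (X k) n))\<^sup>2) \<le> e\<^sup>2" by blast
    qed
    thus ?thesis by blast
  qed
  have diff: "summable (\<lambda>n. (norm (coord (X m) n - l n))\<^sup>2)"
    if "\<forall>N. (\<Sum>n<N. (norm (coord (X m) n - l n))\<^sup>2) \<le> e\<^sup>2" for m e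
    by (rule summableI_nonneg_bounded[where x = "e\<^sup>2"]) (use that in auto)
  have "summable (\<lambda>n. (norm (l n))\<^sup>2)"
  proof -
    obtain m where "\<forall>N. (\<Sum>n<N. (norm (coord (X m) n - l n))\<^sup>2) \<le> 1\<^sup>2"
      using key[of 1] by auto
    hence "summable (\<lambda>n. (norm (coord (X m) n - l n))\<^sup>2)" by (rule diff)
    from summable_sq_add[OF summable_coord[of "- X m"] this] show ?thesis
      by (simp add: uminus_hsum.rep_eq)
  qed
  hence L: "coord (Abs_hsum l) = l" by (simp only: Abs_hsum_inverse mem_Collect_eq)
  define L where "L = Abs_hsum l"
  note L = L[folded L_def]
  have "X \<longlonglongrightarrow> L"
  proof (rule LIMSEQ_I)
    fix r :: real assume "r > 0"
    then obtain M where M: "\<And>m N. m \<ge> M \<Longrightarrow> (\<Sum>n<N. (norm (coord (X m) n - l n))\<^sup>2) \<le> (r/2)\<^sup>2"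
      using key[of "r/2"] by auto
    have "norm (X m - L) < r" if "m \<ge> M" for m
    proof -
      have "(norm (X m - L))\<^sup>2 \<le> (r/2)\<^sup>2"
        unfolding norm_hsum_sq minus_hsum.rep_eq L
        by (intro suminf_le_const diff[where e = "r/2"] allI M that)
      hence "norm (X m - L) \<le> r/2" using \<open>r > 0\<close> by (auto intro: power2_le_imp_le[of _ "r/2"])
      thus ?thesis using \<open>r > 0\<close> by simp
    qed
    thus "\<exists>no. \<forall>n\<ge>no. norm (X n - L) < r" by blast
  qed
  thus "convergent X" by (rule convergentI)
qed

instance hsum :: perfect_space
proof
  fix x :: hsum
  show "\<not> open {x}"
  proof
    assume "open {x}"
    then obtain e where "e > 0" and e: "\<And>y. dist y x < e \<Longrightarrow> y = x"
      unfolding open_dist by blast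
    have "summable (\<lambda>n. (norm (if n = 0 then axis 1 1 else 0 :: complex^2))\<^sup>2)"
      by (rule summable_finite[of "{0}"]) auto
    moreover define u where "u = Abs_hsum (\<lambda>n. if n = 0 then axis 1 1 else 0)"
    ultimately have u: "coord u = (\<lambda>n. if n = 0 then axis 1 1 else 0)"
      by (simp only: u_def Abs_hsum_inverse mem_Collect_eq)
    have "u \<noteq> 0"
    proof
      assume "u = 0"
      hence "coord u 0 $ 1 = 0" by (simp add: zero_hsum.rep_eq)
      thus False by (simp add: u)
    qed
    have "x + (e / (2 * norm u)) *\<^sub>R u = x"
      by (rule e) (use \<open>e > 0\<close> \<open>u \<noteq> 0\<close> in \<open>simp add: dist_norm\<close>)
    thus False using \<open>e > 0\<close> \<open>u \<noteq> 0\<close> by simp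
  qed
qed

lift_definition scaleC_hsum :: "complex \<Rightarrow> hsum \<Rightarrow> hsum" (infixr \<open>*\<^sub>C\<close> 75)
  is "\<lambda>c x n. c *s x n"
  by (simp add: norm_vec_def vector_scalar_mult_def norm_mult L2_set_right_distrib[symmetric]
      power_mult_distrib summable_mult)

lemma norm_scaleC: "norm (c *\<^sub>C x) = cmod c * norm x"
proof -
  have "(norm (c *\<^sub>C x))\<^sup>2 = (cmod c * norm x)\<^sup>2"
    unfolding power_mult_distrib norm_hsum_sq scaleC_hsum.rep_eq
    by (simp add: norm_vec_def vector_scalar_mult_def norm_mult L2_set_right_distrib[symmetric]
        power_mult_distrib suminf_mult summable_coord[unfolded norm_vec_def])
  thus ?thesis by (subst (asm) power2_eq_iff_nonneg) auto
qed

lemma scaleC_add: "c *\<^sub>C (x + y) = c *\<^sub>C x + c *\<^sub>C y"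
  by transfer (simp add: vector_add_ldistrib)

lemma scaleC_scaleR: "c *\<^sub>C (r *\<^sub>R x) = r *\<^sub>R (c *\<^sub>C x)"
  by transfer (simp add: vec_eq_iff fun_eq_iff)

lemma scaleC_scaleC: "c *\<^sub>C (d *\<^sub>C x) = (c * d) *\<^sub>C x"
  by transfer (simp add: vec_eq_iff fun_eq_iff)

lemma bounded_linear_scaleC: "bounded_linear ((*\<^sub>C) c)"
  by (rule bounded_linear_intro[of _ "cmod c"])
    (simp_all add: scaleC_add scaleC_scaleR norm_scaleC mult.commute)

lemma scaleC_of_real: "of_real r *\<^sub>C x = r *\<^sub>R x"
  by transfer (simp add: vec_eq_iff fun_eq_iff scaleR_conv_of_real[where ?'a = complex])

definition cinner :: "hsum \<Rightarrow> hsum \<Rightarrow> complex" where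
  "cinner x y = (\<Sum>n. \<Sum>i\<in>UNIV. cnj (coord x n $ i) * coord y n $ i)"

lemma summable_cinner: "summable (\<lambda>n. \<Sum>i\<in>UNIV. cnj (coord x n $ i) * coord y n $ i)"
proof (rule summable_comparison_test')
  show "summable (\<lambda>n. 2 * ((norm (coord x n))\<^sup>2 + (norm (coord y n))\<^sup>2))"
    by (intro summable_mult summable_add summable_coord)
  fix n
  have "norm (cnj (coord x n $ i) * coord y n $ i) \<le> (norm (coord x n))\<^sup>2 + (norm (coord y n))\<^sup>2" for i
  proof -
    have "norm (cnj (coord x n $ i) * coord y n $ i) \<le> norm (coord x n) * norm (coord y n)"
      by (simp add: norm_mult mult_mono Finite_Cartesian_Product.norm_nth_le)
    also have "\<dots> \<le> (norm (coord x n))\<^sup>2 + (norm (coord y n))\<^sup>2"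
      by (rule mult_le_sq_add) simp_all
    finally show ?thesis .
  qed
  hence "norm (\<Sum>i\<in>UNIV. cnj (coord x n $ i) * coord y n $ i)
      \<le> (\<Sum>i\<in>(UNIV :: 2 set). (norm (coord x n))\<^sup>2 + (norm (coord y n))\<^sup>2)"
    by (intro sum_norm_le) auto
  thus "norm (\<Sum>i\<in>UNIV. cnj (coord x n $ i) * coord y n $ i)
      \<le> 2 * ((norm (coord x n))\<^sup>2 + (norm (coord y n))\<^sup>2)" by simp
qed

lemma Re_cinner: "Re (cinner x y) = inner x y"
  unfolding cinner_def inner_hsum_def
  by (subst Re_suminf[OF summable_cinner])
    (simp add: inner_vec_def inner_complex_def)

lemma cinner_self: "cinner x x = of_real ((norm x)\<^sup>2)"
  unfolding cinner_def norm_hsum_sq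
proof (subst suminf_of_real[OF summable_coord], rule suminf_cong)
  fix n
  have "(norm (coord x n))\<^sup>2 = (\<Sum>i\<in>UNIV. (cmod (coord x n $ i))\<^sup>2)"
    by (simp add: norm_vec_def L2_set_def sum_nonneg)
  thus "(\<Sum>i\<in>UNIV. cnj (coord x n $ i) * coord x n $ i) = of_real ((norm (coord x n))\<^sup>2)"
    by (simp only: of_real_sum complex_norm_square mult.commute)
qed

text \<open>
  \<open>'a bop\<close> is a copy of the space of bounded real-linear endomorphisms of \<open>'a\<close>
  carrying the ring structure given by composition (the binary type constructor
  \<open>blinfun\<close> cannot be made an instance of the ring classes).
  The norm is the operator norm.
\<close>

typedef (overloaded) 'a bop = "UNIV :: ('a::real_normed_vector \<Rightarrow>\<^sub>L 'a) set"
  morphisms blinfun_of_bop Bop ..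

setup_lifting type_definition_bop

instantiation bop :: (real_normed_vector) real_normed_algebra
begin

lift_definition zero_bop :: "'a bop" is 0 .
lift_definition plus_bop :: "'a bop \<Rightarrow> 'a bop \<Rightarrow> 'a bop" is "(+)" .
lift_definition uminus_bop :: "'a bop \<Rightarrow> 'a bop" is uminus .
lift_definition minus_bop :: "'a bop \<Rightarrow> 'a bop \<Rightarrow> 'a bop" is "(-)" .
lift_definition times_bop :: "'a bop \<Rightarrow> 'a bop \<Rightarrow> 'a bop" is "(o\<^sub>L)" .
lift_definition scaleR_bop :: "real \<Rightarrow> 'a bop \<Rightarrow> 'a bop" is "(*\<^sub>R)" .
lift_definition norm_bop :: "'a bop \<Rightarrow> real" is norm .
lift_definition dist_bop :: "'a bop \<Rightarrow> 'a bop \<Rightarrow> real" is dist .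
lift_definition sgn_bop :: "'a bop \<Rightarrow> 'a bop" is sgn .
definition uniformity_bop :: "('a bop \<times> 'a bop) filter" where
  "uniformity_bop = (INF e\<in>{0<..}. principal {(x, y). dist x y < e})"
definition open_bop :: "'a bop set \<Rightarrow> bool" where
  "open_bop U = (\<forall>x\<in>U. eventually (\<lambda>(x', y). x' = x \<longrightarrow> y \<in> U) uniformity)"

instance
proof
  fix x y z :: "'a bop" and a b :: real
  show "x + y + z = x + (y + z)" by transfer (simp add: add.assoc)
  show "x + y = y + x" by transfer (simp add: add.commute)
  show "0 + x = x" by transfer simp
  show "- x + x = 0" by transfer simp
  show "x - y = x + - y" by transfer simp
  show "a *\<^sub>R (x + y) = a *\<^sub>R x + a *\<^sub>R y" by transfer (simp add: scaleR_add_right)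
  show "(a + b) *\<^sub>R x = a *\<^sub>R x + b *\<^sub>R x" by transfer (simp add: scaleR_add_left)
  show "a *\<^sub>R b *\<^sub>R x = (a * b) *\<^sub>R x" by transfer simp
  show "1 *\<^sub>R x = x" by transfer simp
  show "x * y * z = x * (y * z)" by transfer (simp add: blinfun_eqI)
  show "(x + y) * z = x * z + y * z" by transfer (simp add: blinfun_eqI blinfun.bilinear_simps)
  show "x * (y + z) = x * y + x * z" by transfer (simp add: blinfun_eqI blinfun.bilinear_simps)
  show "a *\<^sub>R x * y = a *\<^sub>R (x * y)" by transfer (simp add: blinfun_eqI blinfun.bilinear_simps)
  show "x * a *\<^sub>R y = a *\<^sub>R (x * y)" by transfer (simp add: blinfun_eqI blinfun.bilinear_simps)
  show "dist x y = norm (x - y)" by transfer (simp add: dist_norm)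
  show "sgn x = inverse (norm x) *\<^sub>R x" by transfer (simp add: sgn_div_norm)
  show "uniformity = (INF e\<in>{0<..}. principal {(x :: 'a bop, y). dist x y < e})"
    by (rule uniformity_bop_def)
  show "open U = (\<forall>x\<in>U. \<forall>\<^sub>F (x', y) in uniformity. x' = x \<longrightarrow> y \<in> U)" for U :: "'a bop set"
    by (rule open_bop_def)
  show "norm x = 0 \<longleftrightarrow> x = 0" by transfer simp
  show "norm (x + y) \<le> norm x + norm y" by transfer (rule norm_triangle_ineq)
  show "norm (a *\<^sub>R x) = \<bar>a\<bar> * norm x" by transfer simp
  show "norm (x * y) \<le> norm x * norm y" by transfer (rule norm_blinfun_compose)
qed

end

instantiation bop :: ("{real_normed_vector,perfect_space}") real_normed_algebra_1
begin

lift_definition one_bop :: "'a bop" is id_blinfun .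

instance
proof
  fix x :: "'a bop"
  show "1 * x = x" by transfer (simp add: blinfun_eqI)
  show "x * 1 = x" by transfer (simp add: blinfun_eqI)
  show "norm (1 :: 'a bop) = 1" by transfer simp
  thus "(0 :: 'a bop) \<noteq> 1" by (metis norm_zero zero_neq_one)
qed

end

instance bop :: (banach) banach
proof
  fix X :: "nat \<Rightarrow> 'a bop"
  assume "Cauchy X"
  hence "Cauchy (\<lambda>n. blinfun_of_bop (X n))" by (simp add: Cauchy_def dist_bop.rep_eq)
  then obtain L where "(\<lambda>n. blinfun_of_bop (X n)) \<longlonglongrightarrow> L"
    using Cauchy_convergent convergent_def by blast
  hence "X \<longlonglongrightarrow> Bop L"
    by (simp add: tendsto_iff dist_bop.rep_eq Bop_inverse)
  thus "convergent X" by (rule convergentI)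
qed

definition bop_apply :: "'a::real_normed_vector bop \<Rightarrow> 'a \<Rightarrow> 'a" where
  "bop_apply A = blinfun_apply (blinfun_of_bop A)"

lemma bop_eqI: "(\<And>x. bop_apply A x = bop_apply B x) \<Longrightarrow> A = B"
  by (simp add: bop_apply_def blinfun_eqI blinfun_of_bop_inject[symmetric])

lemma bop_apply_simps:
  "bop_apply 0 x = 0"
  "bop_apply (A + B) x = bop_apply A x + bop_apply B x"
  "bop_apply (A - B) x = bop_apply A x - bop_apply B x"
  "bop_apply (- A) x = - bop_apply A x"
  "bop_apply (r *\<^sub>R A) x = r *\<^sub>R bop_apply A x"
  "bop_apply (A * B) x = bop_apply A (bop_apply B x)"
  by (simp_all add: bop_apply_def zero_bop.rep_eq plus_bop.rep_eq minus_bop.rep_eq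
      uminus_bop.rep_eq scaleR_bop.rep_eq times_bop.rep_eq blinfun.bilinear_simps)

lemma bop_apply_one: "bop_apply (1 :: 'a::{real_normed_vector,perfect_space} bop) x = x"
  by (simp add: bop_apply_def one_bop.rep_eq)

lemma bounded_linear_bop_apply: "bounded_linear (bop_apply A)"
  by (simp add: bop_apply_def blinfun.bounded_linear_right)

lemma norm_bop_apply: "norm (bop_apply A x) \<le> norm A * norm x"
  by (simp add: bop_apply_def norm_bop.rep_eq norm_blinfun)

lemma norm_bop_eq_onorm: "norm A = onorm (bop_apply A)"
  by (simp add: bop_apply_def norm_bop.rep_eq norm_blinfun.rep_eq)

text \<open>The complex Banach algebra of bounded complex-linear operators; the morphism
  \<open>realify\<close> forgets the complex structure.\<close>

typedef cop = "{A :: hsum bop. \<forall>c x. bop_apply A (c *\<^sub>C x) = c *\<^sub>C bop_apply A x}"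
  morphisms realify Abs_cop
  by (intro exI[of _ 1]) (simp add: bop_apply_one)

setup_lifting type_definition_cop

lemma scaleC_simps:
  "c *\<^sub>C 0 = 0" "c *\<^sub>C (x - y) = c *\<^sub>C x - c *\<^sub>C y" "c *\<^sub>C (- x) = - (c *\<^sub>C x)"
  using bounded_linear_scaleC[of c]
  by (simp_all add: linear_simps)

instantiation cop :: real_normed_algebra_1
begin

lift_definition zero_cop :: cop is 0 by (simp add: bop_apply_simps scaleC_simps)
lift_definition one_cop :: cop is 1 by (simp add: bop_apply_one)
lift_definition plus_cop :: "cop \<Rightarrow> cop \<Rightarrow> cop" is "(+)"
  by (simp add: bop_apply_simps scaleC_add)
lift_definition uminus_cop :: "cop \<Rightarrow> cop" is uminus
  by (simp add: bop_apply_simps scaleC_simps)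
lift_definition minus_cop :: "cop \<Rightarrow> cop \<Rightarrow> cop" is "(-)"
  by (simp add: bop_apply_simps scaleC_simps)
lift_definition times_cop :: "cop \<Rightarrow> cop \<Rightarrow> cop" is "(*)"
  by (simp add: bop_apply_simps)
lift_definition scaleR_cop :: "real \<Rightarrow> cop \<Rightarrow> cop" is "(*\<^sub>R)"
  by (simp add: bop_apply_simps scaleC_scaleR)
lift_definition norm_cop :: "cop \<Rightarrow> real" is norm .
lift_definition dist_cop :: "cop \<Rightarrow> cop \<Rightarrow> real" is dist .
lift_definition sgn_cop :: "cop \<Rightarrow> cop" is sgn
  by (simp add: sgn_div_norm bop_apply_simps scaleC_scaleR)
definition uniformity_cop :: "(cop \<times> cop) filter" where
  "uniformity_cop = (INF e\<in>{0<..}. principal {(x, y). dist x y < e})"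
definition open_cop :: "cop set \<Rightarrow> bool" where
  "open_cop U = (\<forall>x\<in>U. eventually (\<lambda>(x', y). x' = x \<longrightarrow> y \<in> U) uniformity)"

instance
proof
  fix x y z :: cop and a b :: real
  show "x + y + z = x + (y + z)" by transfer (simp add: add.assoc)
  show "x + y = y + x" by transfer (simp add: add.commute)
  show "0 + x = x" by transfer simp
  show "- x + x = 0" by transfer simp
  show "x - y = x + - y" by transfer simp
  show "a *\<^sub>R (x + y) = a *\<^sub>R x + a *\<^sub>R y" by transfer (simp add: scaleR_add_right)
  show "(a + b) *\<^sub>R x = a *\<^sub>R x + b *\<^sub>R x" by transfer (simp add: scaleR_add_left)
  show "a *\<^sub>R b *\<^sub>R x = (a * b) *\<^sub>R x" by transfer simp
  show "1 *\<^sub>R x = x" by transfer simp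
  show "x * y * z = x * (y * z)" by transfer (simp add: mult.assoc)
  show "(x + y) * z = x * z + y * z" by transfer (simp add: distrib_right)
  show "x * (y + z) = x * y + x * z" by transfer (simp add: distrib_left)
  show "a *\<^sub>R x * y = a *\<^sub>R (x * y)" by transfer simp
  show "x * a *\<^sub>R y = a *\<^sub>R (x * y)" by transfer simp
  show "1 * x = x" by transfer simp
  show "x * 1 = x" by transfer simp
  show "(0 :: cop) \<noteq> 1" by transfer simp
  show "dist x y = norm (x - y)" by transfer (simp add: dist_norm)
  show "sgn x = inverse (norm x) *\<^sub>R x" by transfer (simp add: sgn_div_norm)
  show "uniformity = (INF e\<in>{0<..}. principal {(x :: cop, y). dist x y < e})"
    by (rule uniformity_cop_def)
  show "open U = (\<forall>x\<in>U. \<forall>\<^sub>F (x', y) in uniformity. x' = x \<longrightarrow> y \<in> U)" for U :: "cop set"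
    by (rule open_cop_def)
  show "norm x = 0 \<longleftrightarrow> x = 0" by transfer simp
  show "norm (x + y) \<le> norm x + norm y" by transfer (rule norm_triangle_ineq)
  show "norm (a *\<^sub>R x) = \<bar>a\<bar> * norm x" by transfer simp
  show "norm (x * y) \<le> norm x * norm y" by transfer (rule norm_mult_ineq)
  show "norm (1 :: cop) = 1" by transfer simp
qed

end

lemma bop_apply_tendsto:
  assumes "(f \<longlongrightarrow> L) F" shows "((\<lambda>n. bop_apply (f n) x) \<longlongrightarrow> bop_apply L x) F"
proof -
  have "bounded_linear (\<lambda>A. bop_apply A x)"
    by (rule bounded_linear_intro[of _ "norm x"])
      (simp_all add: bop_apply_simps norm_bop_apply)
  from bounded_linear.tendsto[OF this assms] show ?thesis .
qed

instance cop :: banach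
proof
  fix X :: "nat \<Rightarrow> cop"
  assume "Cauchy X"
  hence "Cauchy (\<lambda>n. realify (X n))" by (simp add: Cauchy_def dist_cop.rep_eq)
  then obtain L where L: "(\<lambda>n. realify (X n)) \<longlonglongrightarrow> L"
    using Cauchy_convergent convergent_def by blast
  have "bop_apply L (c *\<^sub>C x) = c *\<^sub>C bop_apply L x" for c x
  proof (rule LIMSEQ_unique)
    show "(\<lambda>n. bop_apply (realify (X n)) (c *\<^sub>C x)) \<longlonglongrightarrow> bop_apply L (c *\<^sub>C x)"
      by (rule bop_apply_tendsto[OF L])
    have "(\<lambda>n. c *\<^sub>C bop_apply (realify (X n)) x) \<longlonglongrightarrow> c *\<^sub>C bop_apply L x"
      by (rule bounded_linear.tendsto[OF bounded_linear_scaleC bop_apply_tendsto[OF L]])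
    thus "(\<lambda>n. bop_apply (realify (X n)) (c *\<^sub>C x)) \<longlonglongrightarrow> c *\<^sub>C bop_apply L x"
      using realify by simp
  qed
  hence "realify (Abs_cop L) = L" by (simp add: Abs_cop_inverse)
  hence "X \<longlonglongrightarrow> Abs_cop L"
    using L by (simp add: tendsto_iff dist_cop.rep_eq)
  thus "convergent X" by (rule convergentI)
qed

definition cop_apply :: "cop \<Rightarrow> hsum \<Rightarrow> hsum" where
  "cop_apply A = bop_apply (realify A)"

lemma norm_cop_eq_onorm: "norm A = onorm (cop_apply A)"
  by (simp add: norm_cop.rep_eq norm_bop_eq_onorm cop_apply_def)

lift_definition cop_of_complex :: "complex \<Rightarrow> cop" is "\<lambda>c. Bop (Blinfun ((*\<^sub>C) c))"
  by (simp add: bop_apply_def Bop_inverse bounded_linear_Blinfun_apply bounded_linear_scaleC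
      scaleC_scaleC mult.commute)

lemma cop_apply_of_complex: "cop_apply (cop_of_complex c) x = c *\<^sub>C x"
  by (simp add: cop_apply_def cop_of_complex.rep_eq bop_apply_def Bop_inverse
      bounded_linear_Blinfun_apply bounded_linear_scaleC)

text \<open>The direct sum of a family of matrices; the junk value 0 is used for families that are not
  uniformly bounded.\<close>

definition direct_sum :: "(nat \<Rightarrow> complex^2^2) \<Rightarrow> cop" where
  "direct_sum M = (if bdd_above (range (\<lambda>n. onorm ((*v) (M n))))
    then Abs_cop (Bop (Blinfun (\<lambda>x. Abs_hsum (\<lambda>n. M n *v coord x n)))) else 0)"

lemma direct_sum_apply:
  assumes "bdd_above (range (\<lambda>n. onorm ((*v) (M n))))"
  shows "coord (cop_apply (direct_sum M) x) n = M n *v coord x n"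
proof -
  obtain K where K: "\<And>n. onorm ((*v) (M n)) \<le> K"
    using assms unfolding bdd_above_def by auto
  have "K \<ge> 0" using onorm_pos_le[OF matrix_vector_mul_bounded_linear[of "M 0"]] K[of 0] by simp
  have le: "norm (M n *v v) \<le> K * norm v" for n v
    using onorm[OF matrix_vector_mul_bounded_linear[of "M n"], of v]
      mult_right_mono[OF K[of n] norm_ge_zero[of v]] by simp
  have le2: "(norm (M n *v v))\<^sup>2 \<le> K\<^sup>2 * (norm v)\<^sup>2" for n v
    using power_mono[OF le[of n v] norm_ge_zero, of 2] by (simp add: power_mult_distrib)
  define T where "T = (\<lambda>x. Abs_hsum (\<lambda>n. M n *v coord x n))"
  have sm: "summable (\<lambda>n. (norm (M n *v coord x n))\<^sup>2)" for x
    by (rule summable_comparison_test'[OF summable_mult[OF summable_coord[of x], of "K\<^sup>2"]])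
      (simp add: le2)
  have T: "coord (T x) = (\<lambda>n. M n *v coord x n)" for x
    unfolding T_def by (rule Abs_hsum_inverse) (simp add: sm)
  have "bounded_linear T"
  proof (rule bounded_linear_intro[of _ K])
    show "T (x + y) = T x + T y" for x y
      by (rule hsum_eqI) (simp add: T plus_hsum.rep_eq matrix_vector_right_distrib)
    show "T (r *\<^sub>R x) = r *\<^sub>R T x" for r x
      by (rule hsum_eqI) (simp add: T scaleR_hsum.rep_eq
          linear_cmul[OF bounded_linear.linear[OF matrix_vector_mul_bounded_linear]])
    show "norm (T x) \<le> norm x * K" for x
    proof (rule power2_le_imp_le)
      have "(norm (T x))\<^sup>2 \<le> (\<Sum>n. K\<^sup>2 * (norm (coord x n))\<^sup>2)"
        unfolding norm_hsum_sq T
        by (intro suminf_le sm summable_mult summable_coord le2)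
      also have "\<dots> = (norm x * K)\<^sup>2"
        by (simp add: suminf_mult summable_coord norm_hsum_sq power_mult_distrib)
      finally show "(norm (T x))\<^sup>2 \<le> (norm x * K)\<^sup>2" .
    qed (use \<open>K \<ge> 0\<close> in simp)
  qed
  hence ap: "bop_apply (Bop (Blinfun T)) = T"
    by (simp add: bop_apply_def Bop_inverse bounded_linear_Blinfun_apply)
  have "T (c *\<^sub>C x) = c *\<^sub>C T x" for c x
    by (rule hsum_eqI) (simp add: T scaleC_hsum.rep_eq matrix_vector_mult_def vec_eq_iff
        sum_distrib_left mult_ac)
  hence "cop_apply (Abs_cop (Bop (Blinfun T))) = T"
    by (simp add: cop_apply_def Abs_cop_inverse ap)
  thus ?thesis using assms T by (simp add: direct_sum_def T_def)
qed

definition is_adjoint :: "cop \<Rightarrow> cop \<Rightarrow> bool" where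
  "is_adjoint A A' \<longleftrightarrow> (\<forall>x y. cinner (cop_apply A x) y = cinner x (cop_apply A' y))"

definition skew_hermitian :: "cop \<Rightarrow> bool" where
  "skew_hermitian A \<longleftrightarrow> is_adjoint A (- A)"

definition unitary :: "cop \<Rightarrow> bool" where
  "unitary U \<longleftrightarrow> (\<exists>U'. is_adjoint U U' \<and> U' * U = 1 \<and> U * U' = 1)"

definition is_real_adjoint :: "'a::real_inner bop \<Rightarrow> 'a bop \<Rightarrow> bool" where
  "is_real_adjoint A A' \<longleftrightarrow> (\<forall>x y. inner (bop_apply A x) y = inner x (bop_apply A' y))"

definition skew_symmetric :: "'a::real_inner bop \<Rightarrow> bool" where
  "skew_symmetric A \<longleftrightarrow> is_real_adjoint A (- A)"

definition orthogonal_bop :: "'a::{real_inner,perfect_space} bop \<Rightarrow> bool" where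
  "orthogonal_bop U \<longleftrightarrow> (\<exists>U'. is_real_adjoint U U' \<and> U' * U = 1 \<and> U * U' = 1)"

definition is_inverse :: "'a::ring_1 \<Rightarrow> 'a \<Rightarrow> bool" where
  "is_inverse A B \<longleftrightarrow> A * B = 1 \<and> B * A = 1"

definition alg_inverse :: "'a::ring_1 \<Rightarrow> 'a" where
  "alg_inverse A = (THE B. is_inverse A B)"

lemma alg_inverse_eq: "is_inverse A B \<Longrightarrow> alg_inverse A = B"
  unfolding alg_inverse_def is_inverse_def
proof (rule the_equality)
  fix C assume B: "A * B = 1 \<and> B * A = 1" and C: "A * C = 1 \<and> C * A = 1"
  have "C = (B * A) * C" using B by simp
  also have "\<dots> = B" unfolding mult.assoc using C by simp
  finally show "C = B" .
qed

definition spectrum :: "cop \<Rightarrow> complex set" where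
  "spectrum A = {c. \<nexists>B. is_inverse (cop_of_complex c - A) B}"

text \<open>Meaningful for \<open>A\<close> whose spectrum is disjoint from \<open>(-\<infinity>, 0]\<close>.\<close>

definition log_op :: "cop \<Rightarrow> cop" where
  "log_op A = integral {0..1}
    (\<lambda>l. (A - 1) * alg_inverse (l *\<^sub>R 1 + (1 - l) *\<^sub>R A))"

text \<open>
  Series \<open>\<Sum>k\<ge>1. s k\<close> are represented by sequences \<open>s\<close> whose value at 0 is irrelevant.
  For the Magnus coefficients this value is fixed to be 0, so that the sequence is unique.
  Real \<open>t\<close> near 0 already determine the coefficients.
\<close>

definition is_magnus_expansion :: "cop \<Rightarrow> cop \<Rightarrow> (nat \<Rightarrow> cop) \<Rightarrow> bool" where
  "is_magnus_expansion B1 B2 \<mu> \<longleftrightarrow> \<mu> 0 = 0 \<and>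
    (\<exists>r>0. \<forall>t::real. \<bar>t\<bar> < r \<longrightarrow>
      spectrum (exp (t *\<^sub>R B1) * exp (t *\<^sub>R B2)) \<inter> \<real>\<^sub>\<le>\<^sub>0 = {} \<and>
      (\<lambda>k. t ^ Suc k *\<^sub>R \<mu> (Suc k)) sums log_op (exp (t *\<^sub>R B1) * exp (t *\<^sub>R B2)))"

definition magnus :: "cop \<Rightarrow> cop \<Rightarrow> nat \<Rightarrow> cop" where
  "magnus B1 B2 = (THE \<mu>. is_magnus_expansion B1 B2 \<mu>)"

definition real_analytic_on :: "(real \<Rightarrow> 'a::banach) \<Rightarrow> real set \<Rightarrow> bool" where
  "real_analytic_on f S \<longleftrightarrow>
    (\<forall>x\<in>S. \<exists>a. \<exists>r>0. \<forall>y. \<bar>y - x\<bar> < r \<longrightarrow> (\<lambda>n. (y - x) ^ n *\<^sub>R a n) sums f y)"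

definition radially_converges_to :: "(nat \<Rightarrow> 'a::{real_normed_algebra,banach}) \<Rightarrow> 'a \<Rightarrow> bool" where
  "radially_converges_to s S \<longleftrightarrow>
    (\<exists>f. real_analytic_on f {0<..<1} \<and>
      (\<forall>\<^sub>F t in at_right 0. (\<lambda>k. t ^ Suc k *\<^sub>R s (Suc k)) sums f t) \<and>
      (f \<longlongrightarrow> S) (at_left 1))"

definition completely_divergent :: "(nat \<Rightarrow> 'a::{real_normed_algebra,banach}) \<Rightarrow> bool" where
  "completely_divergent s \<longleftrightarrow> (\<nexists>S. radially_converges_to s S)"

definition \<Delta> :: "complex \<Rightarrow> real" where
  "\<Delta> \<delta> = max (cmod (1 - \<delta>)) (cmod (1 + \<delta>))"

definition block1 :: "real \<Rightarrow> complex \<Rightarrow> complex^2^2" where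
  "block1 \<alpha> \<delta> = ((pi - \<alpha>) / 2 * (1 / \<Delta> \<delta>)) *\<^sub>R
    vector [vector [\<delta>, -1], vector [1, -\<delta>]]"

definition block2 :: "real \<Rightarrow> complex \<Rightarrow> complex^2^2" where
  "block2 \<alpha> \<delta> = ((pi + \<alpha>) / 2 * (1 / \<Delta> \<delta>)) *\<^sub>R
    vector [vector [-\<delta>, -1], vector [1, \<delta>]]"

end

theory Submission
  imports Defs "HOL-Complex_Analysis.Conformal_Mappings"
begin

text \<open>
  Let \<open>f\<close> be a radial extension with limit \<open>S\<close> at 1. For small \<open>t\<close> the \<open>n\<close>-th block of \<open>f t\<close> is the
  small logarithm of the block \<open>P\<close> of \<open>exp (t B\<^sub>1) exp (t B\<^sub>2)\<close>. It is traceless since \<open>det P = 1\<close>, and if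
  \<open>d\<close> is its determinant, \<open>h\<close> and \<open>\<kappa>\<close> are the sums of the off-diagonal entries of the logarithm and of
  \<open>P\<close>, and \<open>\<tau>\<close> is half the trace of \<open>P\<close>, then \<open>cos \<surd>d = \<tau>\<close> and \<open>h\<^sup>2 (1 - \<tau>\<^sup>2) = \<kappa>\<^sup>2 d\<close>. These
  identities do not mention a branch of the logarithm, so they persist on \<open>(0, 1)\<close> by the identity
  theorem and at \<open>t = 1\<close> by continuity.

  As \<open>n\<close> tends to infinity, \<open>\<tau>\<close> tends to \<open>cos (t \<pi>)\<close> and \<open>\<kappa>\<close> to 0, so \<open>h\<close> tends to 0 for each fixed
  \<open>t < 1\<close>. At \<open>t = 1\<close>, however, \<open>1 - \<tau>\<^sup>2\<close> is at most of order \<open>\<delta>\<^sup>2\<close>, \<open>\<kappa>\<close> is of exact order \<open>\<delta>\<close>, and \<open>d\<close>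
  stays away from 0 because \<open>cos \<surd>d\<close> tends to \<open>-1\<close>; hence \<open>h\<close> stays away from 0. This contradicts the
  convergence of \<open>f t\<close> to \<open>S\<close> in norm, which is uniform over the blocks.
\<close>

section \<open>The logarithm in a Banach algebra\<close>

text \<open>At \<open>\<delta> = 0\<close> both blocks are multiples of one rotation generator: they
  commute, the product is the rotation by \<open>t * pi\<close>, and the off-diagonal entries of its
  logarithm cancel. For \<open>\<delta> \<noteq> 0\<close> they cease to commute, and
  \<open>\<kappa>\<close> registers this at first order. The logarithm multiplies the traceless part
  of \<open>P\<close> by \<open>sqrt d / sin (sqrt d)\<close>; at \<open>t = 1\<close> a sine of
  order at most \<open>\<delta>\<close> compensates the factor \<open>\<delta>\<close> in
  \<open>\<kappa>\<close>. The contradiction thus lies in the exchange of the limits in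
  \<open>t\<close> and \<open>n\<close>, not in any one block.

  The obstacle is that \<open>f\<close> is tied to the logarithm only near 0. For larger
  \<open>t\<close> nothing says that \<open>f t\<close> is a logarithm or even preserves the blocks,
  so what is carried along must be an equation between entire functions of finitely many matrix
  entries.

  As \<open>magnus\<close> is a description, existence and uniqueness of the expansion have to be
  proved before anything is known about it: the integral in \<open>log_op\<close> is turned into the
  power series of the logarithm, which is then expanded in \<open>t\<close>.\<close>

definition log1p_series :: "'a::{real_normed_algebra_1,banach} \<Rightarrow> 'a" where
  "log1p_series x = (\<Sum>k. ((-1) ^ k / real (Suc k)) *\<^sub>R x ^ Suc k)"

lemma is_inverse_one_minus:
  fixes y :: "'a::{real_normed_algebra_1,banach}"
  assumes "norm y < 1"
  shows "is_inverse (1 - y) (\<Sum>n. y ^ n)"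
proof -
  let ?S = "\<Sum>n. y ^ n"
  have s: "summable (\<lambda>n. y ^ n)" using assms by (rule complete_algebra_summable_geometric)
  have hd: "(\<Sum>n. y ^ Suc n) = ?S - 1"
    using suminf_split_head[OF s] by simp
  have "y * ?S = ?S - 1" using suminf_mult[OF s, of y] hd by simp
  moreover have "?S * y = ?S - 1"
    using suminf_mult2[OF s, of y] hd by (simp add: power_commutes)
  ultimately show ?thesis by (simp add: is_inverse_def algebra_simps)
qed

lemma alg_inverse_one_plus:
  fixes x :: "'a::{real_normed_algebra_1,banach}"
  assumes "norm x < 1"
  shows "alg_inverse (1 + x) = (\<Sum>n. (- x) ^ n)"
    and "is_inverse (1 + x) (\<Sum>n. (- x) ^ n)"
  using is_inverse_one_minus[of "- x"] assms by (auto intro: alg_inverse_eq)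

lemma log1p_series_bound:
  fixes x :: "'a::{real_normed_algebra_1,banach}"
  shows "norm (((-1) ^ k / real (Suc k)) *\<^sub>R x ^ Suc k) \<le> norm x ^ Suc k"
proof -
  have "norm (((-1) ^ k / real (Suc k)) *\<^sub>R x ^ Suc k) \<le> 1 * norm (x ^ Suc k)"
    unfolding norm_scaleR by (intro mult_right_mono) (simp_all add: power_abs)
  thus ?thesis using norm_power_ineq[of x "Suc k"] by linarith
qed

lemma summable_log1p_series:
  fixes x :: "'a::{real_normed_algebra_1,banach}"
  assumes "norm x < 1"
  shows "summable (\<lambda>k. ((-1) ^ k / real (Suc k)) *\<^sub>R x ^ Suc k)"
proof (rule summable_comparison_test'[OF _ log1p_series_bound])
  have "summable (\<lambda>k. norm x ^ k)" by (rule summable_geometric) (use assms in simp)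
  thus "summable (\<lambda>k. norm x ^ Suc k)" by (subst summable_Suc_iff)
qed

lemma log1p_series_0 [simp]: "log1p_series 0 = 0"
  by (simp add: log1p_series_def)

text \<open>The bound 1 is crude; what matters is that it lies below pi. It later excludes every
  value except 0 for the half trace of a block, that is, it selects the branch for small
  \<open>t\<close>.\<close>

lemma norm_log1p_series_le:
  fixes x :: "'a::{real_normed_algebra_1,banach}"
  assumes "norm x \<le> 1 / 2"
  shows "norm (log1p_series x) \<le> 1"
proof -
  have g: "(\<lambda>k. (1 / 2 :: real) ^ Suc k) sums 1"
    using power_half_series by simp
  have "norm (log1p_series x) \<le> (\<Sum>k. (1 / 2 :: real) ^ Suc k)"
    unfolding log1p_series_def
  proof (rule norm_suminf_le)
    show "norm (((-1) ^ k / real (Suc k)) *\<^sub>R x ^ Suc k) \<le> (1 / 2) ^ Suc k" for k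
      using log1p_series_bound[of k x] power_mono[OF assms norm_ge_zero, of "Suc k"] by linarith
  qed (use g in \<open>simp add: sums_iff\<close>)
  thus ?thesis using g by (simp add: sums_iff)
qed

text \<open>Differentiated termwise along the segment from 0 to \<open>x\<close>, the series becomes
  \<open>x\<close> times the Neumann series of the inverse. The derivative is therefore the
  integrand of \<open>log_op\<close> up to reparametrization, and it also drives the proof that
  \<open>exp\<close> inverts the series.\<close>

lemma log1p_series_has_vector_derivative:
  fixes x :: "'a::{real_normed_algebra_1,banach}"
  assumes x: "norm x < 1" and u: "u \<in> {0..1}"
  shows "((\<lambda>u. log1p_series (u *\<^sub>R x)) has_vector_derivative
    x * alg_inverse (1 + u *\<^sub>R x)) (at u within {0..1})"
proof -
  let ?f = "\<lambda>k (u::real). ((-1) ^ k / real (Suc k)) *\<^sub>R (u *\<^sub>R x) ^ Suc k"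
  let ?f' = "\<lambda>k (u::real). x * (- (u *\<^sub>R x)) ^ k"
  let ?g = "\<lambda>u::real. x * alg_inverse (1 + u *\<^sub>R x)"
  have nu: "norm (u *\<^sub>R x) < 1" if "u \<in> {0..1}" for u :: real
    using that x mult_mono[of "\<bar>u\<bar>" 1 "norm x" "norm x"] by simp
  have ev: "\<forall>\<^sub>F n in sequentially. \<forall>u\<in>{0..1}. norm ((\<Sum>i<n. ?f' i u) - ?g u) < e"
    if "e > 0" for e :: real
  proof -
    have "uniform_limit {0..1} (\<lambda>n u. \<Sum>i<n. ?f' i u) (\<lambda>u. \<Sum>i. ?f' i u) sequentially"
    proof (rule Weierstrass_m_test)
      fix n and u :: real assume u: "u \<in> {0..1}"
      have "norm (?f' n u) \<le> norm x * norm (u *\<^sub>R x) ^ n"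
        by (metis norm_ge_zero norm_minus_cancel norm_mult_ineq norm_power_ineq mult_left_mono order_trans)
      also have "\<dots> \<le> norm x * norm x ^ n"
        using u mult_mono[of "\<bar>u\<bar>" 1 "norm x" "norm x"]
        by (intro mult_left_mono power_mono) auto
      finally show "norm (?f' n u) \<le> norm x * norm x ^ n" .
    next
      show "summable (\<lambda>n. norm x * norm x ^ n)"
        using x by (intro summable_mult summable_geometric) simp
    qed
    from uniform_limitD[OF this that]
    have *: "\<forall>\<^sub>F n in sequentially. \<forall>u\<in>{0..1}. dist (\<Sum>i<n. ?f' i u) (\<Sum>i. ?f' i u) < e" .
    have "?g u = (\<Sum>i. ?f' i u)" if "u \<in> {0..1}" for u :: real
      using nu[OF that]
      by (subst alg_inverse_one_plus(1))
        (auto intro!: suminf_mult[symmetric] complete_algebra_summable_geometric)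
    with * show ?thesis by (simp add: dist_norm)
  qed
  have "\<exists>g. \<forall>u\<in>{0..1}. (\<lambda>n. ?f n u) sums g u \<and>
      (g has_derivative (\<lambda>h. h *\<^sub>R ?g u)) (at u within {0..1})"
  proof (rule has_derivative_series[where f' = "\<lambda>k u h. h *\<^sub>R ?f' k u"])
    show "convex {0..1::real}" by simp
    fix n :: nat and u :: real assume "u \<in> {0..1}"
    have "((\<lambda>u. ((-1) ^ n / real (Suc n) * u ^ Suc n) *\<^sub>R x ^ Suc n) has_vector_derivative
       ((-1) ^ n * u ^ n) *\<^sub>R x ^ Suc n) (at u within {0..1})"
      by (auto intro!: derivative_eq_intros simp: has_real_derivative_iff_has_vector_derivative[symmetric] simp del: power_Suc of_nat_Suc)
    moreover have "?f' n u = ((-1) ^ n * u ^ n) *\<^sub>R x ^ Suc n"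
    proof -
      have "- (u *\<^sub>R x) = (- u) *\<^sub>R x" by simp
      thus ?thesis by (simp only: scaleR_power power_minus[of u] mult_scaleR_right power_Suc)
    qed
    ultimately show "(?f n has_derivative (\<lambda>h. h *\<^sub>R ?f' n u)) (at u within {0..1})"
      unfolding has_vector_derivative_def scaleR_power by (simp add: mult.assoc)
  next
    fix e :: real assume "e > 0"
    from ev[OF this]
    show "\<forall>\<^sub>F n in sequentially. \<forall>u\<in>{0..1}. \<forall>h. norm ((\<Sum>i<n. h *\<^sub>R ?f' i u) - h *\<^sub>R ?g u) \<le> e * norm h"
    proof eventually_elim
      case (elim n)
      show ?case
      proof (intro ballI allI)
        fix u h :: real assume "u \<in> {0..1}"
        with elim have *: "norm ((\<Sum>i<n. ?f' i u) - ?g u) \<le> e" by (auto intro: less_imp_le)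
        have "norm ((\<Sum>i<n. h *\<^sub>R ?f' i u) - h *\<^sub>R ?g u) = \<bar>h\<bar> * norm ((\<Sum>i<n. ?f' i u) - ?g u)"
          by (simp add: scaleR_sum_right[symmetric] scaleR_diff_right[symmetric] del: scaleR_diff_right)
        also have "\<dots> \<le> \<bar>h\<bar> * e" by (intro mult_left_mono *) auto
        finally show "norm ((\<Sum>i<n. h *\<^sub>R ?f' i u) - h *\<^sub>R ?g u) \<le> e * norm h" by (simp add: mult.commute)
      qed
    qed
  next
    show "u \<in> {0..1}" by (rule u)
    show "(\<lambda>n. ?f n u) sums log1p_series (u *\<^sub>R x)"
      unfolding log1p_series_def by (intro summable_sums summable_log1p_series nu u)
  qed
  then obtain g where g: "\<And>u. u \<in> {0..1} \<Longrightarrow> (\<lambda>n. ?f n u) sums g u"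
    "\<And>u. u \<in> {0..1} \<Longrightarrow> (g has_derivative (\<lambda>h. h *\<^sub>R ?g u)) (at u within {0..1})" by blast
  have "log1p_series (u *\<^sub>R x) = g u" if "u \<in> {0..1}" for u
    unfolding log1p_series_def using g(1)[OF that] by (simp add: sums_iff)
  with has_derivative_transform[OF u _ g(2)[OF u]] show ?thesis
    unfolding has_vector_derivative_def by simp
qed

lemma log_op_eq_log1p_series:
  assumes "norm (A - 1) < 1"
  shows "log_op A = log1p_series (A - 1)"
proof -
  let ?x = "A - 1"
  have "((\<lambda>u. ?x * alg_inverse (1 + u *\<^sub>R ?x)) has_integral
      log1p_series (1 *\<^sub>R ?x) - log1p_series (0 *\<^sub>R ?x)) {0..1}"
    by (rule fundamental_theorem_of_calculus)
      (use log1p_series_has_vector_derivative[OF assms] in auto)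
  hence "((\<lambda>u. ?x * alg_inverse (1 + u *\<^sub>R ?x)) has_integral log1p_series ?x) (cbox 0 1)"
    by simp
  \<comment> \<open>In \<open>log_op\<close> the weight \<open>l\<close> sits on the identity, so
    the path is reversed by \<open>u = 1 - l\<close>.\<close>
  from has_integral_affinity[OF this, of "-1" 1]
  have "((\<lambda>l. ?x * alg_inverse (1 + (1 - l) *\<^sub>R ?x)) has_integral log1p_series ?x) {0..1}"
    by (simp add: algebra_simps)
  moreover have "1 + (1 - l) *\<^sub>R ?x = l *\<^sub>R 1 + (1 - l) *\<^sub>R A" for l :: real
    by (simp add: algebra_simps)
  ultimately show ?thesis unfolding log_op_def by (simp add: integral_unique)
qed

section \<open>The exponential of the logarithm series\<close>

lemma suminf_commute:
  fixes f :: "nat \<Rightarrow> 'a::real_normed_algebra"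
  assumes "summable f" "\<And>n. c * f n = f n * c"
  shows "c * suminf f = suminf f * c"
  using suminf_mult[OF assms(1), of c] suminf_mult2[OF assms(1), of c] assms(2) by simp

lemma power_commute:
  fixes c y :: "'a::monoid_mult"
  assumes "c * y = y * c"
  shows "c * y ^ n = y ^ n * c"
  by (rule power_commuting_commutes[symmetric]) (use assms in simp)

lemma exp_commute:
  fixes c y :: "'a::{real_normed_algebra_1,banach}"
  assumes "c * y = y * c"
  shows "c * exp y = exp y * c"
  unfolding exp_def
  by (intro suminf_commute summable_exp_generic) (simp add: power_commute[OF assms])

lemma log1p_series_commute:
  fixes c x :: "'a::{real_normed_algebra_1,banach}"
  assumes "norm x < 1" "c * x = x * c"
  shows "c * log1p_series x = log1p_series x * c"
proof -
  have "c * x ^ Suc k = x ^ Suc k * c" for k by (rule power_commute[OF assms(2)])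
  thus ?thesis
    unfolding log1p_series_def
    by (intro suminf_commute summable_log1p_series assms) (simp del: power_Suc)
qed

lemma norm_exp_remainder_le:
  fixes y :: "'a::{real_normed_algebra_1,banach}"
  assumes "norm y \<le> 1"
  shows "norm (exp y - 1 - y) \<le> (norm y)\<^sup>2"
proof -
  have split: "(\<Sum>n. f (n + 2)) = suminf f - f 0 - f 1" if "summable f"
    for f :: "nat \<Rightarrow> 'b::real_normed_vector"
    using suminf_minus_initial_segment[OF that, of 2] by (simp add: numeral_2_eq_2)
  have "exp y - 1 - y = (\<Sum>n. y ^ (n + 2) /\<^sub>R fact (n + 2))"
    using split[OF summable_exp_generic[of y]] by (simp add: exp_def)
  also have "norm \<dots> \<le> (\<Sum>n. norm y ^ (n + 2) /\<^sub>R fact (n + 2))"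
  proof (rule norm_suminf_le)
    show "norm (y ^ (n + 2) /\<^sub>R fact (n + 2)) \<le> norm y ^ (n + 2) /\<^sub>R fact (n + 2)" for n
      unfolding norm_scaleR using norm_power_ineq[of y "n + 2"]
      by (simp del: fact_Suc power_Suc add: mult_left_mono)
    show "summable (\<lambda>n. norm y ^ (n + 2) /\<^sub>R fact (n + 2))"
      using summable_exp_generic[of "norm y"]
      by (subst summable_iff_shift[where f = "\<lambda>n. norm y ^ n /\<^sub>R fact n"]) 
  qed
  also have "\<dots> = exp (norm y) - 1 - norm y"
    using split[OF summable_exp_generic[of "norm y"]] by (simp add: exp_def)
  also have "\<dots> \<le> (norm y)\<^sup>2" using exp_bound[of "norm y"] assms by simp
  finally show ?thesis .
qed

lemma exp_has_derivative_0:
  "(exp has_derivative (\<lambda>h. h)) (at (0 :: 'a::{real_normed_algebra_1,banach}))"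
proof (rule has_derivativeI_sandwich[of 1])
  fix y :: 'a assume "y \<noteq> 0" "dist y 0 < 1"
  hence "norm (exp y - 1 - y) / norm y \<le> (norm y)\<^sup>2 / norm y"
    by (intro divide_right_mono norm_exp_remainder_le) auto
  thus "norm (exp y - exp 0 - (y - 0)) / norm (y - 0) \<le> norm y"
    using \<open>y \<noteq> 0\<close> by (simp add: power2_eq_square)
next
  show "(norm \<longlongrightarrow> 0) (at (0 :: 'a))" by (rule tendsto_norm_zero) (rule tendsto_ident_at)
qed auto

text \<open>In a noncommutative algebra the derivative of \<open>exp\<close> at a general point has
  no simple form. Commuting values permit the factorization
  \<open>exp (G v) = exp (G u) * exp (G v - G u)\<close>, after which the derivative of
  \<open>exp\<close> at 0 suffices.\<close>

lemma exp_has_vector_derivative_commuting: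
  fixes G :: "real \<Rightarrow> 'a::{real_normed_algebra_1,banach}"
  assumes G: "(G has_vector_derivative G') (at u within S)" and u: "u \<in> S"
    and comm: "\<And>v. v \<in> S \<Longrightarrow> G v * G u = G u * G v"
  shows "((\<lambda>v. exp (G v)) has_vector_derivative exp (G u) * G') (at u within S)"
proof -
  have "((\<lambda>v. G v - G u) has_derivative (\<lambda>h. h *\<^sub>R G')) (at u within S)"
    using G unfolding has_vector_derivative_def
    by (auto intro!: derivative_eq_intros)
  moreover have "(exp has_derivative (\<lambda>h. h)) (at (G u - G u))"
    using exp_has_derivative_0 by simp
  ultimately have "((\<lambda>v. exp (G v - G u)) has_derivative (\<lambda>h. h *\<^sub>R G')) (at u within S)"
    using has_derivative_compose by blast
  hence "((\<lambda>v. exp (G u) * exp (G v - G u)) has_derivative (\<lambda>h. exp (G u) * (h *\<^sub>R G'))) (at u within S)"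
    by (rule has_derivative_mult_right)
  moreover have "exp (G v) = exp (G u) * exp (G v - G u)" if "v \<in> S" for v
    using exp_add_commuting[of "G u" "G v - G u"] comm[OF that] by (simp add: algebra_simps)
  ultimately show ?thesis unfolding has_vector_derivative_def
    using has_derivative_transform[OF u, of "\<lambda>v. exp (G v)" "\<lambda>v. exp (G u) * exp (G v - G u)"] by simp
qed

text \<open>With \<open>L u\<close> the series at \<open>u x\<close>, the product of
  \<open>exp (- L u)\<close> and \<open>1 + u x\<close> has derivative 0 on [0, 1], because
  \<open>L' u\<close> is \<open>x\<close> times the inverse of \<open>1 + u x\<close>. Its value at
  \<open>u = 0\<close> is 1.\<close>

lemma exp_log1p_series:
  fixes x :: "'a::{real_normed_algebra_1,banach}"
  assumes x: "norm x < 1"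
  shows "exp (log1p_series x) = 1 + x"
proof -
  let ?G = "\<lambda>u::real. - log1p_series (u *\<^sub>R x)"
  let ?R = "\<lambda>u::real. alg_inverse (1 + u *\<^sub>R x)"
  have nu: "norm (u *\<^sub>R x) < 1" if "u \<in> {0..1}" for u :: real
    using that x mult_mono[of "\<bar>u\<bar>" 1 "norm x" "norm x"] by simp
  have cx: "x * ?G u = ?G u * x" if "u \<in> {0..1}" for u
    using log1p_series_commute[OF nu[OF that], of x] by simp
  have comm: "?G v * ?G u = ?G u * ?G v" if "u \<in> {0..1}" "v \<in> {0..1}" for u v
    using log1p_series_commute[OF nu[OF that(1)], of "?G v"] cx[OF that(2)] by simp
  have D: "((\<lambda>u. exp (?G u) * (1 + u *\<^sub>R x)) has_vector_derivative 0) (at u within {0..1})"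
    if u: "u \<in> {0..1}" for u
  proof -
    have "(?G has_vector_derivative - (x * ?R u)) (at u within {0..1})"
      by (rule has_vector_derivative_minus[OF log1p_series_has_vector_derivative[OF x u]])
    from exp_has_vector_derivative_commuting[OF this u comm[OF u]]
    have 1: "((\<lambda>u. exp (?G u)) has_vector_derivative exp (?G u) * - (x * ?R u)) (at u within {0..1})"
      by simp
    have 2: "((\<lambda>u. 1 + u *\<^sub>R x) has_vector_derivative x) (at u within {0..1})"
      by (auto intro!: derivative_eq_intros)
    have "?R u * (1 + u *\<^sub>R x) = 1"
      using alg_inverse_one_plus[OF nu[OF u]] by (simp add: is_inverse_def)
    hence "exp (?G u) * - (x * ?R u) * (1 + u *\<^sub>R x) = - (exp (?G u) * x)"
      by (simp only: mult_minus_left mult_minus_right mult.assoc mult_1_right)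
    thus ?thesis using has_vector_derivative_mult[OF 1 2] by simp
  qed
  obtain c where c: "\<And>u. u \<in> {0..1} \<Longrightarrow> exp (?G u) * (1 + u *\<^sub>R x) = c"
    using has_vector_derivative_zero_constant[OF convex_real_interval(5) D] by blast
  have "exp (- log1p_series x) * (1 + x) = 1" using c[of 0] c[of 1] by simp
  hence "exp (log1p_series x) * (exp (- log1p_series x) * (1 + x)) = exp (log1p_series x)" by simp
  thus ?thesis by (simp only: mult.assoc[symmetric] exp_minus_inverse mult_1_left)
qed

section \<open>Substituting a power series into the logarithm series\<close>

lemma summable_mult_bound:
  fixes f :: "nat \<Rightarrow> 'a::banach"
  assumes "\<And>k. norm (f k) \<le> c * u k" "summable u"
  shows "summable (\<lambda>k. norm (f k))"
  by (rule summable_comparison_test'[OF summable_mult[OF assms(2), of c]]) (simp add: assms(1))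

text \<open>A majorant of product form makes the double family absolutely summable, so Fubini for
  unordered sums applies; unordered and ordered sums agree because every series involved converges
  absolutely.\<close>

lemma sums_swap:
  fixes a :: "nat \<Rightarrow> nat \<Rightarrow> 'a::banach"
  assumes le: "\<And>k j. norm (a k j) \<le> u k * v j" and u: "summable u" and v: "summable v"
    and nonneg: "\<And>k. u k \<ge> 0" "\<And>j. v j \<ge> 0"
  shows "(\<lambda>j. \<Sum>k. a k j) sums (\<Sum>k. \<Sum>j. a k j)"
proof -
  have infsum_nat: "infsum f UNIV = suminf f" if "summable (\<lambda>n. norm (f n))" for f :: "nat \<Rightarrow> 'a"
    using norm_summable_imp_has_sum[OF that summable_sums[OF summable_norm_cancel[OF that]]]
    by (rule infsumI)
  have s1: "summable (\<lambda>j. norm (a k j))" for k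
    by (rule summable_mult_bound[OF le v])
  have s2: "summable (\<lambda>k. norm (a k j))" for j
    by (rule summable_mult_bound[of _ "v j", OF _ u]) (use le in \<open>simp add: mult.commute\<close>)
  have n1: "norm (\<Sum>j. a k j) \<le> suminf v * u k" for k
  proof -
    have "norm (\<Sum>j. a k j) \<le> (\<Sum>j. u k * v j)"
      by (rule norm_suminf_le[OF le summable_mult[OF v]])
    thus ?thesis by (simp add: suminf_mult v mult.commute)
  qed
  have n2: "norm (\<Sum>k. a k j) \<le> suminf u * v j" for j
  proof -
    have "norm (\<Sum>k. a k j) \<le> (\<Sum>k. u k * v j)"
      by (rule norm_suminf_le[OF le summable_mult2[OF u]])
    thus ?thesis by (simp add: suminf_mult2[symmetric] u)
  qed
  have "(\<lambda>(k, j). u k * v j) summable_on (UNIV \<times> UNIV)"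
  proof (rule summable_on_SigmaI[where g = "\<lambda>k. u k * suminf v"])
    fix k
    have "summable (\<lambda>j. norm (u k * v j))" using v nonneg by (simp add: summable_mult)
    moreover have "(\<lambda>j. u k * v j) sums (u k * suminf v)" by (intro sums_mult summable_sums v)
    ultimately show "((\<lambda>j. case (k, j) of (k, j) \<Rightarrow> u k * v j) has_sum u k * suminf v) UNIV"
      by (simp add: norm_summable_imp_has_sum)
  next
    have s: "summable (\<lambda>k. norm (u k * suminf v))"
      using nonneg u suminf_nonneg[OF v] by (simp add: summable_mult2 abs_mult)
    show "(\<lambda>k. u k * suminf v) summable_on UNIV"
      by (rule has_sum_imp_summable[OF norm_summable_imp_has_sum[OF s summable_sums[OF summable_norm_cancel[OF s]]]])
  qed (use nonneg in auto)
  hence "(\<lambda>p. norm (case p of (k, j) \<Rightarrow> a k j)) summable_on (UNIV \<times> UNIV)"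
    by (rule Infinite_Sum.abs_summable_on_comparison_test') (use le in auto)
  hence "(\<lambda>(k, j). a k j) summable_on (UNIV \<times> UNIV)"
    by (rule Infinite_Sum.abs_summable_summable)
  from infsum_swap_banach[OF this]
  have "(\<Sum>\<^sub>\<infinity>k. \<Sum>j. a k j) = (\<Sum>\<^sub>\<infinity>j. \<Sum>k. a k j)"
    by (simp add: infsum_nat[OF s1] infsum_nat[OF s2])
  hence "(\<Sum>k. \<Sum>j. a k j) = (\<Sum>j. \<Sum>k. a k j)"
    by (simp add: infsum_nat[OF summable_mult_bound[OF n1 u]] infsum_nat[OF summable_mult_bound[OF n2 v]])
  moreover have "summable (\<lambda>j. \<Sum>k. a k j)"
    by (rule summable_norm_cancel[OF summable_mult_bound[OF n2 v]])
  ultimately show ?thesis by (simp add: sums_iff)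
qed

text \<open>\<open>conv_power c k j\<close> is the coefficient of degree \<open>j\<close> in the
  \<open>k\<close>-th power of the power series with coefficients \<open>c\<close>, which need not
  commute.\<close>

primrec conv_power :: "(nat \<Rightarrow> 'a::ring_1) \<Rightarrow> nat \<Rightarrow> nat \<Rightarrow> 'a" where
  "conv_power c 0 = (\<lambda>j. if j = 0 then 1 else 0)"
| "conv_power c (Suc k) = (\<lambda>j. \<Sum>i\<le>j. c i * conv_power c k (j - i))"

text \<open>The l1 norm with weights \<open>\<rho> ^ i\<close> is submultiplicative under the Cauchy
  product. Bounding finite partial sums only avoids any question of convergence.\<close>

lemma conv_power_bound:
  fixes c :: "nat \<Rightarrow> 'a::real_normed_algebra_1"
  assumes c: "\<And>j. (\<Sum>i\<le>j. norm (c i) * \<rho> ^ i) \<le> q" and "\<rho> \<ge> 0"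
  shows "norm (conv_power c k j) * \<rho> ^ j \<le> q ^ k"
proof (induction k arbitrary: j)
  case 0
  show ?case by simp
next
  case (Suc k)
  have "q \<ge> 0" using c[of 0] order_trans[OF norm_ge_zero, of "c 0" q] by simp
  have "norm (conv_power c (Suc k) j) * \<rho> ^ j
      \<le> (\<Sum>i\<le>j. norm (c i) * norm (conv_power c k (j - i))) * \<rho> ^ j"
    using \<open>\<rho> \<ge> 0\<close> by (intro mult_right_mono) (auto intro!: sum_norm_le norm_mult_ineq)
  also have "\<dots> = (\<Sum>i\<le>j. (norm (c i) * \<rho> ^ i) * (norm (conv_power c k (j - i)) * \<rho> ^ (j - i)))"
    unfolding sum_distrib_right
  proof (rule sum.cong)
    fix i assume "i \<in> {..j}"
    hence "\<rho> ^ j = \<rho> ^ i * \<rho> ^ (j - i)" by (simp add: power_add[symmetric])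
    thus "norm (c i) * norm (conv_power c k (j - i)) * \<rho> ^ j
        = (norm (c i) * \<rho> ^ i) * (norm (conv_power c k (j - i)) * \<rho> ^ (j - i))" by simp
  qed simp
  also have "\<dots> \<le> (\<Sum>i\<le>j. (norm (c i) * \<rho> ^ i) * q ^ k)"
    using \<open>\<rho> \<ge> 0\<close> by (intro sum_mono mult_left_mono Suc.IH) auto
  also have "\<dots> = (\<Sum>i\<le>j. norm (c i) * \<rho> ^ i) * q ^ k" by (rule sum_distrib_right[symmetric])
  also have "\<dots> \<le> q * q ^ k" using c \<open>q \<ge> 0\<close> by (intro mult_right_mono) auto
  finally show ?case by simp
qed

lemma conv_power_bound':
  fixes c :: "nat \<Rightarrow> 'a::real_normed_algebra_1"
  assumes c: "\<And>j. (\<Sum>i\<le>j. norm (c i) * \<rho> ^ i) \<le> q" and "\<rho> > 0"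
  shows "norm (t ^ j *\<^sub>R conv_power c k j) \<le> q ^ k * (\<bar>t\<bar> / \<rho>) ^ j"
proof -
  have "norm (conv_power c k j) \<le> q ^ k / \<rho> ^ j"
    using conv_power_bound[OF c, of k j] \<open>\<rho> > 0\<close> by (simp add: pos_le_divide_eq)
  hence "\<bar>t\<bar> ^ j * norm (conv_power c k j) \<le> \<bar>t\<bar> ^ j * (q ^ k / \<rho> ^ j)"
    by (intro mult_left_mono) auto
  thus ?thesis by (simp add: power_divide power_abs mult_ac)
qed

lemma conv_power_sums:
  fixes c :: "nat \<Rightarrow> 'a::{real_normed_algebra_1,banach}"
  assumes c: "\<And>j. (\<Sum>i\<le>j. norm (c i) * \<rho> ^ i) \<le> q" and t: "\<bar>t\<bar> < \<rho>"
    and X: "(\<lambda>j. t ^ j *\<^sub>R c j) sums X"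
  shows "(\<lambda>j. t ^ j *\<^sub>R conv_power c k j) sums X ^ k"
proof (induction k)
  case 0
  have "(\<lambda>j. t ^ j *\<^sub>R conv_power c 0 j) = (\<lambda>j. if j = 0 then 1 else 0)" by auto
  thus ?case using sums_single[of 0 "\<lambda>_. 1 :: 'a"] by simp
next
  case (Suc k)
  have "\<rho> > 0" using t by linarith
  have s: "summable (\<lambda>j. norm (t ^ j *\<^sub>R conv_power c k j))" for k
    by (rule summable_mult_bound[OF conv_power_bound'[OF c \<open>\<rho> > 0\<close>]])
      (use t in \<open>simp add: summable_geometric\<close>)
  \<comment> \<open>The bound on all powers, taken at \<open>k = 1\<close>, supplies the absolute
    convergence of the given series that the Cauchy product requires.\<close>
  have "conv_power c 1 j = c j" for j
  proof -
    have "(\<Sum>i\<le>j. c i * conv_power c 0 (j - i)) = (\<Sum>i\<le>j. if i = j then c i else 0)"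
      by (rule sum.cong) auto
    thus ?thesis by (simp only: One_nat_def conv_power.simps(2)) simp
  qed
  hence "summable (\<lambda>j. norm (t ^ j *\<^sub>R c j))" using s[of 1] by simp
  from Cauchy_product_sums[OF this s[of k]]
  have "(\<lambda>j. \<Sum>i\<le>j. (t ^ i *\<^sub>R c i) * (t ^ (j - i) *\<^sub>R conv_power c k (j - i))) sums (X * X ^ k)"
    using X Suc.IH by (simp add: sums_iff)
  moreover have "(\<Sum>i\<le>j. (t ^ i *\<^sub>R c i) * (t ^ (j - i) *\<^sub>R conv_power c k (j - i)))
      = t ^ j *\<^sub>R conv_power c (Suc k) j" for j
    unfolding conv_power.simps scaleR_sum_right
    by (rule sum.cong) (auto simp: power_add[symmetric])
  ultimately show ?case by simp
qed

text \<open>With 1/2 as the bound, the double series has the majorant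
  \<open>(1/2)^(k+1) * (|t| / \<rho>)^j\<close>, so it may be rearranged by degree in
  \<open>t\<close>. The resulting coefficients do not depend on \<open>t\<close>.\<close>

lemma log1p_series_power_series:
  fixes c :: "nat \<Rightarrow> 'a::{real_normed_algebra_1,banach}"
  assumes c: "\<And>j. (\<Sum>i\<le>j. norm (c i) * \<rho> ^ i) \<le> 1 / 2" and "\<rho> > 0" and "c 0 = 0"
  obtains \<mu> where "\<mu> 0 = 0"
    "\<And>t X. \<bar>t\<bar> < \<rho> \<Longrightarrow> (\<lambda>j. t ^ j *\<^sub>R c j) sums X \<Longrightarrow> (\<lambda>j. t ^ j *\<^sub>R \<mu> j) sums log1p_series X"
proof
  define \<mu> where "\<mu> j = (\<Sum>k. ((-1) ^ k / real (Suc k)) *\<^sub>R conv_power c (Suc k) j)" for j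
  show "\<mu> 0 = 0" by (simp add: \<mu>_def \<open>c 0 = 0\<close>)
  fix t X assume t: "\<bar>t\<bar> < \<rho>" and X: "(\<lambda>j. t ^ j *\<^sub>R c j) sums X"
  let ?a = "\<lambda>k j. ((-1) ^ k / real (Suc k)) *\<^sub>R (t ^ j *\<^sub>R conv_power c (Suc k) j)"
  have b: "norm (((-1) ^ k / real (Suc k)) *\<^sub>R x) \<le> norm x" for k and x :: 'a
  proof -
    have "norm (((-1) ^ k / real (Suc k)) *\<^sub>R x) \<le> 1 * norm x"
      unfolding norm_scaleR by (intro mult_right_mono) (simp_all add: power_abs)
    thus ?thesis by simp
  qed
  have le: "norm (?a k j) \<le> (1 / 2) ^ Suc k * (\<bar>t\<bar> / \<rho>) ^ j" for k j
    by (rule order_trans[OF b conv_power_bound'[OF c \<open>\<rho> > 0\<close>]])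
  have u: "summable (\<lambda>k. (1 / 2 :: real) ^ Suc k)" by (subst summable_Suc_iff) (simp add: summable_geometric)
  have v: "summable (\<lambda>j. (\<bar>t\<bar> / \<rho>) ^ j)" using t by (simp add: summable_geometric)
  have swap: "(\<lambda>j. \<Sum>k. ?a k j) sums (\<Sum>k. \<Sum>j. ?a k j)"
    by (rule sums_swap[OF le u v]) (use \<open>\<rho> > 0\<close> in auto)
  have "(\<Sum>j. ?a k j) = ((-1) ^ k / real (Suc k)) *\<^sub>R X ^ Suc k" for k
    by (rule sums_unique[symmetric, OF sums_scaleR_right[OF conv_power_sums[OF c t X]]])
  hence log: "(\<Sum>k. \<Sum>j. ?a k j) = log1p_series X"
    unfolding log1p_series_def by (rule suminf_cong)
  have "(\<Sum>k. ?a k j) = t ^ j *\<^sub>R \<mu> j" for j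
  proof -
    have "summable (\<lambda>k. norm (((-1) ^ k / real (Suc k)) *\<^sub>R conv_power c (Suc k) j))"
    proof (rule summable_mult_bound[OF _ u])
      fix k
      have "norm (conv_power c (Suc k) j) \<le> (1 / 2) ^ Suc k / \<rho> ^ j"
        using conv_power_bound[OF c, of "Suc k" j] \<open>\<rho> > 0\<close> by (simp add: pos_le_divide_eq)
      with b[of k "conv_power c (Suc k) j"]
      show "norm (((-1) ^ k / real (Suc k)) *\<^sub>R conv_power c (Suc k) j) \<le> (1 / \<rho> ^ j) * (1 / 2) ^ Suc k"
        by simp
    qed
    from bounded_linear.suminf[OF bounded_linear_scaleR_right[of "t ^ j"] summable_norm_cancel[OF this]]
    show ?thesis by (simp add: \<mu>_def mult.commute del: conv_power.simps)
  qed
  hence "(\<lambda>j. \<Sum>k. ?a k j) = (\<lambda>j. t ^ j *\<^sub>R \<mu> j)" by (rule ext)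
  with swap log show "(\<lambda>j. t ^ j *\<^sub>R \<mu> j) sums log1p_series X" by (simp only:)
qed

section \<open>Existence and uniqueness of the Magnus expansion\<close>

lemma cop_apply_simps:
  "cop_apply 0 x = 0"
  "cop_apply 1 x = x"
  "cop_apply (A + B) x = cop_apply A x + cop_apply B x"
  "cop_apply (A - B) x = cop_apply A x - cop_apply B x"
  "cop_apply (- A) x = - cop_apply A x"
  "cop_apply (r *\<^sub>R A) x = r *\<^sub>R cop_apply A x"
  "cop_apply (A * B) x = cop_apply A (cop_apply B x)"
  "cop_apply A (x + y) = cop_apply A x + cop_apply A y"
  "cop_apply A (x - y) = cop_apply A x - cop_apply A y"
  "cop_apply A (- x) = - cop_apply A x"
  "cop_apply A (r *\<^sub>R x) = r *\<^sub>R cop_apply A x"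
  using bounded_linear_bop_apply[of "realify A"]
  by (simp_all add: cop_apply_def zero_cop.rep_eq one_cop.rep_eq plus_cop.rep_eq minus_cop.rep_eq
      uminus_cop.rep_eq scaleR_cop.rep_eq times_cop.rep_eq bop_apply_simps bop_apply_one linear_simps)

lemma cop_apply_scaleC: "cop_apply A (c *\<^sub>C x) = c *\<^sub>C cop_apply A x"
  using realify[of A] by (simp add: cop_apply_def)

lemma cop_eqI: "(\<And>x. cop_apply A x = cop_apply B x) \<Longrightarrow> A = B"
  by (simp add: cop_apply_def realify_inject[symmetric] bop_eqI)

lemma norm_cop_apply: "norm (cop_apply A x) \<le> norm A * norm x"
  by (simp add: cop_apply_def norm_cop.rep_eq norm_bop_apply)

lemma bounded_linear_cop_apply: "bounded_linear (\<lambda>A. cop_apply A x)"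
  by (rule bounded_linear_intro[of _ "norm x"]) (simp_all add: cop_apply_simps norm_cop_apply)

lemma cop_eq_0I:
  assumes "\<And>x y. inner (cop_apply A x) y = 0"
  shows "A = 0"
proof (rule cop_eqI)
  fix x show "cop_apply A x = cop_apply 0 x"
    using assms[of x "cop_apply A x"] by (simp add: cop_apply_simps)
qed

lemma power_series_coeff_bound:
  fixes c :: "nat \<Rightarrow> 'a::real_normed_vector"
  assumes "summable (\<lambda>j. norm (c j))" and "c 0 = 0"
  obtains \<rho> :: real where "\<rho> > 0" "\<And>j. (\<Sum>i\<le>j. norm (c i) * \<rho> ^ i) \<le> 1 / 2"
proof -
  have "(\<lambda>j. norm (c j)) \<longlonglongrightarrow> 0" by (rule summable_LIMSEQ_zero[OF assms(1)])
  hence "Bseq (\<lambda>j. norm (c j))" by (metis convergentI convergent_imp_Bseq)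
  then obtain K where K: "K > 0" "\<And>j. norm (c j) \<le> K" unfolding Bseq_def by auto
  \<comment> \<open>As \<open>c 0 = 0\<close>, the weighted sum is at most
    \<open>K * \<rho> / (1 - \<rho>)\<close>, and this choice makes that
    \<open>K / (2 * K + 1)\<close>.\<close>
  define \<rho> where "\<rho> = 1 / (2 * K + 2)"
  have \<rho>: "\<rho> > 0" "\<rho> < 1" using K by (auto simp: \<rho>_def)
  have "(\<Sum>i\<le>j. norm (c i) * \<rho> ^ i) \<le> 1 / 2" for j
  proof -
    have "(\<Sum>i\<le>j. norm (c i) * \<rho> ^ i) = (\<Sum>i<j. norm (c (Suc i)) * \<rho> ^ Suc i)"
      by (subst lessThan_Suc_atMost[symmetric], subst sum.lessThan_Suc_shift) (simp add: assms(2))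
    also have "\<dots> \<le> (\<Sum>i<j. K * \<rho> * \<rho> ^ i)"
      using K(2) \<rho> by (intro sum_mono) (simp add: mult_right_mono)
    also have "\<dots> = K * \<rho> * ((1 - \<rho> ^ j) / (1 - \<rho>))"
      using \<rho> by (simp add: sum_distrib_left[symmetric] sum_gp_strict)
    also have "\<dots> \<le> K * \<rho> * (1 / (1 - \<rho>))"
      using \<rho> K by (intro mult_left_mono divide_right_mono) auto
    also have "1 - \<rho> = (2 * K + 1) * \<rho>" using K by (simp add: \<rho>_def field_simps)
    also have "K * \<rho> * (1 / ((2 * K + 1) * \<rho>)) = K / (2 * K + 1)" using \<rho> by simp
    also have "\<dots> \<le> 1 / 2" using K by (simp add: field_simps)
    finally show ?thesis .
  qed
  with \<rho>(1) show thesis by (rule that)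
qed

lemma exp_scaleR_mult_power_series:
  fixes B1 B2 :: "'a::{real_normed_algebra_1,banach}"
  obtains c where "\<And>t. (\<lambda>j. t ^ j *\<^sub>R c j) sums (exp (t *\<^sub>R B1) * exp (t *\<^sub>R B2) - 1)"
    "summable (\<lambda>j. norm (c j))" "c 0 = 0"
proof
  define b where "b j = (\<Sum>i\<le>j. (B1 ^ i /\<^sub>R fact i) * (B2 ^ (j - i) /\<^sub>R fact (j - i)))" for j
  define c where "c j = b j - (if j = 0 then 1 else 0)" for j
  have term_eq: "(\<Sum>i\<le>j. ((t *\<^sub>R B1) ^ i /\<^sub>R fact i) * ((t *\<^sub>R B2) ^ (j - i) /\<^sub>R fact (j - i))) = t ^ j *\<^sub>R b j" for t j
    unfolding b_def scaleR_sum_right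
    by (rule sum.cong) (auto simp: power_add[symmetric])
  have s: "(\<lambda>j. t ^ j *\<^sub>R c j) sums (exp (t *\<^sub>R B1) * exp (t *\<^sub>R B2) - 1)" for t
  proof -
    have "(\<lambda>j. t ^ j *\<^sub>R b j) sums (exp (t *\<^sub>R B1) * exp (t *\<^sub>R B2))"
      using Cauchy_product_sums[OF summable_norm_exp[of "t *\<^sub>R B1"] summable_norm_exp[of "t *\<^sub>R B2"]]
      by (simp only: term_eq exp_def)
    from sums_diff[OF this sums_single[of 0 "\<lambda>_. 1"]]
    have "(\<lambda>j. t ^ j *\<^sub>R b j - (if j = 0 then 1 else 0)) sums (exp (t *\<^sub>R B1) * exp (t *\<^sub>R B2) - 1)" .
    moreover have "t ^ j *\<^sub>R b j - (if j = 0 then 1 else 0) = t ^ j *\<^sub>R c j" for j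
      by (simp add: c_def)
    ultimately show ?thesis by simp
  qed
  show "(\<lambda>j. t ^ j *\<^sub>R c j) sums (exp (t *\<^sub>R B1) * exp (t *\<^sub>R B2) - 1)" for t by (rule s)
  show "c 0 = 0" by (simp add: c_def b_def)
  \<comment> \<open>Convergence at \<open>t = 2\<close> makes \<open>norm (c j)\<close> at most a
    constant times \<open>2^(-j)\<close>, whence absolute summability.\<close>
  have "(\<lambda>j. norm (2 ^ j *\<^sub>R c j)) \<longlonglongrightarrow> 0"
    using summable_LIMSEQ_zero[OF sums_summable[OF s[of 2]]] by (rule tendsto_norm_zero)
  hence "Bseq (\<lambda>j. norm (2 ^ j *\<^sub>R c j))" by (metis convergentI convergent_imp_Bseq)
  then obtain K where K: "\<And>j. norm (2 ^ j *\<^sub>R c j) \<le> K" unfolding Bseq_def by auto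
  show "summable (\<lambda>j. norm (c j))"
  proof (rule summable_mult_bound)
    show "norm (c j) \<le> K * (1 / 2) ^ j" for j using K[of j] by (simp add: field_simps)
  qed (simp add: summable_geometric)
qed

text \<open>For real \<open>r \<le> 0\<close> one has \<open>r - A = (r - 1) (1 - y)\<close> with
  \<open>y = (A - 1) / (r - 1)\<close>. Since \<open>|r - 1| \<ge> 1\<close>, the norm of
  \<open>y\<close> is below 1 and the Neumann series inverts \<open>1 - y\<close>.\<close>

lemma spectrum_disjoint_nonpos_Reals:
  assumes "norm (A - 1) < 1"
  shows "spectrum A \<inter> \<real>\<^sub>\<le>\<^sub>0 = {}"
proof -
  have False if c: "c \<in> spectrum A" "c \<in> \<real>\<^sub>\<le>\<^sub>0" for c
  proof -
    obtain r where r: "c = of_real r" "r \<le> 0" using c(2) by (rule nonpos_Reals_cases)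
    define y where "y = (1 / (r - 1)) *\<^sub>R (A - 1)"
    have "norm y \<le> norm (A - 1)"
    proof -
      have "norm y = norm (A - 1) / \<bar>r - 1\<bar>" by (simp add: y_def)
      also have "\<dots> \<le> norm (A - 1) / 1" using r by (intro divide_left_mono) auto
      finally show ?thesis by simp
    qed
    then obtain S where S: "is_inverse (1 - y) S" using is_inverse_one_minus[of y] assms by auto
    have "cop_of_complex c = r *\<^sub>R 1"
      by (rule cop_eqI) (simp add: cop_apply_of_complex cop_apply_simps r scaleC_of_real)
    moreover have "(r - 1) *\<^sub>R y = A - 1" using r by (simp add: y_def)
    ultimately have "cop_of_complex c - A = (r - 1) *\<^sub>R (1 - y)"
      by (simp add: scaleR_diff_right scaleR_diff_left)
    hence "is_inverse (cop_of_complex c - A) ((1 / (r - 1)) *\<^sub>R S)"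
      using S r by (simp add: is_inverse_def)
    thus False using c(1) by (auto simp: spectrum_def)
  qed
  thus ?thesis by blast
qed

lemma real_power_series_eq_0:
  fixes a :: "nat \<Rightarrow> real"
  assumes "r > 0" "\<And>t. \<bar>t\<bar> < r \<Longrightarrow> (\<lambda>k. a k * t ^ Suc k) sums 0"
  shows "a k = 0"
proof (rule ccontr)
  assume k: "a k \<noteq> 0"
  define b where "b n = (case n of 0 \<Rightarrow> 0 | Suc k \<Rightarrow> a k)" for n
  have "(\<lambda>n. b n * (t - 0) ^ n) sums 0" if "norm (t - 0) < r" for t
    using assms(2)[of t] that sums_Suc_iff[of "\<lambda>n. b n * (t - 0) ^ n" 0] by (simp add: b_def)
  \<comment> \<open>A nonzero coefficient would make 0 an isolated zero of the sum, but the sum is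
    the zero function.\<close>
  from powser_0_nonzero[OF assms(1) this _ _, of "Suc k"] k
  obtain s where s: "s > 0" "\<And>z. z \<in> cball (0::real) s - {0} \<Longrightarrow> (0::real) \<noteq> 0"
    by (auto simp: b_def)
  from s(2)[of s] s(1) show False by simp
qed

lemma is_magnus_expansion_unique:
  assumes "is_magnus_expansion B1 B2 \<mu>" "is_magnus_expansion B1 B2 \<nu>"
  shows "\<mu> = \<nu>"
proof
  fix n
  obtain r1 where r1: "r1 > 0" "\<And>t. \<bar>t\<bar> < r1 \<Longrightarrow>
      (\<lambda>k. t ^ Suc k *\<^sub>R \<mu> (Suc k)) sums log_op (exp (t *\<^sub>R B1) * exp (t *\<^sub>R B2))"
    using assms(1) unfolding is_magnus_expansion_def by blast
  obtain r2 where r2: "r2 > 0" "\<And>t. \<bar>t\<bar> < r2 \<Longrightarrow>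
      (\<lambda>k. t ^ Suc k *\<^sub>R \<nu> (Suc k)) sums log_op (exp (t *\<^sub>R B1) * exp (t *\<^sub>R B2))"
    using assms(2) unfolding is_magnus_expansion_def by blast
  have "\<mu> (Suc k) - \<nu> (Suc k) = 0" for k
  proof (rule cop_eq_0I)
    fix x y
    let ?l = "\<lambda>A. inner (cop_apply A x) y"
    have bl: "bounded_linear ?l"
      by (rule bounded_linear_compose[OF bounded_linear_inner_left bounded_linear_cop_apply])
    have "(\<lambda>k. ?l (\<mu> (Suc k) - \<nu> (Suc k)) * t ^ Suc k) sums 0" if t: "\<bar>t\<bar> < min r1 r2" for t
    proof -
      have "(\<lambda>k. t ^ Suc k *\<^sub>R \<mu> (Suc k) - t ^ Suc k *\<^sub>R \<nu> (Suc k)) sums 0"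
        using sums_diff[OF r1(2) r2(2), of t t] t by simp
      from bounded_linear.sums[OF bl this] show ?thesis
        by (simp add: scaleR_diff_right[symmetric] cop_apply_simps mult.commute del: scaleR_diff_right power_Suc)
    qed
    from real_power_series_eq_0[of "min r1 r2", OF _ this] r1(1) r2(1) show "?l (\<mu> (Suc k) - \<nu> (Suc k)) = 0" by simp
  qed
  moreover have "\<mu> 0 = 0" "\<nu> 0 = 0" using assms by (auto simp: is_magnus_expansion_def)
  ultimately show "\<mu> n = \<nu> n" by (cases n) auto
qed

text \<open>All later knowledge about \<open>magnus\<close> comes from here. The bound 1/2 is kept
  in the conclusion because it controls the norm of the logarithm, not just its convergence.\<close>

lemma magnus_near_0:
  obtains r where "r > 0"
    "\<And>t. \<bar>t\<bar> < r \<Longrightarrow> norm (exp (t *\<^sub>R B1) * exp (t *\<^sub>R B2) - 1) \<le> 1 / 2"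
    "\<And>t. \<bar>t\<bar> < r \<Longrightarrow> (\<lambda>k. t ^ Suc k *\<^sub>R magnus B1 B2 (Suc k)) sums
      log1p_series (exp (t *\<^sub>R B1) * exp (t *\<^sub>R B2) - 1)"
proof -
  let ?X = "\<lambda>t. exp (t *\<^sub>R B1) * exp (t *\<^sub>R B2) - 1"
  obtain c where X: "\<And>t. (\<lambda>j. t ^ j *\<^sub>R c j) sums ?X t"
    and c: "summable (\<lambda>j. norm (c j))" "c 0 = 0"
    using exp_scaleR_mult_power_series[of B1 B2] by metis
  obtain \<rho> :: real where \<rho>: "\<rho> > 0" and bound: "\<And>j. (\<Sum>i\<le>j. norm (c i) * \<rho> ^ i) \<le> 1 / 2"
    using power_series_coeff_bound[OF c] by blast
  obtain \<mu> where \<mu>: "\<mu> 0 = 0" and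
    log: "\<And>t X. \<bar>t\<bar> < \<rho> \<Longrightarrow> (\<lambda>j. t ^ j *\<^sub>R c j) sums X \<Longrightarrow> (\<lambda>j. t ^ j *\<^sub>R \<mu> j) sums log1p_series X"
    using log1p_series_power_series[OF bound \<rho> c(2)] by blast
  have le: "norm (?X t) \<le> 1 / 2" if t: "\<bar>t\<bar> < \<rho>" for t
  proof (rule LIMSEQ_le_const2)
    show "(\<lambda>n. norm (\<Sum>i<n. t ^ i *\<^sub>R c i)) \<longlonglongrightarrow> norm (?X t)"
      using X[of t] unfolding sums_def by (rule tendsto_norm)
    have "norm (\<Sum>i<n. t ^ i *\<^sub>R c i) \<le> 1 / 2" for n
    proof -
      have "norm (\<Sum>i<n. t ^ i *\<^sub>R c i) \<le> (\<Sum>i<n. norm (c i) * \<rho> ^ i)"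
      proof (rule sum_norm_le)
        fix i
        have "\<bar>t\<bar> ^ i \<le> \<rho> ^ i" using t by (intro power_mono) auto
        thus "norm (t ^ i *\<^sub>R c i) \<le> norm (c i) * \<rho> ^ i"
          by (simp add: power_abs mult.commute[of "norm (c i)"] mult_right_mono)
      qed
      also have "\<dots> \<le> (\<Sum>i\<le>n. norm (c i) * \<rho> ^ i)" using \<rho> by (intro sum_mono2) auto
      finally show ?thesis using bound[of n] by linarith
    qed
    thus "\<exists>N. \<forall>n\<ge>N. norm (\<Sum>i<n. t ^ i *\<^sub>R c i) \<le> 1 / 2" by blast
  qed
  have sums: "(\<lambda>k. t ^ Suc k *\<^sub>R \<mu> (Suc k)) sums log1p_series (?X t)" if "\<bar>t\<bar> < \<rho>" for t
    using log[OF that X] sums_Suc_iff[of "\<lambda>j. t ^ j *\<^sub>R \<mu> j"] by (simp add: \<mu>)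
  have "is_magnus_expansion B1 B2 \<mu>"
    unfolding is_magnus_expansion_def
  proof (intro conjI exI[of _ \<rho>] allI impI)
    fix t :: real assume t: "\<bar>t\<bar> < \<rho>"
    have lt: "norm (?X t) < 1" using le[OF t] by linarith
    show "spectrum (exp (t *\<^sub>R B1) * exp (t *\<^sub>R B2)) \<inter> \<real>\<^sub>\<le>\<^sub>0 = {}"
      by (rule spectrum_disjoint_nonpos_Reals[OF lt])
    show "(\<lambda>k. t ^ Suc k *\<^sub>R \<mu> (Suc k)) sums log_op (exp (t *\<^sub>R B1) * exp (t *\<^sub>R B2))"
      unfolding log_op_eq_log1p_series[OF lt] by (rule sums[OF t])
  qed (use \<mu> \<rho> in auto)
  hence "magnus B1 B2 = \<mu>"
    unfolding magnus_def using is_magnus_expansion_unique by blast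
  with \<rho> le sums that show thesis by blast
qed

section \<open>Real-analytic functions and holomorphic extension\<close>

text \<open>This is real analyticity of a complex-valued function, phrased through holomorphic
  extensions: closure under algebraic operations and under composition with entire functions is then
  inherited from holomorphic functions, and so is the identity theorem.\<close>

definition locally_holomorphic_extension :: "(real \<Rightarrow> complex) \<Rightarrow> real set \<Rightarrow> bool" where
  "locally_holomorphic_extension g S \<longleftrightarrow> (\<forall>x\<in>S. \<exists>r>0. \<exists>G. G holomorphic_on ball (of_real x) r \<and>
    (\<forall>y. \<bar>y - x\<bar> < r \<longrightarrow> g y = G (of_real y)))"

lemma locally_holomorphic_extension_of_real:
  assumes "H holomorphic_on UNIV"
  shows "locally_holomorphic_extension (\<lambda>t. H (of_real t)) S"
  unfolding locally_holomorphic_extension_def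
  using holomorphic_on_subset[OF assms] by (intro ballI exI[of _ 1]) auto

lemma locally_holomorphic_extension_binary:
  assumes f: "locally_holomorphic_extension f S" and g: "locally_holomorphic_extension g S"
    and op: "\<And>A F G. F holomorphic_on A \<Longrightarrow> G holomorphic_on A \<Longrightarrow> (\<lambda>z. op (F z) (G z)) holomorphic_on A"
  shows "locally_holomorphic_extension (\<lambda>t. op (f t) (g t)) S"
  unfolding locally_holomorphic_extension_def
proof
  fix x assume "x \<in> S"
  obtain r F where F: "r > 0" "F holomorphic_on ball (of_real x) r" "\<And>y. \<bar>y - x\<bar> < r \<Longrightarrow> f y = F (of_real y)"
    using f \<open>x \<in> S\<close> unfolding locally_holomorphic_extension_def by blast
  obtain s G where G: "s > 0" "G holomorphic_on ball (of_real x) s" "\<And>y. \<bar>y - x\<bar> < s \<Longrightarrow> g y = G (of_real y)"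
    using g \<open>x \<in> S\<close> unfolding locally_holomorphic_extension_def by blast
  have "(\<lambda>z. op (F z) (G z)) holomorphic_on ball (of_real x) (min r s)"
    by (intro op holomorphic_on_subset[OF F(2)] holomorphic_on_subset[OF G(2)]) auto
  with F G show "\<exists>r>0. \<exists>H. H holomorphic_on ball (of_real x) r \<and> (\<forall>y. \<bar>y - x\<bar> < r \<longrightarrow> op (f y) (g y) = H (of_real y))"
    by (intro exI[of _ "min r s"] conjI exI[of _ "\<lambda>z. op (F z) (G z)"]) auto
qed

lemmas locally_holomorphic_extension_intros =
  locally_holomorphic_extension_binary[where op = "(+)", OF _ _ holomorphic_on_add]
  locally_holomorphic_extension_binary[where op = "(-)", OF _ _ holomorphic_on_diff]
  locally_holomorphic_extension_binary[where op = "(*)", OF _ _ holomorphic_on_mult]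

lemma locally_holomorphic_extension_compose:
  assumes "locally_holomorphic_extension f S" and H: "H holomorphic_on UNIV"
  shows "locally_holomorphic_extension (\<lambda>t. H (f t)) S"
  using locally_holomorphic_extension_binary[OF assms(1) assms(1), where op = "\<lambda>a b. H a"]
    holomorphic_on_compose_gen[OF _ H, unfolded o_def] by blast

lemma locally_holomorphic_extension_real_analytic:
  assumes f: "real_analytic_on f S" and l: "bounded_linear l"
  shows "locally_holomorphic_extension (\<lambda>t. l (f t)) S"
  unfolding locally_holomorphic_extension_def
proof
  fix x assume "x \<in> S"
  then obtain a r where r: "r > 0" and s: "\<And>y. \<bar>y - x\<bar> < r \<Longrightarrow> (\<lambda>n. (y - x) ^ n *\<^sub>R a n) sums f y"
    using f unfolding real_analytic_on_def by blast
  define G where "G z = (\<Sum>n. l (a n) * (z - of_real x) ^ n)" for z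
  have sl: "(\<lambda>n. l (a n) * (of_real y - of_real x) ^ n) sums l (f y)" if "\<bar>y - x\<bar> < r" for y
    using bounded_linear.sums[OF l s[OF that]]
    by (simp add: linear_simps[OF l] scaleR_conv_of_real mult.commute)
  have "(\<lambda>n. l (a n) * (z - of_real x) ^ n) sums G z" if z: "z \<in> ball (of_real x) r" for z
  proof -
    \<comment> \<open>The expansion is known to converge at real points only; convergence at
      \<open>x + \<rho>\<close> carries over to every complex point closer to
      \<open>x\<close>.\<close>
    obtain \<rho> where \<rho>: "cmod (z - of_real x) < \<rho>" "\<rho> < r"
      using z dense by (auto simp: dist_norm norm_minus_commute)
    have "\<rho> \<ge> 0" using \<rho>(1) norm_ge_zero[of "z - of_real x"] by linarith
    hence "summable (\<lambda>n. l (a n) * (of_real \<rho>) ^ n)"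
      using sl[of "x + \<rho>"] \<rho>(2) by (simp add: sums_iff)
    hence "summable (\<lambda>n. l (a n) * (z - of_real x) ^ n)"
      by (rule powser_inside) (use \<rho>(1) \<open>\<rho> \<ge> 0\<close> in simp)
    thus ?thesis unfolding G_def by (rule summable_sums)
  qed
  hence "G holomorphic_on ball (of_real x) r" by (rule power_series_holomorphic)
  moreover have "l (f y) = G (of_real y)" if "\<bar>y - x\<bar> < r" for y
    using sl[OF that] by (simp add: G_def sums_iff)
  ultimately show "\<exists>r>0. \<exists>G. G holomorphic_on ball (of_real x) r \<and> (\<forall>y. \<bar>y - x\<bar> < r \<longrightarrow> l (f y) = G (of_real y))"
    using r by blast
qed

text \<open>A connectedness argument. Let \<open>?Z\<close> be the set of points near which
  \<open>g\<close> vanishes. If the disc of extension around \<open>x\<close> meets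
  \<open>?Z\<close> in a real point, analytic continuation kills \<open>g\<close> on all real points
  of the disc. Hence \<open>?Z\<close> is open and is disjoint from the union \<open>V\<close> of
  the discs around points outside it.\<close>

lemma locally_holomorphic_extension_eq_0:
  fixes a b :: real
  assumes g: "locally_holomorphic_extension g {a<..<b}"
    and 0: "\<forall>\<^sub>F t in at_right a. g t = 0" and t: "t \<in> {a<..<b}"
  shows "g t = 0"
proof -
  let ?S = "{a<..<b}"
  let ?Z = "{x. \<forall>\<^sub>F y in nhds x. g y = 0}"
  have "\<exists>r>0. \<forall>y\<in>?Z. \<bar>y - x\<bar> < r \<longrightarrow> (\<forall>y. \<bar>y - x\<bar> < r \<longrightarrow> g y = 0)" if x: "x \<in> ?S" for x
  proof -
    obtain r G where r: "r > 0" and G: "G holomorphic_on ball (of_real x) r"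
      "\<And>y. \<bar>y - x\<bar> < r \<Longrightarrow> g y = G (of_real y)"
      using bspec[OF g[unfolded locally_holomorphic_extension_def] x] by blast
    have "g v = 0" if u: "u \<in> ?Z" "\<bar>u - x\<bar> < r" and v: "\<bar>v - x\<bar> < r" for u v
    proof -
      obtain e where e: "e > 0" "\<And>y. \<bar>y - u\<bar> < e \<Longrightarrow> g y = 0"
        using u(1) unfolding mem_Collect_eq eventually_nhds_metric dist_real_def by blast
      let ?U = "of_real ` {y. \<bar>y - u\<bar> < e \<and> \<bar>y - x\<bar> < r} :: complex set"
      have "of_real u islimpt ?U"
        unfolding islimpt_approachable
      proof (intro allI impI)
        fix \<epsilon> :: real assume "\<epsilon> > 0"
        define m where "m = min (min e (r - \<bar>u - x\<bar>)) \<epsilon>"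
        have m: "m > 0" "m \<le> e" "m \<le> r - \<bar>u - x\<bar>" "m \<le> \<epsilon>"
          using \<open>\<epsilon> > 0\<close> e(1) u(2) by (simp_all add: m_def)
        define s where "s = m / 2"
        have s: "s > 0" "s < e" "s < \<epsilon>" "\<bar>u + s - x\<bar> < r"
          using m by (simp_all add: s_def)
        have "complex_of_real (u + s) \<in> ?U" using s by (intro imageI) simp
        moreover have "dist (complex_of_real (u + s)) (of_real u) < \<epsilon>" using s by (simp add: dist_norm)
        ultimately show "\<exists>x'\<in>?U. x' \<noteq> of_real u \<and> dist x' (of_real u) < \<epsilon>"
          using s(1) by (intro bexI[of _ "complex_of_real (u + s)"]) auto
      qed
      hence "G (of_real v) = 0"
      proof (rule analytic_continuation[OF G(1) open_ball connected_ball, rotated 2])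
        show "?U \<subseteq> ball (of_real x) r" "of_real u \<in> ball (complex_of_real x) r" "of_real v \<in> ball (complex_of_real x) r"
          using u(2) v by (auto simp: dist_of_real dist_real_def abs_minus_commute)
        show "G z = 0" if "z \<in> ?U" for z using that e(2) G(2) by fastforce
      qed
      thus ?thesis using G(2)[OF v] by simp
    qed
    thus ?thesis using r by blast
  qed
  then obtain r where r: "\<And>x. x \<in> ?S \<Longrightarrow> r x > 0"
    "\<And>x y v. x \<in> ?S \<Longrightarrow> y \<in> ?Z \<Longrightarrow> \<bar>y - x\<bar> < r x \<Longrightarrow> \<bar>v - x\<bar> < r x \<Longrightarrow> g v = 0" by metis
  define V where "V = (\<Union>x\<in>?S - ?Z. ball x (r x))"
  have "open V" unfolding V_def by blast
  have "open ?Z"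
    unfolding open_contains_ball
  proof
    fix x assume "x \<in> ?Z"
    then obtain e where e: "e > 0" "\<And>y. dist y x < e \<Longrightarrow> g y = 0"
      unfolding mem_Collect_eq eventually_nhds_metric by blast
    have "y \<in> ?Z" if "dist x y < e / 2" for y
    proof -
      have "dist z x < e" if "dist z y < e / 2" for z
        using that \<open>dist x y < e / 2\<close> dist_triangle[of z x y] by (simp add: dist_commute)
      thus ?thesis using e unfolding mem_Collect_eq eventually_nhds_metric
        by (intro exI[of _ "e / 2"]) auto
    qed
    thus "\<exists>e>0. ball x e \<subseteq> ?Z" using e(1) by (intro exI[of _ "e / 2"]) auto
  qed
  have "?Z \<inter> V = {}"
  proof -
    have False if y: "y \<in> ?Z" and x: "x \<in> ?S - ?Z" and d: "dist x y < r x" for x y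
    proof -
      have "g v = 0" if "dist v x < r x" for v
        using r(2)[of x y v] x y d that by (simp add: dist_real_def abs_minus_commute)
      hence "x \<in> ?Z" using r(1)[of x] x unfolding mem_Collect_eq eventually_nhds_metric by blast
      with x show False by blast
    qed
    thus ?thesis by (fastforce simp: V_def)
  qed
  moreover have cover: "?S \<subseteq> ?Z \<union> V"
  proof
    fix x assume x: "x \<in> ?S"
    have "x \<in> V" if "x \<notin> ?Z"
      unfolding V_def by (rule UN_I[of x]) (use that x r(1)[OF x] in simp_all)
    thus "x \<in> ?Z \<union> V" by blast
  qed
  moreover have "?Z \<inter> ?S \<noteq> {}"
  proof -
    obtain c where c: "c > a" "\<And>y. a < y \<Longrightarrow> y < c \<Longrightarrow> g y = 0"
      using 0 t by (auto simp: eventually_at_right[of a b])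
    obtain m where m: "a < m" "m < min b c" using dense[of a "min b c"] c(1) t by auto
    have "\<forall>\<^sub>F y in nhds m. y \<in> {a<..<c}" by (rule eventually_nhds_in_open) (use m in auto)
    hence "m \<in> ?Z" using c(2) by (auto elim: eventually_mono)
    thus ?thesis using m by auto
  qed
  ultimately have "V \<inter> ?S = {}"
    using connectedD[of ?S ?Z V] \<open>open ?Z\<close> \<open>open V\<close> by auto
  hence "t \<in> ?Z" using cover t by blast
  thus ?thesis by (auto dest: eventually_nhds_x_imp_x)
qed

text \<open>\<open>cos \<surd>d\<close> and \<open>sin \<surd>d / \<surd>d\<close> as entire functions of \<open>d\<close>, so that no branch of the square root
  has to be continued along the extension.\<close>

definition cos_sq :: "complex \<Rightarrow> complex" where
  "cos_sq d = (\<Sum>k. (- d) ^ k / fact (2 * k))"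

definition sinc_sq :: "complex \<Rightarrow> complex" where
  "sinc_sq d = (\<Sum>k. (- d) ^ k / fact (2 * k + 1))"

lemma cos_sq_series:
  "(\<lambda>k. (- (z\<^sup>2)) ^ k / fact (2 * k)) sums cos (z :: complex)"
proof -
  have "(\<lambda>k. cos_coeff (2 * k) *\<^sub>R z ^ (2 * k)) sums cos z"
    using cos_converges[of z]
    by (subst sums_mono_reindex[of "\<lambda>k. 2 * k", where f = "\<lambda>n. cos_coeff n *\<^sub>R z ^ n"])
      (auto simp: strict_mono_def cos_coeff_def elim!: evenE)
  moreover have "cos_coeff (2 * k) *\<^sub>R z ^ (2 * k) = (- (z\<^sup>2)) ^ k / fact (2 * k)" for k
    by (simp add: cos_coeff_def scaleR_conv_of_real power_mult power_minus[of "z\<^sup>2"])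
  ultimately show ?thesis by simp
qed

lemma sinc_sq_series:
  fixes z :: complex
  assumes "z \<noteq> 0"
  shows "(\<lambda>k. (- (z\<^sup>2)) ^ k / fact (2 * k + 1)) sums (sin z / z)"
proof -
  have "(\<lambda>k. sin_coeff (2 * k + 1) *\<^sub>R z ^ (2 * k + 1)) sums sin z"
    using sin_converges[of z]
    by (subst sums_mono_reindex[of "\<lambda>k. 2 * k + 1", where f = "\<lambda>n. sin_coeff n *\<^sub>R z ^ n"])
      (auto simp: strict_mono_def sin_coeff_def elim!: oddE)
  from sums_divide[OF this, of z] have "(\<lambda>k. sin_coeff (2 * k + 1) *\<^sub>R z ^ (2 * k + 1) / z) sums (sin z / z)" .
  moreover have "sin_coeff (2 * k + 1) *\<^sub>R z ^ (2 * k + 1) / z = (- (z\<^sup>2)) ^ k / fact (2 * k + 1)" for k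
    using assms by (simp add: sin_coeff_def scaleR_conv_of_real power_mult power_minus[of "z\<^sup>2"] del: fact_Suc)
  ultimately show ?thesis by simp
qed

lemma cos_sq_sums: "(\<lambda>k. (- d) ^ k / fact (2 * k)) sums cos_sq d"
  using cos_sq_series[of "csqrt d"] by (simp add: cos_sq_def sums_iff)

lemma sinc_sq_sums: "(\<lambda>k. (- d) ^ k / fact (2 * k + 1)) sums sinc_sq d"
proof (cases "d = 0")
  case True
  have "(\<lambda>k. (- d) ^ k / fact (2 * k + 1)) sums (- d) ^ 0"
    using sums_single[of 0 "\<lambda>k. (- d) ^ k / fact (2 * k + 1)"] True
    by (simp add: power_0_left if_distrib[of "\<lambda>x. x / _"] cong: if_cong)
  thus ?thesis unfolding sinc_sq_def by (metis sums_summable summable_sums)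
next
  case False
  thus ?thesis using sinc_sq_series[of "csqrt d"] by (simp add: sinc_sq_def sums_iff)
qed

lemma cos_sq_power2: "cos_sq (z\<^sup>2) = cos z"
  using cos_sq_series[of z] by (simp add: cos_sq_def sums_iff)

lemma sinc_sq_power2: "z * sinc_sq (z\<^sup>2) = sin z"
  using sinc_sq_series[of z] by (cases "z = 0") (auto simp: sinc_sq_def sums_iff)

lemma cos_sq_sinc_sq: "(cos_sq d)\<^sup>2 + d * (sinc_sq d)\<^sup>2 = 1"
proof -
  have "d * (sinc_sq d)\<^sup>2 = (csqrt d * sinc_sq ((csqrt d)\<^sup>2))\<^sup>2" by (simp add: power_mult_distrib)
  moreover have "cos_sq d = cos_sq ((csqrt d)\<^sup>2)" by simp
  ultimately show ?thesis by (simp only: cos_sq_power2 sinc_sq_power2) simp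
qed

lemma cos_sq_holomorphic: "cos_sq holomorphic_on UNIV"
proof -
  have "cos_sq holomorphic_on ball 0 r" for r
  proof (rule power_series_holomorphic)
    show "(\<lambda>n. ((- 1) ^ n / fact (2 * n)) * (w - 0) ^ n) sums cos_sq w" for w
      using cos_sq_sums[of w] by (simp add: power_minus[of w])
  qed
  hence "cos_sq field_differentiable at z" for z
    by (rule holomorphic_on_imp_differentiable_at[of _ "ball 0 (norm z + 1)"]) auto
  thus ?thesis by (auto simp: holomorphic_on_def field_differentiable_at_within)
qed

section \<open>Operators preserving a block\<close>

lemma coord_simps:
  "coord 0 n = 0"
  "coord (x + y) n = coord x n + coord y n"
  "coord (x - y) n = coord x n - coord y n"
  "coord (- x) n = - coord x n"
  "coord (r *\<^sub>R x) n = r *\<^sub>R coord x n"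
  "coord (c *\<^sub>C x) n = c *s coord x n"
  by (simp_all add: zero_hsum.rep_eq plus_hsum.rep_eq minus_hsum.rep_eq uminus_hsum.rep_eq
      scaleR_hsum.rep_eq scaleC_hsum.rep_eq)

lemma scaleC_algebra:
  "(c + d) *\<^sub>C x = c *\<^sub>C x + d *\<^sub>C x"
  "(c - d) *\<^sub>C x = c *\<^sub>C x - d *\<^sub>C x"
  "(- c) *\<^sub>C x = - (c *\<^sub>C x)"
  "1 *\<^sub>C x = x"
  "(r *\<^sub>R c) *\<^sub>C x = r *\<^sub>R (c *\<^sub>C x)"
  by (rule hsum_eqI, simp add: coord_simps vec_eq_iff algebra_simps)+

lemma bounded_linear_scaleC_left: "bounded_linear (\<lambda>c. c *\<^sub>C x)"
  by (rule bounded_linear_intro[of _ "norm x"]) (simp_all add: scaleC_algebra norm_scaleC)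

lemma cop_exp_sums: "(\<lambda>k. cop_apply (A ^ k) x /\<^sub>R fact k) sums cop_apply (exp A) x"
  using bounded_linear.sums[OF bounded_linear_cop_apply[of x] summable_sums[OF summable_exp_generic[of A]]]
  by (simp add: exp_def cop_apply_simps)

text \<open>The even powers of \<open>G\<close> act on \<open>x\<close> as scalars and the odd ones
  as multiples of \<open>G\<close>, so the exponential series splits into the two entire functions.
  The relation is required at the single vector \<open>x\<close>, since it holds only on a
  block.\<close>

lemma cop_apply_exp_quadratic:
  assumes G: "cop_apply G (cop_apply G x) = (- d) *\<^sub>C x"
  shows "cop_apply (exp G) x = cos_sq d *\<^sub>C x + sinc_sq d *\<^sub>C cop_apply G x"
proof -
  have even: "cop_apply (G ^ (2 * k)) x = ((- d) ^ k) *\<^sub>C x" for k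
  proof (induction k)
    case (Suc k)
    have "2 * Suc k = 2 * k + 2" by simp
    hence "cop_apply (G ^ (2 * Suc k)) x = cop_apply (G ^ (2 * k) * (G * G)) x"
      by (simp only: power_add power2_eq_square)
    also have "\<dots> = (- d) *\<^sub>C cop_apply (G ^ (2 * k)) x"
      by (simp only: cop_apply_simps G cop_apply_scaleC)
    finally show ?case by (simp add: Suc.IH scaleC_scaleC)
  qed (simp add: cop_apply_simps scaleC_algebra)
  have odd: "cop_apply (G ^ (2 * k + 1)) x = ((- d) ^ k) *\<^sub>C cop_apply G x" for k
    using even[of k] by (simp add: cop_apply_simps cop_apply_scaleC)
  let ?f = "\<lambda>k. cop_apply (G ^ k) x /\<^sub>R fact k"
  have real: "c *\<^sub>C y /\<^sub>R fact n = (c / fact n) *\<^sub>C y" for c y n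
    by (simp add: scaleC_algebra(5)[symmetric] scaleR_conv_of_real divide_inverse mult.commute)
  have "(\<lambda>k. ?f (2 * k)) sums (cos_sq d *\<^sub>C x)"
    using bounded_linear.sums[OF bounded_linear_scaleC_left cos_sq_sums] by (simp only: even real)
  hence 1: "(\<lambda>k. if even k then ?f k else 0) sums (cos_sq d *\<^sub>C x)"
    by (subst sums_mono_reindex[of "\<lambda>k. 2 * k", symmetric])
      (auto simp: strict_mono_def elim!: evenE)
  have "(\<lambda>k. ?f (2 * k + 1)) sums (sinc_sq d *\<^sub>C cop_apply G x)"
    using bounded_linear.sums[OF bounded_linear_scaleC_left sinc_sq_sums] by (simp only: odd real)
  hence 2: "(\<lambda>k. if odd k then ?f k else 0) sums (sinc_sq d *\<^sub>C cop_apply G x)"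
    by (subst sums_mono_reindex[of "\<lambda>k. 2 * k + 1", symmetric])
      (auto simp: strict_mono_def elim!: oddE)
  have "(\<lambda>k. (if even k then ?f k else 0) + (if odd k then ?f k else 0)) = ?f" by auto
  with sums_add[OF 1 2] have "?f sums (cos_sq d *\<^sub>C x + sinc_sq d *\<^sub>C cop_apply G x)" by simp
  thus ?thesis using cop_exp_sums[of G x] sums_unique2 by blast
qed

lemma cop_apply_exp_of_complex: "cop_apply (exp (cop_of_complex c)) x = exp c *\<^sub>C x"
proof -
  have pow: "cop_apply (cop_of_complex c ^ k) x = c ^ k *\<^sub>C x" for k
    by (induction k) (simp_all add: cop_apply_simps cop_apply_of_complex scaleC_algebra scaleC_scaleC)
  have "(\<lambda>k. (c ^ k /\<^sub>R fact k) *\<^sub>C x) sums (exp c *\<^sub>C x)"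
    by (rule bounded_linear.sums[OF bounded_linear_scaleC_left exp_converges])
  hence "(\<lambda>k. cop_apply (cop_of_complex c ^ k) x /\<^sub>R fact k) sums (exp c *\<^sub>C x)"
    by (simp only: scaleC_algebra pow)
  thus ?thesis using cop_exp_sums sums_unique2 by blast
qed

lemma cop_apply_exp_shift:
  assumes "F = cop_of_complex p + G"
  shows "cop_apply (exp F) x = exp p *\<^sub>C cop_apply (exp G) x"
proof -
  have "cop_of_complex p * G = G * cop_of_complex p"
    by (rule cop_eqI) (simp add: cop_apply_simps cop_apply_of_complex cop_apply_scaleC)
  hence "exp F = exp (cop_of_complex p) * exp G" by (simp add: assms exp_add_commuting)
  thus ?thesis by (simp add: cop_apply_simps cop_apply_exp_of_complex)
qed

text \<open>Removing half the trace leaves a traceless operator on the span of \<open>x\<close> and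
  \<open>y\<close>. By Cayley-Hamilton its square there is minus its determinant \<open>d\<close>,
  and the removed scalar contributes a factor to the exponential.\<close>

lemma cop_apply_exp_2x2:
  fixes a b c e :: complex
  assumes F: "cop_apply F x = a *\<^sub>C x + c *\<^sub>C y" "cop_apply F y = b *\<^sub>C x + e *\<^sub>C y"
  defines "g \<equiv> (a - e) / 2" and "d \<equiv> - (((a - e) / 2)\<^sup>2 + b * c)"
  shows "cop_apply (exp F) x = exp ((a + e) / 2) *\<^sub>C
      ((cos_sq d + sinc_sq d * g) *\<^sub>C x + (sinc_sq d * c) *\<^sub>C y)"
    and "cop_apply (exp F) y = exp ((a + e) / 2) *\<^sub>C
      ((sinc_sq d * b) *\<^sub>C x + (cos_sq d - sinc_sq d * g) *\<^sub>C y)"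
proof -
  define G where "G = F - cop_of_complex ((a + e) / 2)"
  have ge: "a - (a + e) / 2 = g" "e - (a + e) / 2 = - g" by (simp_all add: g_def field_simps)
  have Gx: "cop_apply G x = g *\<^sub>C x + c *\<^sub>C y"
  proof -
    have "cop_apply G x = (a - (a + e) / 2) *\<^sub>C x + c *\<^sub>C y"
      by (simp only: G_def F cop_apply_simps cop_apply_of_complex scaleC_algebra) simp
    thus ?thesis by (simp only: ge)
  qed
  have Gy: "cop_apply G y = b *\<^sub>C x + (- g) *\<^sub>C y"
  proof -
    have "cop_apply G y = b *\<^sub>C x + (e - (a + e) / 2) *\<^sub>C y"
      by (simp only: G_def F cop_apply_simps cop_apply_of_complex scaleC_algebra) simp
    thus ?thesis by (simp only: ge)
  qed
  have d: "- d = g * g + c * b" by (simp add: d_def g_def power2_eq_square)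
  have GGx: "cop_apply G (cop_apply G x) = (- d) *\<^sub>C x"
  proof -
    have "cop_apply G (cop_apply G x) = g *\<^sub>C (g *\<^sub>C x + c *\<^sub>C y) + c *\<^sub>C (b *\<^sub>C x + (- g) *\<^sub>C y)"
      by (simp only: Gx cop_apply_simps cop_apply_scaleC Gy)
    also have "\<dots> = (g * g + c * b) *\<^sub>C x"
      by (rule hsum_eqI) (simp add: coord_simps vec_eq_iff algebra_simps)
    finally show ?thesis by (simp only: d)
  qed
  have GGy: "cop_apply G (cop_apply G y) = (- d) *\<^sub>C y"
  proof -
    have "cop_apply G (cop_apply G y) = b *\<^sub>C (g *\<^sub>C x + c *\<^sub>C y) + (- g) *\<^sub>C (b *\<^sub>C x + (- g) *\<^sub>C y)"
      by (simp only: Gx cop_apply_simps cop_apply_scaleC Gy)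
    also have "\<dots> = (g * g + c * b) *\<^sub>C y"
      by (rule hsum_eqI) (simp add: coord_simps vec_eq_iff algebra_simps)
    finally show ?thesis by (simp only: d)
  qed
  have F_eq: "F = cop_of_complex ((a + e) / 2) + G" by (simp add: G_def)
  show "cop_apply (exp F) x = exp ((a + e) / 2) *\<^sub>C
      ((cos_sq d + sinc_sq d * g) *\<^sub>C x + (sinc_sq d * c) *\<^sub>C y)"
    unfolding cop_apply_exp_shift[OF F_eq] cop_apply_exp_quadratic[OF GGx] Gx
    by (simp add: scaleC_add scaleC_scaleC scaleC_algebra)
  show "cop_apply (exp F) y = exp ((a + e) / 2) *\<^sub>C
      ((sinc_sq d * b) *\<^sub>C x + (cos_sq d - sinc_sq d * g) *\<^sub>C y)"
    unfolding cop_apply_exp_shift[OF F_eq] cop_apply_exp_quadratic[OF GGy] Gy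
    by (simp add: scaleC_add scaleC_scaleC scaleC_algebra scaleC_simps)
qed

section \<open>Matrix entries of a diagonal block\<close>

definition hunit :: "nat \<Rightarrow> 2 \<Rightarrow> hsum" where
  "hunit n i = Abs_hsum (\<lambda>m. if m = n then axis i 1 else 0)"

lemma coord_hunit: "coord (hunit n i) m = (if m = n then axis i 1 else 0)"
proof -
  have "summable (\<lambda>m. (norm (if m = n then axis i 1 else 0 :: complex^2))\<^sup>2)"
    by (rule summable_finite[of "{n}"]) auto
  thus ?thesis by (simp add: hunit_def Abs_hsum_inverse)
qed

lemma norm_hunit: "norm (hunit n i) = 1"
proof -
  have "(\<lambda>m. (norm (coord (hunit n i) m))\<^sup>2) sums (norm (coord (hunit n i) n))\<^sup>2"
    by (rule sums_single[of n "\<lambda>m. (norm (coord (hunit n i) m))\<^sup>2", THEN iffD1[OF sums_cong, rotated]])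
      (auto simp: coord_hunit)
  hence "(norm (hunit n i))\<^sup>2 = 1" unfolding norm_hsum_sq by (simp add: sums_iff coord_hunit)
  thus ?thesis by (simp add: power2_eq_1_iff) (use norm_ge_zero[of "hunit n i"] in linarith)
qed

definition entry :: "nat \<Rightarrow> cop \<Rightarrow> 2 \<Rightarrow> 2 \<Rightarrow> complex" where
  "entry n A i j = coord (cop_apply A (hunit n j)) n $ i"

lemma cmod_entry_le: "cmod (entry n A i j) \<le> norm A"
proof -
  have "cmod (entry n A i j) \<le> norm (coord (cop_apply A (hunit n j)) n)"
    unfolding entry_def by (rule Finite_Cartesian_Product.norm_nth_le)
  also have "\<dots> \<le> norm (cop_apply A (hunit n j))" by (rule norm_coord_le)
  also have "\<dots> \<le> norm A" using norm_cop_apply[of A "hunit n j"] by (simp add: norm_hunit)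
  finally show ?thesis .
qed

lemma entry_simps:
  "entry n (A + B) i j = entry n A i j + entry n B i j"
  "entry n (A - B) i j = entry n A i j - entry n B i j"
  "entry n (r *\<^sub>R A) i j = r *\<^sub>R entry n A i j"
  by (simp_all add: entry_def cop_apply_simps coord_simps)

lemma bounded_linear_entry: "bounded_linear (\<lambda>A. entry n A i j)"
  by (rule bounded_linear_intro[of _ 1]) (simp_all add: entry_simps cmod_entry_le)

definition block_proj :: "nat \<Rightarrow> cop" where
  "block_proj n = direct_sum (\<lambda>m. if m = n then mat 1 else 0)"

lemma coord_block_proj: "coord (cop_apply (block_proj n) x) m = (if m = n then coord x n else 0)"
proof -
  have "onorm ((*v) (if m = n then mat 1 else 0 :: complex^2^2)) \<le> 1" for m
    by (rule onorm_bound) auto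
  hence "bdd_above (range (\<lambda>m. onorm ((*v) (if m = n then mat 1 else 0 :: complex^2^2))))"
    by (intro bdd_aboveI[of _ 1]) auto
  from direct_sum_apply[OF this] show ?thesis by (simp add: block_proj_def)
qed

lemma cop_apply_hunit:
  assumes "block_proj n * A = A * block_proj n"
  shows "cop_apply A (hunit n j) = entry n A 1 j *\<^sub>C hunit n 1 + entry n A 2 j *\<^sub>C hunit n 2"
proof (rule hsum_eqI)
  fix m
  have "cop_apply (block_proj n) (hunit n j) = hunit n j"
    by (rule hsum_eqI) (simp add: coord_block_proj coord_hunit)
  hence "cop_apply A (hunit n j) = cop_apply (block_proj n) (cop_apply A (hunit n j))"
    using arg_cong[OF assms, of "\<lambda>X. cop_apply X (hunit n j)"] by (simp add: cop_apply_simps)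
  hence "coord (cop_apply A (hunit n j)) m = (if m = n then coord (cop_apply A (hunit n j)) n else 0)"
    by (metis coord_block_proj)
  thus "coord (cop_apply A (hunit n j)) m = coord (entry n A 1 j *\<^sub>C hunit n 1 + entry n A 2 j *\<^sub>C hunit n 2) m"
    by (auto simp: coord_simps coord_hunit vec_eq_iff entry_def axis_def forall_2)
qed

text \<open>The determinant of the traceless part of the \<open>n\<close>-th block.\<close>

definition block_disc :: "nat \<Rightarrow> cop \<Rightarrow> complex" where
  "block_disc n A = - (((entry n A 1 1 - entry n A 2 2) / 2)\<^sup>2 + entry n A 1 2 * entry n A 2 1)"

text \<open>A linear functional that vanishes on the span of the identity and the rotation
  generator, where everything would remain at \<open>\<delta> = 0\<close>.\<close>

definition off_sum :: "nat \<Rightarrow> cop \<Rightarrow> complex" where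
  "off_sum n A = entry n A 1 2 + entry n A 2 1"

lemma entry_hunit_combination:
  assumes "cop_apply A (hunit n j) = u *\<^sub>C hunit n 1 + v *\<^sub>C hunit n 2"
  shows "entry n A 1 j = u" "entry n A 2 j = v"
  by (simp_all add: entry_def assms coord_simps coord_hunit axis_def)

lemma entry_exp:
  assumes "block_proj n * A = A * block_proj n"
  defines "p \<equiv> exp ((entry n A 1 1 + entry n A 2 2) / 2)" and "g \<equiv> (entry n A 1 1 - entry n A 2 2) / 2"
    and "d \<equiv> block_disc n A"
  shows "entry n (exp A) 1 1 = p * (cos_sq d + sinc_sq d * g)"
    and "entry n (exp A) 2 1 = p * (sinc_sq d * entry n A 2 1)"
    and "entry n (exp A) 1 2 = p * (sinc_sq d * entry n A 1 2)"
    and "entry n (exp A) 2 2 = p * (cos_sq d - sinc_sq d * g)"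
proof -
  note e = cop_apply_exp_2x2[OF cop_apply_hunit[OF assms(1)] cop_apply_hunit[OF assms(1)],
    folded p_def g_def block_disc_def d_def]
  show "entry n (exp A) 1 1 = p * (cos_sq d + sinc_sq d * g)"
    "entry n (exp A) 2 1 = p * (sinc_sq d * entry n A 2 1)"
    by (rule entry_hunit_combination, subst e(1), simp add: scaleC_add scaleC_scaleC)+
  show "entry n (exp A) 1 2 = p * (sinc_sq d * entry n A 1 2)"
    "entry n (exp A) 2 2 = p * (cos_sq d - sinc_sq d * g)"
    by (rule entry_hunit_combination, subst e(2), simp add: scaleC_add scaleC_scaleC)+
qed

lemma exp_small_eq_1:
  assumes "exp (2 * z) = 1" "cmod z < pi"
  shows "z = 0"
proof -
  from assms(1) obtain k :: int where k: "Re (2 * z) = 0" "Im (2 * z) = of_int (2 * k) * pi"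
    unfolding exp_eq_1 by blast
  have "Im z = of_int k * pi" using k(2) by simp
  hence "\<bar>of_int k\<bar> * pi = \<bar>Im z\<bar>" by (simp add: abs_mult)
  also have "\<dots> < 1 * pi" using abs_Im_le_cmod[of z] assms(2) by linarith
  finally have "\<bar>real_of_int k\<bar> * pi < 1 * pi" .
  hence "k = 0" using pi_gt_zero by (simp only: mult_less_cancel_right_pos)
  with k show ?thesis by (simp add: complex_eq_iff)
qed

text \<open>Let \<open>p\<close> be half the trace of the block of \<open>F\<close>. The determinant
  of \<open>P\<close> is \<open>exp (2 * p)\<close>, so it being 1 leaves \<open>p\<close> in the
  multiples of \<open>pi * \<i>\<close>, and the norm bound on \<open>F\<close> leaves only 0. With
  \<open>S = sinc_sq d\<close> this gives \<open>off_sum n P = S * off_sum n F\<close> and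
  \<open>1 - \<tau>^2 = d * S^2\<close>; eliminating \<open>S\<close> yields the second
  identity.\<close>

lemma log1p_series_block:
  fixes X :: cop
  assumes X: "norm X \<le> 1 / 2" and comm: "block_proj n * X = X * block_proj n"
  defines "P \<equiv> 1 + X" and "F \<equiv> log1p_series X"
  defines "\<tau> \<equiv> (entry n P 1 1 + entry n P 2 2) / 2"
  assumes det: "entry n P 1 1 * entry n P 2 2 - entry n P 1 2 * entry n P 2 1 = 1"
  shows "cos_sq (block_disc n F) = \<tau>"
    and "(off_sum n F)\<^sup>2 * (1 - \<tau>\<^sup>2) = (off_sum n P)\<^sup>2 * block_disc n F"
proof -
  have X1: "norm X < 1" using X by linarith
  have cF: "block_proj n * F = F * block_proj n"
    unfolding F_def by (rule log1p_series_commute[OF X1 comm])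
  have exp_F: "exp F = P" unfolding F_def P_def by (rule exp_log1p_series[OF X1])
  define p where "p = (entry n F 1 1 + entry n F 2 2) / 2"
  define g where "g = (entry n F 1 1 - entry n F 2 2) / 2"
  define b where "b = entry n F 1 2"
  define c where "c = entry n F 2 1"
  define C where "C = cos_sq (block_disc n F)"
  define S where "S = sinc_sq (block_disc n F)"
  note e = entry_exp[OF cF, unfolded exp_F, folded p_def g_def b_def c_def C_def S_def]
  have d: "block_disc n F = - (g\<^sup>2 + b * c)" by (simp add: block_disc_def g_def b_def c_def)
  have CS: "C\<^sup>2 - (g\<^sup>2 + b * c) * S\<^sup>2 = 1"
    using cos_sq_sinc_sq[of "block_disc n F"] by (simp add: C_def S_def d algebra_simps)
  have "exp (2 * p) = exp p * exp p" by (simp add: exp_double power2_eq_square)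
  also have "\<dots> = (exp p * exp p) * (C\<^sup>2 - (g\<^sup>2 + b * c) * S\<^sup>2)" by (simp add: CS)
  also have "\<dots> = 1" using det unfolding e by (simp add: algebra_simps power2_eq_square)
  finally have "exp (2 * p) = 1" .
  moreover have "cmod p < pi"
  proof -
    have "norm F \<le> 1" unfolding F_def by (rule norm_log1p_series_le[OF X])
    hence "cmod (entry n F 1 1 + entry n F 2 2) \<le> 1 + 1"
      by (intro norm_triangle_mono order_trans[OF cmod_entry_le])
    thus ?thesis using pi_gt3 by (simp add: p_def norm_divide)
  qed
  ultimately have p: "p = 0" by (rule exp_small_eq_1)
  have \<tau>: "\<tau> = C" by (simp add: \<tau>_def e p)
  thus "cos_sq (block_disc n F) = \<tau>" by (simp add: C_def)
  have "off_sum n P = S * off_sum n F" by (simp add: off_sum_def e p b_def c_def algebra_simps)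
  moreover have "1 - \<tau>\<^sup>2 = block_disc n F * S\<^sup>2" using CS by (simp add: \<tau> d algebra_simps)
  ultimately show "(off_sum n F)\<^sup>2 * (1 - \<tau>\<^sup>2) = (off_sum n P)\<^sup>2 * block_disc n F"
    by (simp add: power_mult_distrib)
qed

lemma block_proj_direct_sum:
  assumes "bdd_above (range (\<lambda>n. onorm ((*v) (M n))))"
  shows "block_proj n * direct_sum M = direct_sum M * block_proj n"
  by (intro cop_eqI hsum_eqI) (simp add: cop_apply_simps direct_sum_apply[OF assms] coord_block_proj)

lemma entry_direct_sum:
  assumes "bdd_above (range (\<lambda>n. onorm ((*v) (M n))))"
  shows "entry n (direct_sum M) i j = M n $ i $ j"
  by (simp add: entry_def direct_sum_apply[OF assms] coord_hunit matrix_vector_mult_def axis_def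
      if_distrib[of "\<lambda>x. _ * x"] cong: if_cong)

section \<open>Entries and operator norms of the two blocks\<close>

lemma \<Delta>_minus: "\<Delta> (- \<delta>) = \<Delta> \<delta>"
  unfolding \<Delta>_def by (subst max.commute) simp

text \<open>This symmetry lets every fact about blocks be proved for \<open>block1\<close>
  alone.\<close>

lemma block2_eq_block1: "block2 \<alpha> \<delta> = block1 (- \<alpha>) (- \<delta>)"
  by (simp add: block1_def block2_def \<Delta>_minus)

lemma \<Delta>_ge_1: "\<Delta> \<delta> \<ge> 1"
proof -
  have "2 = cmod ((1 - \<delta>) + (1 + \<delta>))" by simp
  also have "\<dots> \<le> cmod (1 - \<delta>) + cmod (1 + \<delta>)" by (rule norm_triangle_ineq)
  finally show ?thesis by (simp add: \<Delta>_def max_def)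
qed

lemma \<Delta>_diff_1_le: "\<bar>\<Delta> \<delta> - 1\<bar> \<le> cmod \<delta>"
proof -
  have "\<Delta> \<delta> \<le> 1 + cmod \<delta>"
    using norm_triangle_ineq[of 1 \<delta>] norm_triangle_ineq4[of 1 \<delta>] by (simp add: \<Delta>_def)
  thus ?thesis using \<Delta>_ge_1[of \<delta>] by simp
qed

lemma block1_nth:
  fixes \<alpha> s :: real and \<delta> :: complex
  assumes "s = (pi - \<alpha>) / 2 / \<Delta> \<delta>"
  shows "block1 \<alpha> \<delta> $ 1 $ 1 = of_real s * \<delta>" "block1 \<alpha> \<delta> $ 1 $ 2 = - of_real s"
    "block1 \<alpha> \<delta> $ 2 $ 1 = of_real s" "block1 \<alpha> \<delta> $ 2 $ 2 = - (of_real s * \<delta>)"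
proof -
  have "block1 \<alpha> \<delta> = s *\<^sub>R vector [vector [\<delta>, -1], vector [1, -\<delta>]]"
    by (simp add: block1_def assms)
  thus "block1 \<alpha> \<delta> $ 1 $ 1 = of_real s * \<delta>" "block1 \<alpha> \<delta> $ 1 $ 2 = - of_real s"
    "block1 \<alpha> \<delta> $ 2 $ 1 = of_real s" "block1 \<alpha> \<delta> $ 2 $ 2 = - (of_real s * \<delta>)"
    by (simp_all add: scaleR_conv_of_real[where 'a = complex])
qed

lemma norm_vec2_sq: "(norm v)\<^sup>2 = (cmod (v $ 1))\<^sup>2 + (cmod (v $ 2))\<^sup>2" for v :: "complex^2"
  by (simp add: norm_vec_def L2_set_def sum_2)

lemma cmod_parallelogram: "(cmod (x + y))\<^sup>2 + (cmod (x - y))\<^sup>2 = 2 * ((cmod x)\<^sup>2 + (cmod y)\<^sup>2)"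
  by (simp only: cmod_power2) (simp add: power2_eq_square algebra_simps)

text \<open>In the orthogonal coordinates \<open>v $ 1 + v $ 2\<close> and
  \<open>v $ 1 - v $ 2\<close> the block is antidiagonal, with factors \<open>1 + \<delta>\<close>
  and \<open>1 - \<delta>\<close> up to sign and the scalar \<open>s\<close>. This explains the
  normalization by their maximal modulus \<open>\<Delta> \<delta>\<close>.\<close>

lemma norm_block1_sq:
  fixes \<alpha> :: real and \<delta> :: complex
  defines "s \<equiv> (pi - \<alpha>) / 2 / \<Delta> \<delta>"
  shows "(norm (block1 \<alpha> \<delta> *v v))\<^sup>2 = s\<^sup>2 / 2 *
    ((cmod (1 + \<delta>))\<^sup>2 * (cmod (v $ 1 - v $ 2))\<^sup>2 + (cmod (1 - \<delta>))\<^sup>2 * (cmod (v $ 1 + v $ 2))\<^sup>2)"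
proof -
  let ?x = "(block1 \<alpha> \<delta> *v v) $ 1" and ?y = "(block1 \<alpha> \<delta> *v v) $ 2"
  have xy: "?x = s * (\<delta> * v $ 1 - v $ 2)" "?y = s * (v $ 1 - \<delta> * v $ 2)"
    by (simp_all add: matrix_vector_mult_def sum_2 block1_nth[OF meta_eq_to_obj_eq[OF s_def]] algebra_simps)
  have sum: "?x + ?y = s * ((1 + \<delta>) * (v $ 1 - v $ 2))"
    and diff: "?x - ?y = - (s * ((1 - \<delta>) * (v $ 1 + v $ 2)))"
    by (simp_all add: xy algebra_simps)
  have "cmod (?x + ?y) = \<bar>s\<bar> * (cmod (1 + \<delta>) * cmod (v $ 1 - v $ 2))"
    "cmod (?x - ?y) = \<bar>s\<bar> * (cmod (1 - \<delta>) * cmod (v $ 1 + v $ 2))"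
    by (simp_all only: sum diff norm_minus_cancel norm_mult norm_of_real)
  hence "(cmod (?x + ?y))\<^sup>2 + (cmod (?x - ?y))\<^sup>2 =
    s\<^sup>2 * ((cmod (1 + \<delta>))\<^sup>2 * (cmod (v $ 1 - v $ 2))\<^sup>2 + (cmod (1 - \<delta>))\<^sup>2 * (cmod (v $ 1 + v $ 2))\<^sup>2)"
    by (simp only: power_mult_distrib power2_abs distrib_left)
  thus ?thesis unfolding norm_vec2_sq using cmod_parallelogram[of ?x ?y] by simp
qed

lemma norm_block1_le:
  assumes "\<bar>\<alpha>\<bar> \<le> pi"
  shows "norm (block1 \<alpha> \<delta> *v v) \<le> (pi - \<alpha>) / 2 * norm v"
proof (rule power2_le_imp_le)
  define s where "s = (pi - \<alpha>) / 2 / \<Delta> \<delta>"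
  have s: "s * \<Delta> \<delta> = (pi - \<alpha>) / 2" using \<Delta>_ge_1[of \<delta>] by (simp add: s_def)
  let ?q = "(cmod (1 + \<delta>))\<^sup>2 * (cmod (v $ 1 - v $ 2))\<^sup>2 + (cmod (1 - \<delta>))\<^sup>2 * (cmod (v $ 1 + v $ 2))\<^sup>2"
  have "?q \<le> (\<Delta> \<delta>)\<^sup>2 * (cmod (v $ 1 - v $ 2))\<^sup>2 + (\<Delta> \<delta>)\<^sup>2 * (cmod (v $ 1 + v $ 2))\<^sup>2"
    by (intro add_mono mult_right_mono power_mono) (auto simp: \<Delta>_def)
  also have "\<dots> = (\<Delta> \<delta>)\<^sup>2 * ((cmod (v $ 1 - v $ 2))\<^sup>2 + (cmod (v $ 1 + v $ 2))\<^sup>2)"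
    by (rule distrib_left[symmetric])
  also have "(cmod (v $ 1 - v $ 2))\<^sup>2 + (cmod (v $ 1 + v $ 2))\<^sup>2 = 2 * (norm v)\<^sup>2"
    unfolding norm_vec2_sq by (subst add.commute) (rule cmod_parallelogram)
  finally have q: "?q \<le> (\<Delta> \<delta>)\<^sup>2 * (2 * (norm v)\<^sup>2)" .
  have "(norm (block1 \<alpha> \<delta> *v v))\<^sup>2 = s\<^sup>2 / 2 * ?q"
    unfolding s_def by (rule norm_block1_sq)
  also have "\<dots> \<le> s\<^sup>2 / 2 * ((\<Delta> \<delta>)\<^sup>2 * (2 * (norm v)\<^sup>2))"
    using q by (rule mult_left_mono) simp
  also have "\<dots> = ((s * \<Delta> \<delta>) * norm v)\<^sup>2" by (simp add: power_mult_distrib)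
  finally show "(norm (block1 \<alpha> \<delta> *v v))\<^sup>2 \<le> ((pi - \<alpha>) / 2 * norm v)\<^sup>2" by (simp only: s)
qed (use assms in simp)

lemma bdd_above_block1:
  assumes "\<bar>\<alpha>\<bar> \<le> pi"
  shows "bdd_above (range (\<lambda>n. onorm ((*v) (block1 \<alpha> (\<delta> n)))))"
proof (rule bdd_aboveI)
  fix x assume "x \<in> range (\<lambda>n. onorm ((*v) (block1 \<alpha> (\<delta> n))))"
  then obtain n where "x = onorm ((*v) (block1 \<alpha> (\<delta> n)))" by blast
  thus "x \<le> (pi - \<alpha>) / 2" using onorm_le[OF norm_block1_le[OF assms]] by simp
qed

lemma norm_block1_attained:
  assumes "\<bar>\<alpha>\<bar> \<le> pi"
  obtains v where "v \<noteq> 0" "norm (block1 \<alpha> \<delta> *v v) = (pi - \<alpha>) / 2 * norm v"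
proof -
  define s where "s = (pi - \<alpha>) / 2 / \<Delta> \<delta>"
  have s: "s * \<Delta> \<delta> = (pi - \<alpha>) / 2" using \<Delta>_ge_1[of \<delta>] by (simp add: s_def)
  \<comment> \<open>The vector \<open>(1, \<epsilon>)\<close> has one vanishing coordinate in the
    sum-difference basis; the sign is chosen so that the larger of the two factors acts on the
    other.\<close>
  define \<epsilon> :: complex where "\<epsilon> = (if \<Delta> \<delta> = cmod (1 - \<delta>) then 1 else - 1)"
  define v :: "complex^2" where "v = vector [1, \<epsilon>]"
  have v: "v $ 1 = 1" "v $ 2 = \<epsilon>" by (simp_all add: v_def)
  have "(norm (block1 \<alpha> \<delta> *v v))\<^sup>2 = s\<^sup>2 / 2 * (4 * (\<Delta> \<delta>)\<^sup>2)"
    unfolding norm_block1_sq v s_def[symmetric] by (auto simp: \<epsilon>_def \<Delta>_def max_def split: if_splits)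
  also have "\<dots> = ((s * \<Delta> \<delta>) * norm v)\<^sup>2"
    using norm_vec2_sq[of v] by (simp add: power_mult_distrib v \<epsilon>_def)
  finally have "(norm (block1 \<alpha> \<delta> *v v))\<^sup>2 = ((pi - \<alpha>) / 2 * norm v)\<^sup>2" by (simp only: s)
  hence "norm (block1 \<alpha> \<delta> *v v) = (pi - \<alpha>) / 2 * norm v"
    using assms by (subst (asm) power2_eq_iff_nonneg) auto
  moreover have "v \<noteq> 0" using v(1) by auto
  ultimately show thesis by (rule that[rotated])
qed

lemma norm_direct_sum_block1:
  assumes "\<bar>\<alpha>\<bar> \<le> pi"
  shows "norm (direct_sum (\<lambda>n. block1 \<alpha> (\<delta> n))) = (pi - \<alpha>) / 2"
proof (rule antisym)
  let ?B = "direct_sum (\<lambda>n. block1 \<alpha> (\<delta> n))"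
  let ?c = "(pi - \<alpha>) / 2"
  have c: "?c \<ge> 0" using assms by simp
  note B_apply = direct_sum_apply[OF bdd_above_block1[OF assms]]
  have le: "norm (cop_apply ?B x) \<le> ?c * norm x" for x
  proof (rule power2_le_imp_le)
    have "(norm (cop_apply ?B x))\<^sup>2 \<le> (\<Sum>n. ?c\<^sup>2 * (norm (coord x n))\<^sup>2)"
      unfolding norm_hsum_sq
    proof (intro suminf_le summable_coord summable_mult)
      show "(norm (coord (cop_apply ?B x) n))\<^sup>2 \<le> ?c\<^sup>2 * (norm (coord x n))\<^sup>2" for n
        unfolding B_apply power_mult_distrib[symmetric] by (intro power_mono norm_block1_le assms) auto
    qed
    also have "\<dots> = (?c * norm x)\<^sup>2"
      by (simp only: suminf_mult[OF summable_coord] norm_hsum_sq power_mult_distrib)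
    finally show "(norm (cop_apply ?B x))\<^sup>2 \<le> (?c * norm x)\<^sup>2" .
  qed (use c in simp)
  show "norm ?B \<le> ?c" unfolding norm_cop_eq_onorm by (rule onorm_bound[OF c le])
  \<comment> \<open>Every block has the same norm, so a vector supported in block 0 already attains
    it.\<close>
  obtain v where v: "v \<noteq> 0" "norm (block1 \<alpha> (\<delta> 0) *v v) = ?c * norm v"
    using norm_block1_attained[OF assms] by blast
  have "summable (\<lambda>m. (norm (if m = 0 then v else 0))\<^sup>2)"
    by (rule summable_finite[of "{0}"]) auto
  moreover define x where "x = Abs_hsum (\<lambda>m. if m = 0 then v else 0)"
  ultimately have x: "coord x m = (if m = 0 then v else 0)" for m by (simp add: Abs_hsum_inverse)
  have "(\<lambda>m. (norm (coord x m))\<^sup>2) sums (norm v)\<^sup>2"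
    using sums_single[of 0 "\<lambda>m. (norm v)\<^sup>2"] by (simp add: x if_distrib[of "\<lambda>v. (norm v)\<^sup>2"] cong: if_cong)
  hence "(norm x)\<^sup>2 = (norm v)\<^sup>2" unfolding norm_hsum_sq by (simp add: sums_iff)
  hence nx: "norm x = norm v" by simp
  have "?c * norm v = norm (coord (cop_apply ?B x) 0)" by (simp only: B_apply x v(2) simp_thms if_True)
  also have "\<dots> \<le> norm (cop_apply ?B x)" by (rule norm_coord_le)
  also have "\<dots> \<le> norm ?B * norm v" using norm_cop_apply[of ?B x] by (simp only: nx)
  finally show "?c \<le> norm ?B" using v(1) by simp
qed

section \<open>Adjoints and exponentials\<close>

lemma bop_apply_exp_sums:
  fixes A :: "'a::{banach,perfect_space} bop"
  shows "(\<lambda>k. bop_apply (A ^ k) x /\<^sub>R fact k) sums bop_apply (exp A) x"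
proof -
  have "bounded_linear (\<lambda>A :: 'a bop. bop_apply A x)"
    by (rule bounded_linear_intro[of _ "norm x"]) (simp_all add: bop_apply_simps norm_bop_apply)
  from bounded_linear.sums[OF this summable_sums[OF summable_exp_generic[of A]]]
  show ?thesis by (simp add: exp_def bop_apply_simps)
qed

lemma is_real_adjoint_power:
  fixes A :: "'a::{real_inner,perfect_space} bop"
  assumes "is_real_adjoint A A'"
  shows "is_real_adjoint (A ^ k) (A' ^ k)"
proof (induction k)
  case 0
  show ?case by (simp add: is_real_adjoint_def bop_apply_one)
next
  case (Suc k)
  have "inner (bop_apply (A ^ Suc k) x) y = inner x (bop_apply (A' ^ k * A') y)" for x y
    using assms Suc.IH by (simp add: is_real_adjoint_def bop_apply_simps)
  thus ?case by (simp add: is_real_adjoint_def power_commutes)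
qed

lemma is_real_adjoint_exp:
  fixes A :: "'a::{real_inner,banach,perfect_space} bop"
  assumes "is_real_adjoint A A'"
  shows "is_real_adjoint (exp A) (exp A')"
  unfolding is_real_adjoint_def
proof (intro allI)
  fix x y
  have "(\<lambda>k. inner (bop_apply (A ^ k) x /\<^sub>R fact k) y) sums inner (bop_apply (exp A) x) y"
    by (rule bounded_linear.sums[OF bounded_linear_inner_left bop_apply_exp_sums])
  moreover have "(\<lambda>k. inner x (bop_apply (A' ^ k) y /\<^sub>R fact k)) sums inner x (bop_apply (exp A') y)"
    by (rule bounded_linear.sums[OF bounded_linear_inner_right bop_apply_exp_sums])
  moreover have "inner (bop_apply (A ^ k) x /\<^sub>R fact k) y = inner x (bop_apply (A' ^ k) y /\<^sub>R fact k)" for k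
    using is_real_adjoint_power[OF assms, of k] by (simp add: is_real_adjoint_def)
  ultimately show "inner (bop_apply (exp A) x) y = inner x (bop_apply (exp A') y)"
    by (simp add: sums_unique2)
qed

lemma orthogonal_exp_skew_symmetric:
  fixes A :: "'a::{real_inner,banach,perfect_space} bop"
  assumes "skew_symmetric A"
  shows "orthogonal_bop (exp A)"
  using is_real_adjoint_exp[of A "- A"] assms exp_minus_inverse[of A] exp_minus_inverse[of "- A"]
  unfolding orthogonal_bop_def skew_symmetric_def by (intro exI[of _ "exp (- A)"]) simp

lemma realify_exp: "realify (exp A) = exp (realify A)"
proof -
  have bl: "bounded_linear realify"
    by (rule bounded_linear_intro[of _ 1])
      (simp_all add: plus_cop.rep_eq scaleR_cop.rep_eq norm_cop.rep_eq)
  have "realify (A ^ k) = realify A ^ k" for k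
    by (induction k) (simp_all add: one_cop.rep_eq times_cop.rep_eq)
  hence "(\<lambda>k. realify A ^ k /\<^sub>R fact k) sums realify (exp A)"
    using bounded_linear.sums[OF bl summable_sums[OF summable_exp_generic[of A]]]
    by (simp add: exp_def scaleR_cop.rep_eq)
  thus ?thesis by (simp add: exp_def sums_iff)
qed

lemma cinner_scaleC_right: "cinner x (c *\<^sub>C y) = c * cinner x y"
proof -
  have "(\<Sum>i\<in>UNIV. cnj (coord x n $ i) * coord (c *\<^sub>C y) n $ i)
      = c * (\<Sum>i\<in>UNIV. cnj (coord x n $ i) * coord y n $ i)" for n
    by (simp add: coord_simps sum_distrib_left mult_ac)
  thus ?thesis unfolding cinner_def by (simp add: suminf_mult summable_cinner)
qed

lemma cinner_eq_inner: "cinner x y = Complex (inner x y) (inner x ((- \<i>) *\<^sub>C y))"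
  using Re_cinner[of x y] Re_cinner[of x "(- \<i>) *\<^sub>C y"]
  by (simp add: cinner_scaleC_right complex_eq_iff)

text \<open>The imaginary part of the Hermitian product is the real product with
  \<open>(- \<i>) y\<close>, and operators in \<open>cop\<close> commute with this scalar. The
  claims on skew-Hermitian and unitary operators thus reduce to their realifications.\<close>

lemma is_adjoint_if_real_adjoint:
  assumes "is_real_adjoint (realify A) (realify A')"
  shows "is_adjoint A A'"
  using assms unfolding is_adjoint_def is_real_adjoint_def cinner_eq_inner
  by (simp add: cop_apply_def[symmetric] cop_apply_scaleC[symmetric])

lemma skew_hermitian_if_skew_symmetric:
  assumes "skew_symmetric (realify A)"
  shows "skew_hermitian A"
  using assms is_adjoint_if_real_adjoint[of A "- A"]
  by (simp add: skew_symmetric_def skew_hermitian_def uminus_cop.rep_eq)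

lemma unitary_exp:
  assumes "skew_symmetric (realify A)"
  shows "unitary (exp A)"
proof -
  have "is_adjoint (exp A) (exp (- A))"
    by (rule is_adjoint_if_real_adjoint)
      (use is_real_adjoint_exp[OF assms[unfolded skew_symmetric_def]] in \<open>simp add: realify_exp uminus_cop.rep_eq\<close>)
  thus ?thesis
    using exp_minus_inverse[of A] exp_minus_inverse[of "- A"]
    unfolding unitary_def by (intro exI[of _ "exp (- A)"]) simp
qed

lemma skew_symmetric_direct_sum:
  assumes bdd: "bdd_above (range (\<lambda>n. onorm ((*v) (M n))))"
    and M: "\<And>n x y. inner (M n *v x) y = - inner x (M n *v y)"
  shows "skew_symmetric (realify (direct_sum M))"
  unfolding skew_symmetric_def is_real_adjoint_def bop_apply_simps cop_apply_def[symmetric]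
proof (intro allI)
  fix x y
  show "inner (cop_apply (direct_sum M) x) y = inner x (- cop_apply (direct_sum M) y)"
    unfolding inner_hsum_def by (simp add: direct_sum_apply[OF bdd] M coord_simps)
qed

lemma cmod_sin_le_near_0: "\<forall>\<^sub>F z :: complex in nhds 0. cmod (sin z) \<le> 2 * cmod z"
proof -
  have "((\<lambda>z :: complex. (sin z - sin 0) / (z - 0)) \<longlongrightarrow> cos 0) (at 0)"
    using DERIV_sin[of "0 :: complex"] by (simp add: has_field_derivative_iff)
  hence "((\<lambda>z :: complex. cmod (sin z / z)) \<longlongrightarrow> 1) (at 0)"
    using tendsto_norm by fastforce
  hence "\<forall>\<^sub>F z :: complex in at 0. cmod (sin z / z) < 2"
    by (rule order_tendstoD) simp
  hence "\<forall>\<^sub>F z :: complex in at 0. cmod (sin z) \<le> 2 * cmod z"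
    using eventually_neq_at_within[of 0 0 UNIV]
    by eventually_elim (simp add: norm_divide divide_simps)
  thus ?thesis by (simp add: eventually_nhds_conv_at)
qed

section \<open>The blocks along the radial extension\<close>

text \<open>For \<open>\<alpha>\<close> and \<open>\<delta>\<close> the matrix \<open>block1\<close>
  squares to minus the square of this number times the identity, so \<open>t\<close> times the angle
  is the argument of the sine and cosine in its exponential.\<close>

definition angle :: "real \<Rightarrow> complex \<Rightarrow> complex" where
  "angle \<alpha> \<delta> = of_real ((pi - \<alpha>) / 2 / \<Delta> \<delta>) * csqrt (1 - \<delta>\<^sup>2)"

text \<open>The product of the lower left entries of the two exponentials, each a sine divided by
  the root of \<open>1 - \<delta>^2\<close>. A change of sign of the root would not affect it. The
  argument \<open>z\<close> is complex so that the identity theorem can use an entire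
  function.\<close>

definition sin_prod :: "real \<Rightarrow> complex \<Rightarrow> complex \<Rightarrow> complex" where
  "sin_prod \<alpha> \<delta> z = sin (z * angle \<alpha> \<delta>) * sin (z * angle (- \<alpha>) \<delta>) / (1 - \<delta>\<^sup>2)"

definition half_trace :: "real \<Rightarrow> complex \<Rightarrow> complex \<Rightarrow> complex" where
  "half_trace \<alpha> \<delta> z = cos (z * angle \<alpha> \<delta>) * cos (z * angle (- \<alpha>) \<delta>) - (1 + \<delta>\<^sup>2) * sin_prod \<alpha> \<delta> z"

lemma entry_exp_block:
  assumes comm: "block_proj n * A = A * block_proj n"
    and A: "entry n A 1 1 = u * \<delta>" "entry n A 1 2 = - u" "entry n A 2 1 = u" "entry n A 2 2 = - (u * \<delta>)"
    and w: "w\<^sup>2 = 1 - \<delta>\<^sup>2" "w \<noteq> 0"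
  shows "entry n (exp A) 1 1 = cos (u * w) + sin (u * w) / w * \<delta>"
    "entry n (exp A) 1 2 = - (sin (u * w) / w)"
    "entry n (exp A) 2 1 = sin (u * w) / w"
    "entry n (exp A) 2 2 = cos (u * w) - sin (u * w) / w * \<delta>"
proof -
  have d: "block_disc n A = (u * w)\<^sup>2"
    by (simp add: block_disc_def A power_mult_distrib w) (simp add: power2_eq_square algebra_simps)
  have "w * (sinc_sq ((u * w)\<^sup>2) * u) = sin (u * w)"
    using sinc_sq_power2[of "u * w"] by (simp add: mult_ac)
  hence S: "sinc_sq ((u * w)\<^sup>2) * u = sin (u * w) / w" using w(2) by (simp add: field_simps)
  show "entry n (exp A) 1 1 = cos (u * w) + sin (u * w) / w * \<delta>"
    "entry n (exp A) 1 2 = - (sin (u * w) / w)"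
    "entry n (exp A) 2 1 = sin (u * w) / w"
    "entry n (exp A) 2 2 = cos (u * w) - sin (u * w) / w * \<delta>"
    unfolding entry_exp[OF comm] d cos_sq_power2
    by (simp_all add: A S[symmetric])
qed

lemma entry_mult:
  assumes "block_proj n * B = B * block_proj n"
  shows "entry n (A * B) i j = entry n A i 1 * entry n B 1 j + entry n A i 2 * entry n B 2 j"
  by (simp add: entry_def[of n "A * B"] cop_apply_simps cop_apply_hunit[OF assms] cop_apply_scaleC
      coord_simps) (simp add: entry_def mult.commute)

lemma entry_exp_scaled_block1:
  fixes t :: real and \<alpha> :: real and \<delta> :: "nat \<Rightarrow> complex"
  assumes \<alpha>: "\<bar>\<alpha>\<bar> \<le> pi" and \<delta>: "(\<delta> n)\<^sup>2 \<noteq> 1"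
  defines "B \<equiv> direct_sum (\<lambda>n. block1 \<alpha> (\<delta> n))" and "w \<equiv> csqrt (1 - (\<delta> n)\<^sup>2)"
  defines "a \<equiv> of_real t * angle \<alpha> (\<delta> n)"
  shows "entry n (exp (t *\<^sub>R B)) 1 1 = cos a + sin a / w * \<delta> n"
    "entry n (exp (t *\<^sub>R B)) 1 2 = - (sin a / w)"
    "entry n (exp (t *\<^sub>R B)) 2 1 = sin a / w"
    "entry n (exp (t *\<^sub>R B)) 2 2 = cos a - sin a / w * \<delta> n"
    "block_proj n * exp (t *\<^sub>R B) = exp (t *\<^sub>R B) * block_proj n"
proof -
  define s where "s = (pi - \<alpha>) / 2 / \<Delta> (\<delta> n)"
  note bdd = bdd_above_block1[OF \<alpha>, of \<delta>]
  have comm: "block_proj n * (t *\<^sub>R B) = (t *\<^sub>R B) * block_proj n"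
    using block_proj_direct_sum[OF bdd] by (simp add: B_def)
  have w: "w\<^sup>2 = 1 - (\<delta> n)\<^sup>2" "w \<noteq> 0" using \<delta> by (simp_all add: w_def)
  note e = entry_direct_sum[OF bdd] block1_nth[OF s_def]
  have a: "of_real (t * s) * w = a" by (simp add: a_def angle_def s_def w_def)
  note exp_block = entry_exp_block[OF comm _ _ _ _ w, of "of_real (t * s)", unfolded a]
  have "entry n (t *\<^sub>R B) 1 1 = of_real (t * s) * \<delta> n" "entry n (t *\<^sub>R B) 1 2 = - of_real (t * s)"
    "entry n (t *\<^sub>R B) 2 1 = of_real (t * s)" "entry n (t *\<^sub>R B) 2 2 = - (of_real (t * s) * \<delta> n)"
    by (simp_all add: entry_simps B_def e scaleR_conv_of_real[where 'a = complex])
  from exp_block[OF this]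
  show "entry n (exp (t *\<^sub>R B)) 1 1 = cos a + sin a / w * \<delta> n"
    "entry n (exp (t *\<^sub>R B)) 1 2 = - (sin a / w)"
    "entry n (exp (t *\<^sub>R B)) 2 1 = sin a / w"
    "entry n (exp (t *\<^sub>R B)) 2 2 = cos a - sin a / w * \<delta> n" .
  show "block_proj n * exp (t *\<^sub>R B) = exp (t *\<^sub>R B) * block_proj n"
    by (rule exp_commute[OF comm])
qed

lemma angle_minus: "angle \<alpha> (- \<delta>) = angle \<alpha> \<delta>"
  by (simp add: angle_def \<Delta>_minus)

text \<open>In the sum of the off-diagonal entries the mixed products of sine and cosine cancel, and
  only noncommutativity leaves a term, of first order in \<open>\<delta>\<close>. The determinant is
  1 because each factor has determinant \<open>cos^2 + sin^2\<close>.\<close>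

lemma entry_product:
  fixes t :: real and \<alpha> :: real and \<delta> :: "nat \<Rightarrow> complex"
  assumes \<alpha>: "\<bar>\<alpha>\<bar> \<le> pi" and \<delta>: "(\<delta> n)\<^sup>2 \<noteq> 1"
  defines "P \<equiv> exp (t *\<^sub>R direct_sum (\<lambda>n. block1 \<alpha> (\<delta> n))) * exp (t *\<^sub>R direct_sum (\<lambda>n. block2 \<alpha> (\<delta> n)))"
  shows "entry n P 1 1 + entry n P 2 2 = 2 * half_trace \<alpha> (\<delta> n) t"
    and "off_sum n P = - (4 * \<delta> n * sin_prod \<alpha> (\<delta> n) t)"
    and "entry n P 1 1 * entry n P 2 2 - entry n P 1 2 * entry n P 2 1 = 1"
    and "block_proj n * P = P * block_proj n"
proof -
  let ?A = "exp (t *\<^sub>R direct_sum (\<lambda>n. block1 \<alpha> (\<delta> n)))"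
  let ?B = "exp (t *\<^sub>R direct_sum (\<lambda>n. block2 \<alpha> (\<delta> n)))"
  define w where "w = csqrt (1 - (\<delta> n)\<^sup>2)"
  have w: "w\<^sup>2 = 1 - (\<delta> n)\<^sup>2" "w \<noteq> 0" using \<delta> by (simp_all add: w_def)
  define a where "a = of_real t * angle \<alpha> (\<delta> n)"
  define b where "b = of_real t * angle (- \<alpha>) (\<delta> n)"
  note A = entry_exp_scaled_block1[of \<alpha> \<delta> n, OF \<alpha> \<delta>, of t, folded w_def a_def]
  have B: "entry n ?B 1 1 = cos b - sin b / w * \<delta> n" "entry n ?B 1 2 = - (sin b / w)"
    "entry n ?B 2 1 = sin b / w" "entry n ?B 2 2 = cos b + sin b / w * \<delta> n"
    "block_proj n * ?B = ?B * block_proj n"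
    using entry_exp_scaled_block1[of "- \<alpha>" "\<lambda>n. - \<delta> n" n t] \<alpha> \<delta>
    by (simp_all add: block2_eq_block1 angle_minus w_def b_def)
  define x where "x = sin a / w"
  define y where "y = sin b / w"
  have "x * y = sin a * sin b / w\<^sup>2" by (simp add: x_def y_def power2_eq_square)
  hence xy: "x * y = sin_prod \<alpha> (\<delta> n) t" by (simp add: w(1) sin_prod_def a_def b_def)
  note P = entry_mult[OF B(5), of ?A] A(1-4)[folded x_def] B(1-4)[folded y_def]
  show "entry n P 1 1 + entry n P 2 2 = 2 * half_trace \<alpha> (\<delta> n) t"
    unfolding P_def P half_trace_def xy[symmetric] a_def[symmetric] b_def[symmetric]
    by (simp add: power2_eq_square algebra_simps)
  show "off_sum n P = - (4 * \<delta> n * sin_prod \<alpha> (\<delta> n) t)"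
    unfolding P_def off_sum_def P xy[symmetric] by (simp add: algebra_simps)
  have sq: "(cos a)\<^sup>2 + x\<^sup>2 * (1 - (\<delta> n)\<^sup>2) = 1" "(cos b)\<^sup>2 + y\<^sup>2 * (1 - (\<delta> n)\<^sup>2) = 1"
    using w(2) by (simp_all add: x_def y_def w(1)[symmetric] power_divide)
  have "entry n P 1 1 * entry n P 2 2 - entry n P 1 2 * entry n P 2 1
      = ((cos a)\<^sup>2 + x\<^sup>2 * (1 - (\<delta> n)\<^sup>2)) * ((cos b)\<^sup>2 + y\<^sup>2 * (1 - (\<delta> n)\<^sup>2))"
    unfolding P_def P by (simp add: power2_eq_square algebra_simps)
  thus "entry n P 1 1 * entry n P 2 2 - entry n P 1 2 * entry n P 2 1 = 1" by (simp only: sq mult_1)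
  have "block_proj n * (?A * ?B) = (?A * block_proj n) * ?B" by (simp only: mult.assoc[symmetric] A(5))
  also have "\<dots> = (?A * ?B) * block_proj n" by (simp only: mult.assoc B(5))
  finally show "block_proj n * P = P * block_proj n" by (simp only: P_def)
qed

lemma half_trace_holomorphic: "half_trace \<alpha> \<delta> holomorphic_on UNIV"
  \<comment> \<open>For \<open>\<delta>^2 = 1\<close> the division by zero in
    \<open>sin_prod\<close> gives 0, so holomorphy holds there as well.\<close>
  unfolding half_trace_def[abs_def] sin_prod_def by (cases "\<delta>\<^sup>2 = 1") (auto intro!: holomorphic_intros)

lemma sin_prod_holomorphic: "sin_prod \<alpha> \<delta> holomorphic_on UNIV"
  unfolding sin_prod_def[abs_def] by (cases "\<delta>\<^sup>2 = 1") (auto intro!: holomorphic_intros)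

lemma tendsto_block_disc:
  assumes "(f \<longlongrightarrow> A) F"
  shows "((\<lambda>t. block_disc n (f t)) \<longlongrightarrow> block_disc n A) F"
  unfolding block_disc_def
  by (intro tendsto_intros bounded_linear.tendsto[OF bounded_linear_entry assms]) auto

lemma tendsto_off_sum:
  assumes "(f \<longlongrightarrow> A) F"
  shows "((\<lambda>t. off_sum n (f t)) \<longlongrightarrow> off_sum n A) F"
  unfolding off_sum_def
  by (intro tendsto_intros bounded_linear.tendsto[OF bounded_linear_entry assms])

text \<open>For small \<open>t\<close> the sum \<open>f t\<close> is the logarithm series, which
  commutes with the block projection. For larger \<open>t\<close> this commutation is not claimed:
  both identities speak of entries of \<open>f t\<close> alone, and these are continued as scalar
  functions.\<close>

lemma radial_extension_block:
  fixes \<alpha> :: real and \<delta> :: "nat \<Rightarrow> complex"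
  assumes \<alpha>: "\<bar>\<alpha>\<bar> \<le> pi" and \<delta>: "(\<delta> n)\<^sup>2 \<noteq> 1"
  defines "B1 \<equiv> direct_sum (\<lambda>n. block1 \<alpha> (\<delta> n))" and "B2 \<equiv> direct_sum (\<lambda>n. block2 \<alpha> (\<delta> n))"
  defines "\<tau> \<equiv> half_trace \<alpha> (\<delta> n)" and "\<kappa> \<equiv> \<lambda>z. - (4 * \<delta> n * sin_prod \<alpha> (\<delta> n) z)"
  assumes f: "real_analytic_on f {0<..<1}"
    and sums: "\<forall>\<^sub>F t in at_right 0. (\<lambda>k. t ^ Suc k *\<^sub>R magnus B1 B2 (Suc k)) sums f t"
    and t: "t \<in> {0<..<1}"
  shows "cos_sq (block_disc n (f t)) = \<tau> t"
    and "(off_sum n (f t))\<^sup>2 * (1 - (\<tau> t)\<^sup>2) = (\<kappa> t)\<^sup>2 * block_disc n (f t)"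
proof -
  let ?X = "\<lambda>t. exp (t *\<^sub>R B1) * exp (t *\<^sub>R B2) - 1"
  obtain r where r: "r > 0" "\<And>t. \<bar>t\<bar> < r \<Longrightarrow> norm (?X t) \<le> 1 / 2"
    "\<And>t. \<bar>t\<bar> < r \<Longrightarrow> (\<lambda>k. t ^ Suc k *\<^sub>R magnus B1 B2 (Suc k)) sums log1p_series (?X t)"
    using magnus_near_0[of B1 B2] by blast
  have small: "cos_sq (block_disc n (f t)) = \<tau> t \<and>
      (off_sum n (f t))\<^sup>2 * (1 - (\<tau> t)\<^sup>2) = (\<kappa> t)\<^sup>2 * block_disc n (f t)"
    if t: "\<bar>t\<bar> < r" and s: "(\<lambda>k. t ^ Suc k *\<^sub>R magnus B1 B2 (Suc k)) sums f t" for t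
  proof -
    have ft: "f t = log1p_series (?X t)" using s r(3)[OF t] by (rule sums_unique2)
    note P = entry_product[of \<alpha> \<delta> n t, OF \<alpha> \<delta>, folded B1_def B2_def]
    have comm: "block_proj n * ?X t = ?X t * block_proj n"
      using P(4) by (simp add: left_diff_distrib right_diff_distrib)
    have X: "1 + ?X t = exp (t *\<^sub>R B1) * exp (t *\<^sub>R B2)" by simp
    note log = log1p_series_block[OF r(2)[OF t] comm, unfolded X, OF P(3)]
    show ?thesis using log unfolding ft P(1,2) \<tau>_def \<kappa>_def by simp
  qed
  have ev: "\<forall>\<^sub>F t in at_right 0. cos_sq (block_disc n (f t)) - \<tau> t = 0 \<and>
      (off_sum n (f t))\<^sup>2 * (1 - (\<tau> t)\<^sup>2) - (\<kappa> t)\<^sup>2 * block_disc n (f t) = 0"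
    using sums eventually_at_right_real[OF r(1)]
    by eventually_elim (use small in auto)
  note ext = locally_holomorphic_extension_real_analytic[OF f bounded_linear_entry]
  have const: "locally_holomorphic_extension (\<lambda>t. c) S" for c S
    by (rule locally_holomorphic_extension_of_real[of "\<lambda>z. c"]) simp
  have disc: "locally_holomorphic_extension (\<lambda>t. block_disc n (f t)) {0<..<1}"
  proof -
    have "locally_holomorphic_extension (\<lambda>t. - 1 * ((1 / 2 * (entry n (f t) 1 1 - entry n (f t) 2 2)) *
      (1 / 2 * (entry n (f t) 1 1 - entry n (f t) 2 2)) + entry n (f t) 1 2 * entry n (f t) 2 1)) {0<..<1}"
      by (intro locally_holomorphic_extension_intros ext const)
    thus ?thesis by (simp add: block_disc_def power2_eq_square)
  qed
  have off: "locally_holomorphic_extension (\<lambda>t. off_sum n (f t)) {0<..<1}"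
    unfolding off_sum_def by (intro locally_holomorphic_extension_intros ext)
  have tau: "locally_holomorphic_extension (\<lambda>t. \<tau> (complex_of_real t)) {0<..<1}"
    unfolding \<tau>_def by (rule locally_holomorphic_extension_of_real[OF half_trace_holomorphic])
  have kappa: "locally_holomorphic_extension (\<lambda>t. \<kappa> (complex_of_real t)) {0<..<1}"
    unfolding \<kappa>_def by (rule locally_holomorphic_extension_of_real) (intro holomorphic_intros sin_prod_holomorphic)
  have "locally_holomorphic_extension (\<lambda>t. cos_sq (block_disc n (f t)) - \<tau> t) {0<..<1}"
    by (intro locally_holomorphic_extension_intros locally_holomorphic_extension_compose[OF disc cos_sq_holomorphic] tau)
  from locally_holomorphic_extension_eq_0[OF this _ t]
  show "cos_sq (block_disc n (f t)) = \<tau> t" using ev by (simp add: eventually_conj_iff)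
  have "locally_holomorphic_extension (\<lambda>t. (off_sum n (f t))\<^sup>2 * (1 - (\<tau> t)\<^sup>2) - (\<kappa> t)\<^sup>2 * block_disc n (f t)) {0<..<1}"
    unfolding power2_eq_square by (intro locally_holomorphic_extension_intros disc off tau kappa const)
  from locally_holomorphic_extension_eq_0[OF this _ t]
  show "(off_sum n (f t))\<^sup>2 * (1 - (\<tau> t)\<^sup>2) = (\<kappa> t)\<^sup>2 * block_disc n (f t)"
    using ev by (simp add: eventually_conj_iff)
qed

lemma radial_limit_block:
  fixes \<alpha> :: real and \<delta> :: "nat \<Rightarrow> complex"
  assumes \<alpha>: "\<bar>\<alpha>\<bar> \<le> pi" and \<delta>: "(\<delta> n)\<^sup>2 \<noteq> 1"
  defines "B1 \<equiv> direct_sum (\<lambda>n. block1 \<alpha> (\<delta> n))" and "B2 \<equiv> direct_sum (\<lambda>n. block2 \<alpha> (\<delta> n))"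
  defines "\<tau> \<equiv> half_trace \<alpha> (\<delta> n)" and "\<kappa> \<equiv> \<lambda>z. - (4 * \<delta> n * sin_prod \<alpha> (\<delta> n) z)"
  assumes f: "real_analytic_on f {0<..<1}"
    and sums: "\<forall>\<^sub>F t in at_right 0. (\<lambda>k. t ^ Suc k *\<^sub>R magnus B1 B2 (Suc k)) sums f t"
    and S: "(f \<longlongrightarrow> S) (at_left 1)"
  shows "cos_sq (block_disc n S) = \<tau> 1"
    and "(off_sum n S)\<^sup>2 * (1 - (\<tau> 1)\<^sup>2) = (\<kappa> 1)\<^sup>2 * block_disc n S"
proof -
  note ext = radial_extension_block[of \<alpha> \<delta> n, OF \<alpha> \<delta>, folded B1_def B2_def, OF f sums,
      folded \<tau>_def]
  have cont: "isCont g 1 \<Longrightarrow> ((\<lambda>t. g (complex_of_real t)) \<longlongrightarrow> g 1) (at_left 1)" for g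
    by (rule isCont_tendsto_compose[of 1 g]) (auto intro!: tendsto_eq_intros)
  have holo_cont: "g holomorphic_on UNIV \<Longrightarrow> isCont g z" for g and z :: complex
    using holomorphic_on_imp_continuous_on continuous_on_eq_continuous_at open_UNIV by blast
  have tau: "((\<lambda>t. \<tau> (complex_of_real t)) \<longlongrightarrow> \<tau> 1) (at_left 1)"
    unfolding \<tau>_def by (intro cont holo_cont half_trace_holomorphic)
  have kappa: "((\<lambda>t. \<kappa> (complex_of_real t)) \<longlongrightarrow> \<kappa> 1) (at_left 1)"
    unfolding \<kappa>_def by (intro tendsto_intros cont holo_cont sin_prod_holomorphic)
  note disc = tendsto_block_disc[OF S, of n] and off = tendsto_off_sum[OF S, of n]
  have ev: "\<forall>\<^sub>F t in at_left 1. t \<in> {0<..<1::real}" by (rule eventually_at_left_real) simp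
  have "((\<lambda>t. cos_sq (block_disc n (f t))) \<longlongrightarrow> cos_sq (block_disc n S)) (at_left 1)"
    by (rule isCont_tendsto_compose[OF holo_cont[OF cos_sq_holomorphic] disc])
  moreover have "\<forall>\<^sub>F t in at_left 1. cos_sq (block_disc n (f t)) = \<tau> (of_real t)"
    using ev by eventually_elim (rule ext(1))
  ultimately have "((\<lambda>t. \<tau> (complex_of_real t)) \<longlongrightarrow> cos_sq (block_disc n S)) (at_left 1)"
    using tendsto_cong by force
  thus "cos_sq (block_disc n S) = \<tau> 1" using tau by (intro tendsto_unique[OF _ _ tau]) auto
  have "((\<lambda>t. (off_sum n (f t))\<^sup>2 * (1 - (\<tau> t)\<^sup>2)) \<longlongrightarrow> (off_sum n S)\<^sup>2 * (1 - (\<tau> 1)\<^sup>2)) (at_left 1)"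
    by (intro tendsto_intros off tau)
  moreover have "\<forall>\<^sub>F t in at_left 1. (off_sum n (f t))\<^sup>2 * (1 - (\<tau> t)\<^sup>2) = (\<kappa> t)\<^sup>2 * block_disc n (f t)"
    using ev by eventually_elim (simp only: ext(2) \<kappa>_def)
  ultimately have "((\<lambda>t. (\<kappa> t)\<^sup>2 * block_disc n (f t)) \<longlongrightarrow> (off_sum n S)\<^sup>2 * (1 - (\<tau> 1)\<^sup>2)) (at_left 1)"
    using tendsto_cong by force
  moreover have "((\<lambda>t. (\<kappa> t)\<^sup>2 * block_disc n (f t)) \<longlongrightarrow> (\<kappa> 1)\<^sup>2 * block_disc n S) (at_left 1)"
    by (intro tendsto_intros kappa disc)
  ultimately show "(off_sum n S)\<^sup>2 * (1 - (\<tau> 1)\<^sup>2) = (\<kappa> 1)\<^sup>2 * block_disc n S"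
    by (rule tendsto_unique[rotated]) simp
qed

section \<open>Limits as the parameters tend to zero\<close>

text \<open>The principal root \<open>w\<close> has nonnegative real part, so
  \<open>|w + 1| \<ge> 1\<close>, while \<open>(w - 1) (w + 1) = - \<delta>^2\<close>.\<close>

lemma cmod_csqrt_minus_1_le:
  "cmod (csqrt (1 - \<delta>\<^sup>2) - 1) \<le> (cmod \<delta>)\<^sup>2"
proof -
  let ?w = "csqrt (1 - \<delta>\<^sup>2)"
  have "Re ?w \<ge> 0" using csqrt_principal[of "1 - \<delta>\<^sup>2"] by auto
  hence "1 \<le> cmod (?w + 1)"
    using complex_Re_le_cmod[of "?w + 1"] by (simp only: plus_complex.sel one_complex.sel)
  hence "cmod (?w - 1) * 1 \<le> cmod (?w - 1) * cmod (?w + 1)" by (intro mult_left_mono) auto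
  also have "\<dots> = cmod (?w\<^sup>2 - 1)" by (simp add: norm_mult[symmetric] power2_eq_square algebra_simps del: power2_csqrt)
  also have "\<dots> = (cmod \<delta>)\<^sup>2" by (simp add: norm_power)
  finally show ?thesis by simp
qed

lemma angle_tendsto:
  assumes "\<delta> \<longlonglongrightarrow> 0"
  shows "(\<lambda>n. angle \<alpha> (\<delta> n)) \<longlonglongrightarrow> of_real ((pi - \<alpha>) / 2)"
proof -
  have "(\<lambda>n. cmod (\<delta> n)) \<longlonglongrightarrow> 0" by (rule tendsto_norm_zero[OF assms])
  hence sq: "(\<lambda>n. (cmod (\<delta> n))\<^sup>2) \<longlonglongrightarrow> 0" by (auto intro!: tendsto_eq_intros)
  have "(\<lambda>n. csqrt (1 - (\<delta> n)\<^sup>2) - 1) \<longlonglongrightarrow> 0"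
    by (rule Lim_null_comparison[OF _ sq]) (simp add: cmod_csqrt_minus_1_le)
  hence w: "(\<lambda>n. csqrt (1 - (\<delta> n)\<^sup>2)) \<longlonglongrightarrow> 1" by (simp add: LIM_zero_iff)
  have "(\<lambda>n. \<Delta> (\<delta> n) - 1) \<longlonglongrightarrow> 0"
    by (rule Lim_null_comparison[OF _ tendsto_norm_zero[OF assms]]) (simp add: \<Delta>_diff_1_le)
  hence "(\<lambda>n. \<Delta> (\<delta> n)) \<longlonglongrightarrow> 1" by (simp add: LIM_zero_iff)
  hence "(\<lambda>n. angle \<alpha> (\<delta> n)) \<longlonglongrightarrow> of_real ((pi - \<alpha>) / 2 / 1) * 1"
    unfolding angle_def by (intro tendsto_intros w) auto
  thus ?thesis by simp
qed

lemma sin_prod_tendsto: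
  assumes "\<delta> \<longlonglongrightarrow> 0"
  shows "(\<lambda>n. sin_prod \<alpha> (\<delta> n) (of_real t)) \<longlonglongrightarrow>
    of_real (sin (t * ((pi - \<alpha>) / 2)) * sin (t * ((pi + \<alpha>) / 2)))"
proof -
  have "(\<lambda>n. sin_prod \<alpha> (\<delta> n) (of_real t)) \<longlonglongrightarrow>
    sin (of_real t * of_real ((pi - \<alpha>) / 2)) * sin (of_real t * of_real ((pi - (- \<alpha>)) / 2)) / (1 - 0\<^sup>2)"
    unfolding sin_prod_def by (intro tendsto_intros angle_tendsto assms) auto
  thus ?thesis by (simp only: of_real_mult[symmetric] sin_of_real) simp
qed

text \<open>In the limit the two factors are commuting rotations, whose angles
  \<open>t (pi - \<alpha>) / 2\<close> and \<open>t (pi + \<alpha>) / 2\<close> add up to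
  \<open>t pi\<close>.\<close>

lemma half_trace_tendsto:
  assumes "\<delta> \<longlonglongrightarrow> 0"
  shows "(\<lambda>n. half_trace \<alpha> (\<delta> n) (of_real t)) \<longlonglongrightarrow> of_real (cos (t * pi))"
proof -
  have "(\<lambda>n. half_trace \<alpha> (\<delta> n) (of_real t)) \<longlonglongrightarrow>
    cos (of_real t * of_real ((pi - \<alpha>) / 2)) * cos (of_real t * of_real ((pi - (- \<alpha>)) / 2))
      - (1 + 0\<^sup>2) * of_real (sin (t * ((pi - \<alpha>) / 2)) * sin (t * ((pi + \<alpha>) / 2)))"
    unfolding half_trace_def by (intro tendsto_intros angle_tendsto sin_prod_tendsto assms)
  also have "cos (of_real t * of_real ((pi - \<alpha>) / 2)) * cos (of_real t * of_real ((pi - (- \<alpha>)) / 2))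
      - (1 + 0\<^sup>2) * of_real (sin (t * ((pi - \<alpha>) / 2)) * sin (t * ((pi + \<alpha>) / 2)))
    = complex_of_real (cos (t * ((pi - \<alpha>) / 2)) * cos (t * ((pi + \<alpha>) / 2))
        - sin (t * ((pi - \<alpha>) / 2)) * sin (t * ((pi + \<alpha>) / 2)))"
    by (simp add: cos_of_real[symmetric])
  also have "cos (t * ((pi - \<alpha>) / 2)) * cos (t * ((pi + \<alpha>) / 2))
        - sin (t * ((pi - \<alpha>) / 2)) * sin (t * ((pi + \<alpha>) / 2)) = cos (t * pi)"
    by (simp add: cos_add[symmetric] algebra_simps add_divide_distrib[symmetric])
  finally show ?thesis .
qed

text \<open>The two angles add up to \<open>pi + 2 x\<close> with \<open>x\<close> of order
  \<open>\<delta>\<close>; the first-order error comes from \<open>\<Delta>\<close>, the root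
  contributing only second order. As -1 is a critical value of cosine, the trace still deviates to
  second order only: \<open>1 + half_trace = 2 sin^2 x - 2 \<delta>^2 sin_prod\<close>. The constant
  collects \<open>|sin x| \<le> 2 pi |\<delta>|\<close> and \<open>|sin_prod| < 2\<close>.\<close>

lemma one_plus_half_trace_1_le:
  assumes "\<delta> \<longlonglongrightarrow> 0"
  shows "\<forall>\<^sub>F n in sequentially. cmod (1 + half_trace \<alpha> (\<delta> n) 1) \<le> (8 * pi\<^sup>2 + 4) * (cmod (\<delta> n))\<^sup>2"
proof -
  define x where "x n = of_real (pi / 2) * (csqrt (1 - (\<delta> n)\<^sup>2) / of_real (\<Delta> (\<delta> n)) - 1)" for n
  have nd: "(\<lambda>n. cmod (\<delta> n)) \<longlonglongrightarrow> 0" by (rule tendsto_norm_zero[OF assms])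
  have x_le: "cmod (x n) \<le> pi * cmod (\<delta> n)" if "cmod (\<delta> n) < 1" for n
  proof -
    let ?w = "csqrt (1 - (\<delta> n)\<^sup>2)"
    have \<Delta>: "\<Delta> (\<delta> n) \<ge> 1" by (rule \<Delta>_ge_1)
    have "cmod (?w - of_real (\<Delta> (\<delta> n))) \<le> cmod (?w - 1) + cmod (1 - of_real (\<Delta> (\<delta> n)))"
      by (rule norm_triangle_mono[of "?w - 1" _ "1 - of_real (\<Delta> (\<delta> n))", simplified]) auto
    also have "cmod (?w - 1) \<le> (cmod (\<delta> n))\<^sup>2" by (rule cmod_csqrt_minus_1_le)
    also have "(cmod (\<delta> n))\<^sup>2 \<le> cmod (\<delta> n)" using that by (simp add: power2_eq_square mult_left_le)
    also have "cmod (1 - of_real (\<Delta> (\<delta> n))) \<le> cmod (\<delta> n)"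
      using \<Delta>_diff_1_le[of "\<delta> n"] by (metis abs_minus_commute norm_of_real of_real_1 of_real_diff)
    finally have le: "cmod (?w - of_real (\<Delta> (\<delta> n))) \<le> 2 * cmod (\<delta> n)" by simp
    have "?w / of_real (\<Delta> (\<delta> n)) - 1 = (?w - of_real (\<Delta> (\<delta> n))) / of_real (\<Delta> (\<delta> n))"
      using \<Delta> by (simp add: diff_divide_distrib)
    hence "cmod (x n) = pi / 2 * (cmod (?w - of_real (\<Delta> (\<delta> n))) / \<Delta> (\<delta> n))"
      using \<Delta> by (simp add: x_def norm_mult norm_divide)
    also have "\<dots> \<le> pi / 2 * (2 * cmod (\<delta> n) / 1)"
      using \<Delta> le by (intro mult_left_mono frac_le) auto
    finally show ?thesis by simp
  qed
  have ev1: "\<forall>\<^sub>F n in sequentially. cmod (\<delta> n) < 1 / 2" using nd by (rule order_tendstoD) simp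
  have "x \<longlonglongrightarrow> 0"
  proof (rule Lim_null_comparison)
    show "\<forall>\<^sub>F n in sequentially. norm (x n) \<le> pi * cmod (\<delta> n)"
      using ev1 by eventually_elim (rule x_le, simp)
    show "(\<lambda>n. pi * cmod (\<delta> n)) \<longlonglongrightarrow> 0" using nd by (auto intro!: tendsto_eq_intros)
  qed
  hence ev2: "\<forall>\<^sub>F n in sequentially. cmod (sin (x n)) \<le> 2 * cmod (x n)"
    using cmod_sin_le_near_0 unfolding filterlim_iff by blast
  let ?L = "of_real (sin ((pi - \<alpha>) / 2) * sin ((pi + \<alpha>) / 2)) :: complex"
  have "cmod ?L \<le> 1 * 1"
    unfolding of_real_mult norm_mult norm_of_real by (intro mult_mono) auto
  moreover have "(\<lambda>n. cmod (sin_prod \<alpha> (\<delta> n) 1)) \<longlonglongrightarrow> cmod ?L"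
    using sin_prod_tendsto[OF assms, of \<alpha> 1] by (intro tendsto_norm) simp
  ultimately have ev3: "\<forall>\<^sub>F n in sequentially. cmod (sin_prod \<alpha> (\<delta> n) 1) < 2"
    by (intro order_tendstoD(2)) auto
  show ?thesis
    using ev1 ev2 ev3
  proof eventually_elim
    case (elim n)
    let ?a = "angle \<alpha> (\<delta> n)" and ?b = "angle (- \<alpha>) (\<delta> n)"
    have "(\<delta> n)\<^sup>2 \<noteq> 1"
    proof
      assume "(\<delta> n)\<^sup>2 = 1"
      hence "(cmod (\<delta> n))\<^sup>2 = 1" by (metis norm_one norm_power)
      moreover have "(cmod (\<delta> n))\<^sup>2 \<le> (1 / 2)\<^sup>2" using elim(1) by (intro power_mono) auto
      ultimately show False by (simp add: power2_eq_square)
    qed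
    hence nz: "1 - (\<delta> n)\<^sup>2 \<noteq> 0" by simp
    have ab: "?a + ?b = 2 * x n + of_real pi"
      by (simp add: angle_def x_def distrib_right[symmetric] of_real_add[symmetric] add_divide_distrib[symmetric] del: of_real_add)
        (simp add: algebra_simps)
    have "cos (?a + ?b) = 2 * (sin (x n))\<^sup>2 - 1"
      unfolding ab by (simp add: cos_add cos_of_real sin_of_real cos_double_sin)
    moreover have "sin ?a * sin ?b = (1 - (\<delta> n)\<^sup>2) * sin_prod \<alpha> (\<delta> n) 1"
      using nz by (simp add: sin_prod_def)
    ultimately have "1 + half_trace \<alpha> (\<delta> n) 1 = 2 * (sin (x n))\<^sup>2 - 2 * ((\<delta> n)\<^sup>2 * sin_prod \<alpha> (\<delta> n) 1)"
      by (simp add: half_trace_def cos_add algebra_simps)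
    hence "cmod (1 + half_trace \<alpha> (\<delta> n) 1)
        \<le> 2 * (cmod (sin (x n)))\<^sup>2 + 2 * ((cmod (\<delta> n))\<^sup>2 * cmod (sin_prod \<alpha> (\<delta> n) 1))"
      using norm_triangle_ineq4[of "2 * (sin (x n))\<^sup>2" "2 * ((\<delta> n)\<^sup>2 * sin_prod \<alpha> (\<delta> n) 1)"]
      by (simp add: norm_mult norm_power)
    also have "(cmod (sin (x n)))\<^sup>2 \<le> (2 * (pi * cmod (\<delta> n)))\<^sup>2"
      using elim(2) x_le[of n] elim(1) by (intro power_mono) auto
    also have "(cmod (\<delta> n))\<^sup>2 * cmod (sin_prod \<alpha> (\<delta> n) 1) \<le> (cmod (\<delta> n))\<^sup>2 * 2"
      using elim(3) by (intro mult_left_mono) auto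
    also have "2 * (2 * (pi * cmod (\<delta> n)))\<^sup>2 + 2 * ((cmod (\<delta> n))\<^sup>2 * 2) = (8 * pi\<^sup>2 + 4) * (cmod (\<delta> n))\<^sup>2"
      by (simp add: power_mult_distrib algebra_simps)
    finally show ?case by simp
  qed
qed

lemma eventually_sq_neq_1:
  fixes \<delta> :: "nat \<Rightarrow> complex"
  assumes "\<delta> \<longlonglongrightarrow> 0"
  shows "\<forall>\<^sub>F n in sequentially. (\<delta> n)\<^sup>2 \<noteq> 1"
proof (rule tendsto_imp_eventually_ne)
  show "(\<lambda>n. (\<delta> n)\<^sup>2) \<longlonglongrightarrow> 0" using assms by (auto intro!: tendsto_eq_intros)
qed simp

lemma off_sum_radial_tendsto_0:
  fixes \<alpha> :: real and \<delta> :: "nat \<Rightarrow> complex"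
  assumes \<alpha>: "\<bar>\<alpha>\<bar> \<le> pi" and \<delta>: "\<delta> \<longlonglongrightarrow> 0"
  defines "B1 \<equiv> direct_sum (\<lambda>n. block1 \<alpha> (\<delta> n))" and "B2 \<equiv> direct_sum (\<lambda>n. block2 \<alpha> (\<delta> n))"
  assumes f: "real_analytic_on f {0<..<1}"
    and sums: "\<forall>\<^sub>F t in at_right 0. (\<lambda>k. t ^ Suc k *\<^sub>R magnus B1 B2 (Suc k)) sums f t"
    and t: "t \<in> {0<..<1}"
  shows "(\<lambda>n. off_sum n (f t)) \<longlonglongrightarrow> 0"
proof -
  let ?\<tau> = "\<lambda>n. half_trace \<alpha> (\<delta> n) t" and ?\<kappa> = "\<lambda>n. - (4 * \<delta> n * sin_prod \<alpha> (\<delta> n) t)"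
  let ?K = "norm (f t)"
  \<comment> \<open>For \<open>t\<close> strictly between 0 and 1 the limit of
    \<open>1 - \<tau>^2\<close> in \<open>n\<close> is nonzero, so the identity can be solved for
    the square of the off-diagonal sum.\<close>
  have "cos (t * pi) \<noteq> 1" "cos (t * pi) \<noteq> - 1"
    using t cos_monotone_0_pi[of 0 "t * pi"] cos_monotone_0_pi[of "t * pi" pi] by auto
  hence "(cos (t * pi))\<^sup>2 \<noteq> 1" by (simp add: power2_eq_1_iff)
  hence ne: "1 - (complex_of_real (cos (t * pi)))\<^sup>2 \<noteq> 0" by (metis of_real_1 of_real_eq_iff of_real_power right_minus_eq)
  have lim: "(\<lambda>n. 1 - (?\<tau> n)\<^sup>2) \<longlonglongrightarrow> 1 - (complex_of_real (cos (t * pi)))\<^sup>2"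
    by (intro tendsto_intros half_trace_tendsto \<delta>)
  have "(\<lambda>n. ?\<kappa> n) \<longlonglongrightarrow> - (4 * 0 * of_real (sin (t * ((pi - \<alpha>) / 2)) * sin (t * ((pi + \<alpha>) / 2))))"
    by (intro tendsto_intros \<delta> sin_prod_tendsto)
  hence "(\<lambda>n. (?\<kappa> n)\<^sup>2) \<longlonglongrightarrow> 0\<^sup>2" by (intro tendsto_intros) simp
  hence kappa0: "Zfun (\<lambda>n. (?\<kappa> n)\<^sup>2) sequentially" by (simp add: tendsto_Zfun_iff)
  \<comment> \<open>No limit of the discriminants is known, but boundedness of the operator
    \<open>f t\<close> bounds them uniformly in \<open>n\<close>, which is enough next to a factor
    tending to 0.\<close>
  have d_le: "cmod (block_disc n (f t)) \<le> 2 * ?K\<^sup>2" for n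
  proof -
    have "cmod ((entry n (f t) 1 1 - entry n (f t) 2 2) / 2) \<le> ?K"
      using norm_triangle_ineq4[of "entry n (f t) 1 1" "entry n (f t) 2 2"]
        cmod_entry_le[of n "f t" 1 1] cmod_entry_le[of n "f t" 2 2] by (simp add: norm_divide)
    hence "cmod (((entry n (f t) 1 1 - entry n (f t) 2 2) / 2)\<^sup>2) \<le> ?K\<^sup>2"
      unfolding norm_power by (intro power_mono) auto
    moreover have "cmod (entry n (f t) 1 2 * entry n (f t) 2 1) \<le> ?K\<^sup>2"
      unfolding norm_mult power2_eq_square by (intro mult_mono cmod_entry_le) auto
    ultimately show ?thesis
      unfolding block_disc_def norm_minus_cancel
      using norm_triangle_ineq[of "((entry n (f t) 1 1 - entry n (f t) 2 2) / 2)\<^sup>2" "entry n (f t) 1 2 * entry n (f t) 2 1"]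
      by linarith
  qed
  have "Zfun (\<lambda>n. (?\<kappa> n)\<^sup>2 * block_disc n (f t)) sequentially"
    by (rule bounded_bilinear.Zfun_prod_Bfun[OF bounded_bilinear_mult kappa0 BfunI[where K = "2 * ?K\<^sup>2"]])
      (simp add: d_le)
  hence "(\<lambda>n. (?\<kappa> n)\<^sup>2 * block_disc n (f t)) \<longlonglongrightarrow> 0" by (simp add: tendsto_Zfun_iff)
  from tendsto_divide[OF this lim ne]
  have "(\<lambda>n. (?\<kappa> n)\<^sup>2 * block_disc n (f t) / (1 - (?\<tau> n)\<^sup>2)) \<longlonglongrightarrow> 0" by simp
  moreover have "\<forall>\<^sub>F n in sequentially. (?\<kappa> n)\<^sup>2 * block_disc n (f t) / (1 - (?\<tau> n)\<^sup>2) = (off_sum n (f t))\<^sup>2"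
    using tendsto_imp_eventually_ne[OF lim ne] eventually_sq_neq_1[OF \<delta>]
  proof eventually_elim
    case (elim n)
    from radial_extension_block(2)[of \<alpha> \<delta> n, OF \<alpha> elim(2), folded B1_def B2_def, OF f sums t] elim(1)
    show ?case by (simp add: field_simps)
  qed
  ultimately have "(\<lambda>n. (off_sum n (f t))\<^sup>2) \<longlonglongrightarrow> 0" using tendsto_cong by force
  hence "(\<lambda>n. sqrt (cmod ((off_sum n (f t))\<^sup>2))) \<longlonglongrightarrow> sqrt 0"
    by (intro tendsto_real_sqrt tendsto_norm_zero)
  hence "(\<lambda>n. cmod (off_sum n (f t))) \<longlonglongrightarrow> 0" by (simp add: norm_power)
  thus ?thesis by (rule tendsto_norm_zero_cancel)
qed

lemma off_sum_limit_bounded_below: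
  fixes \<alpha> :: real and \<delta> :: "nat \<Rightarrow> complex"
  assumes \<alpha>: "\<bar>\<alpha>\<bar> < pi" and \<delta>: "\<delta> \<longlonglongrightarrow> 0" and \<delta>0: "\<And>n. \<delta> n \<noteq> 0"
  defines "B1 \<equiv> direct_sum (\<lambda>n. block1 \<alpha> (\<delta> n))" and "B2 \<equiv> direct_sum (\<lambda>n. block2 \<alpha> (\<delta> n))"
  assumes f: "real_analytic_on f {0<..<1}"
    and sums: "\<forall>\<^sub>F t in at_right 0. (\<lambda>k. t ^ Suc k *\<^sub>R magnus B1 B2 (Suc k)) sums f t"
    and S: "(f \<longlongrightarrow> S) (at_left 1)"
  obtains \<eta> where "\<eta> > 0" "\<forall>\<^sub>F n in sequentially. \<eta> \<le> cmod (off_sum n S)"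
proof -
  let ?\<tau> = "\<lambda>n. half_trace \<alpha> (\<delta> n) 1" and ?\<kappa> = "\<lambda>n. - (4 * \<delta> n * sin_prod \<alpha> (\<delta> n) 1)"
  \<comment> \<open>Near 0 the function \<open>cos_sq\<close> stays within 1 of the value 1, whereas
    \<open>\<tau>\<close> approaches -1. This keeps the discriminant away from 0 and leaves the
    branch of its root undetermined.\<close>
  have "isCont cos_sq 0"
    using holomorphic_on_imp_continuous_on[OF cos_sq_holomorphic] by (simp add: continuous_on_eq_continuous_at)
  moreover have "cos_sq 0 = 1" using cos_sq_power2[of 0] by simp
  ultimately obtain d0 where d0: "d0 > 0" "\<And>d. cmod d < d0 \<Longrightarrow> cmod (cos_sq d - 1) < 1"
    unfolding continuous_at_eps_delta by (metis diff_zero dist_norm zero_less_one)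
  \<comment> \<open>Both sines equal \<open>cos (\<alpha> / 2)\<close>, so \<open>L\<close> is its
    square, positive because \<open>|\<alpha>| < pi\<close> is strict.\<close>
  define L where "L = sin ((pi - \<alpha>) / 2) * sin ((pi + \<alpha>) / 2)"
  have "L > 0" unfolding L_def using \<alpha> by (intro mult_pos_pos sin_gt_zero) (auto simp: abs_less_iff)
  have "(\<lambda>n. cmod (sin_prod \<alpha> (\<delta> n) 1)) \<longlonglongrightarrow> cmod (of_real L)"
    using sin_prod_tendsto[OF \<delta>, of \<alpha> 1] unfolding L_def by (intro tendsto_norm) simp
  hence ev1: "\<forall>\<^sub>F n in sequentially. cmod (sin_prod \<alpha> (\<delta> n) 1) > L / 2"
    by (rule order_tendstoD) (use \<open>L > 0\<close> in simp)
  have \<tau>: "?\<tau> \<longlonglongrightarrow> - 1" using half_trace_tendsto[OF \<delta>, of \<alpha> 1] by simp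
  have "(\<lambda>n. cmod (?\<tau> n - 1)) \<longlonglongrightarrow> cmod (- 1 - 1)" by (intro tendsto_intros \<tau>)
  hence lim: "(\<lambda>n. cmod (?\<tau> n - 1)) \<longlonglongrightarrow> 2" by simp
  have ev2: "\<forall>\<^sub>F n in sequentially. cmod (?\<tau> n - 1) > 1" by (rule order_tendstoD(1)[OF lim]) simp
  have ev3: "\<forall>\<^sub>F n in sequentially. cmod (?\<tau> n - 1) < 3" by (rule order_tendstoD(2)[OF lim]) simp
  \<comment> \<open>In \<open>1 - \<tau>^2 = - (\<tau> - 1) (1 + \<tau>)\<close> the first factor is
    bounded by 3 and the second by the constant found for the half trace.\<close>
  define C where "C = 3 * (8 * pi\<^sup>2 + 4)"
  have "C > 0" by (simp add: C_def add_nonneg_pos)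
  \<comment> \<open>Obtained by solving
    \<open>4 L^2 |\<delta>|^2 d0 \<le> |h|^2 C |\<delta>|^2\<close>, whose left side uses
    \<open>|\<kappa>| \<ge> 2 L |\<delta>|\<close>.\<close>
  define \<eta> where "\<eta> = sqrt (4 * L\<^sup>2 * d0 / C)"
  show thesis
  proof (rule that)
    show "\<eta> > 0" using \<open>C > 0\<close> \<open>L > 0\<close> d0(1) by (simp add: \<eta>_def)
    show "\<forall>\<^sub>F n in sequentially. \<eta> \<le> cmod (off_sum n S)"
      using ev1 ev2 ev3 one_plus_half_trace_1_le[OF \<delta>, of \<alpha>] eventually_sq_neq_1[OF \<delta>]
    proof eventually_elim
      case (elim n)
      have "\<bar>\<alpha>\<bar> \<le> pi" using \<alpha> by simp
      note lim = radial_limit_block[of \<alpha> \<delta> n, OF this elim(5), folded B1_def B2_def, OF f sums S]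
      let ?d = "block_disc n S"
      have d: "d0 \<le> cmod ?d"
        using d0(2)[of ?d] elim(2) unfolding lim(1) by linarith
      have sq: "cmod (1 - (?\<tau> n)\<^sup>2) \<le> C * (cmod (\<delta> n))\<^sup>2"
      proof -
        have "1 - (?\<tau> n)\<^sup>2 = - ((?\<tau> n - 1) * (1 + ?\<tau> n))" by (simp add: power2_eq_square algebra_simps)
        hence "cmod (1 - (?\<tau> n)\<^sup>2) = cmod (?\<tau> n - 1) * cmod (1 + ?\<tau> n)" by (simp only: norm_minus_cancel norm_mult)
        also have "\<dots> \<le> 3 * ((8 * pi\<^sup>2 + 4) * (cmod (\<delta> n))\<^sup>2)"
          using elim(3,4) by (intro mult_mono) auto
        finally show ?thesis by (simp only: C_def mult.assoc)
      qed
      have "(2 * L * cmod (\<delta> n))\<^sup>2 \<le> (4 * cmod (\<delta> n) * cmod (sin_prod \<alpha> (\<delta> n) 1))\<^sup>2"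
      proof (rule power_mono)
        show "2 * L * cmod (\<delta> n) \<le> 4 * cmod (\<delta> n) * cmod (sin_prod \<alpha> (\<delta> n) 1)"
          using mult_left_mono[OF less_imp_le[OF elim(1)], of "4 * cmod (\<delta> n)"] by simp
      qed (use \<open>L > 0\<close> in simp)
      also have "\<dots> = (cmod (?\<kappa> n))\<^sup>2" by (simp add: norm_mult)
      finally have k: "4 * L\<^sup>2 * (cmod (\<delta> n))\<^sup>2 \<le> (cmod (?\<kappa> n))\<^sup>2" by (simp add: power_mult_distrib)
      have "4 * L\<^sup>2 * (cmod (\<delta> n))\<^sup>2 * d0 \<le> (cmod (?\<kappa> n))\<^sup>2 * cmod ?d"
        using k d d0(1) by (intro mult_mono) auto
      also have "\<dots> = (cmod (off_sum n S))\<^sup>2 * cmod (1 - (?\<tau> n)\<^sup>2)"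
        using arg_cong[OF lim(2), of cmod] by (simp only: norm_mult norm_power)
      also have "\<dots> \<le> (cmod (off_sum n S))\<^sup>2 * (C * (cmod (\<delta> n))\<^sup>2)"
        using sq by (intro mult_left_mono) auto
      finally have "(4 * L\<^sup>2 * d0) * (cmod (\<delta> n))\<^sup>2 \<le> (C * (cmod (off_sum n S))\<^sup>2) * (cmod (\<delta> n))\<^sup>2"
        by (simp only: mult_ac)
      \<comment> \<open>The two sides are of the same order in \<open>\<delta> n\<close>, so
        division by its squared modulus, positive since \<open>\<delta> n \<noteq> 0\<close>, leaves
        a bound free of \<open>n\<close>.\<close>
      hence "4 * L\<^sup>2 * d0 \<le> C * (cmod (off_sum n S))\<^sup>2"
        using \<delta>0[of n] by (subst (asm) mult_le_cancel_right_pos) auto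
      hence "4 * L\<^sup>2 * d0 / C \<le> (cmod (off_sum n S))\<^sup>2"
        using \<open>C > 0\<close> by (simp add: pos_divide_le_eq mult.commute)
      thus ?case unfolding \<eta>_def by (intro real_le_lsqrt) auto
    qed
  qed
qed

lemma completely_divergent_magnus_blocks:
  fixes \<alpha> :: real and \<delta> :: "nat \<Rightarrow> complex"
  assumes \<alpha>: "\<bar>\<alpha>\<bar> < pi" and \<delta>: "\<delta> \<longlonglongrightarrow> 0" and \<delta>0: "\<And>n. \<delta> n \<noteq> 0"
  shows "completely_divergent (magnus (direct_sum (\<lambda>n. block1 \<alpha> (\<delta> n))) (direct_sum (\<lambda>n. block2 \<alpha> (\<delta> n))))"
  unfolding completely_divergent_def radially_converges_to_def
proof safe
  fix S f
  let ?B1 = "direct_sum (\<lambda>n. block1 \<alpha> (\<delta> n))" and ?B2 = "direct_sum (\<lambda>n. block2 \<alpha> (\<delta> n))"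
  assume f: "real_analytic_on f {0<..<1}"
    and sums: "\<forall>\<^sub>F t in at_right 0. (\<lambda>k. t ^ Suc k *\<^sub>R magnus ?B1 ?B2 (Suc k)) sums f t"
    and S: "(f \<longlongrightarrow> S) (at_left 1)"
  obtain \<eta> where \<eta>: "\<eta> > 0" "\<forall>\<^sub>F n in sequentially. \<eta> \<le> cmod (off_sum n S)"
    using off_sum_limit_bounded_below[OF \<alpha> \<delta> \<delta>0 f sums S] by blast
  \<comment> \<open>\<open>off_sum\<close> adds two entries, each bounded by the operator norm for
    every \<open>n\<close>, so a distance below \<open>\<eta> / 4\<close> moves it by less than
    \<open>\<eta> / 2\<close> in all blocks at once. One such \<open>t < 1\<close> is fixed before
    \<open>n\<close> grows.\<close>
  have "\<forall>\<^sub>F t in at_left 1. dist (f t) S < \<eta> / 4" by (rule tendstoD[OF S]) (use \<eta>(1) in simp)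
  moreover have "\<forall>\<^sub>F t in at_left 1. t \<in> {0<..<1::real}" by (rule eventually_at_left_real) simp
  ultimately have "\<exists>t\<in>{0<..<1}. dist (f t) S < \<eta> / 4"
    using eventually_happens[OF eventually_conj] trivial_limit_at_left_real by blast
  then obtain t where t: "t \<in> {0<..<1}" "norm (f t - S) < \<eta> / 4" by (auto simp: dist_norm)
  have "(\<lambda>n. cmod (off_sum n (f t))) \<longlonglongrightarrow> 0"
    by (rule tendsto_norm_zero, rule off_sum_radial_tendsto_0[OF _ \<delta> f sums t(1)]) (use \<alpha> in simp)
  hence "\<forall>\<^sub>F n in sequentially. cmod (off_sum n (f t)) < \<eta> / 2"
    by (rule order_tendstoD) (use \<eta>(1) in simp)
  with \<eta>(2) have "\<forall>\<^sub>F n in sequentially. False"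
  proof eventually_elim
    case (elim n)
    have "off_sum n (f t) - off_sum n S = entry n (f t - S) 1 2 + entry n (f t - S) 2 1"
      by (simp add: off_sum_def entry_simps)
    hence "cmod (off_sum n (f t) - off_sum n S) \<le> norm (f t - S) + norm (f t - S)"
      using norm_triangle_ineq[of "entry n (f t - S) 1 2" "entry n (f t - S) 2 1"]
        cmod_entry_le[of n "f t - S" 1 2] cmod_entry_le[of n "f t - S" 2 1] by simp
    moreover have "cmod (off_sum n S) \<le> cmod (off_sum n (f t)) + cmod (off_sum n (f t) - off_sum n S)"
      using norm_triangle_sub[of "off_sum n S" "off_sum n (f t)"] by (simp add: norm_minus_commute)
    ultimately show False using elim t(2) by linarith
  qed
  thus False by simp
qed

lemma inner_block1_skew:
  assumes "Re \<delta> = 0"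
  shows "inner (block1 \<alpha> \<delta> *v x) y = - inner x (block1 \<alpha> \<delta> *v y)"
  using assms
  by (simp add: inner_vec_def sum_2 matrix_vector_mult_def block1_nth[OF refl] inner_complex_def algebra_simps)

theorem theorem6p17:
  fixes \<alpha> :: real and \<delta> :: "nat \<Rightarrow> complex" and B1 B2 :: cop
  assumes "\<alpha> \<in> {-pi<..<pi}"
    and "\<And>n. \<delta> n \<noteq> 0"
    and "\<delta> \<longlonglongrightarrow> 0"
  defines "B1 \<equiv> direct_sum (\<lambda>n. block1 \<alpha> (\<delta> n))"
    and "B2 \<equiv> direct_sum (\<lambda>n. block2 \<alpha> (\<delta> n))"
  shows "norm B1 = (pi - \<alpha>) / 2 \<and> norm B2 = (pi + \<alpha>) / 2 \<and>
    completely_divergent (magnus B1 B2) \<and>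
    ((\<forall>n. Re (\<delta> n) = 0) \<longrightarrow>
      skew_hermitian B1 \<and> skew_hermitian B2 \<and>
      unitary (exp B1) \<and> unitary (exp B2) \<and>
      skew_symmetric (realify B1) \<and> skew_symmetric (realify B2) \<and>
      orthogonal_bop (exp (realify B1)) \<and> orthogonal_bop (exp (realify B2)))"
proof -
  have \<alpha>: "\<bar>\<alpha>\<bar> < pi" using assms(1) by auto
  have \<alpha>': "\<bar>\<alpha>\<bar> \<le> pi" "\<bar>- \<alpha>\<bar> \<le> pi" using \<alpha> by simp_all
  have B2: "B2 = direct_sum (\<lambda>n. block1 (- \<alpha>) (- \<delta> n))"
    by (simp add: B2_def block2_eq_block1)
  \<comment> \<open>The other six claims for purely imaginary parameters follow from these two
    through the lemmas on realification and exponentials.\<close>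
  have "skew_symmetric (realify B1)" "skew_symmetric (realify B2)" if "\<forall>n. Re (\<delta> n) = 0"
    unfolding B2 B1_def using that
    by (intro skew_symmetric_direct_sum bdd_above_block1 \<alpha>' inner_block1_skew, simp)+
  moreover have "norm B1 = (pi - \<alpha>) / 2" unfolding B1_def by (rule norm_direct_sum_block1[OF \<alpha>'(1)])
  moreover have "norm B2 = (pi + \<alpha>) / 2" unfolding B2 using norm_direct_sum_block1[OF \<alpha>'(2)] by simp
  moreover have "completely_divergent (magnus B1 B2)"
    unfolding B1_def B2_def by (rule completely_divergent_magnus_blocks[OF \<alpha> assms(3,2)])
  ultimately show ?thesis
    by (intro conjI impI skew_hermitian_if_skew_symmetric unitary_exp orthogonal_exp_skew_symmetric) auto
qed

end
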